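(* Let $N\in\mathbb N$ and let $\mathcal L:[0,T]\times(\mathbb R^d)^m\times\mathcal W_1(\mathbb R^d)\to\mathbb R$ be uniformly continuous. Then, for the functional $\mathcal F_N:E^m\to\mathbb R$ defined in the context, there exists $(\mathbf h_*,\mathbf g_* )\in E^m$ such that $$\mathcal F_N(\mathbf h_*,\mathbf g_* )=\min_{(\mathbf h,\mathbf g)\in E^m}\mathcal F_N(\mathbf h,\mathbf g).$$
   Context: Fix $d,m,\ell\in\mathbb N$ (all $\ge1$), $T>0$, $\sigma>0$, constants $M,L>0$, and a filtered probability space $(\Omega,\mathcal F,(\mathcal F_t),\mathbb P)$; Brownian motions are with respect to $(\mathcal F_t)$ and random initial data are $\mathcal F_0$-measurable. $\mathcal W_p(\mathbb R^d)$ is the space of Borel probability measures on $\mathbb R^d$ with finite $p$-th moment, with the $p$-Wasserstein distance. $H_1,H_2,K_1,K_2:\mathbb R^d\to\mathbb R^d$ are globally Lipschitz. Fix $\mu_0\in\mathcal W_p(\mathbb R^d)$ for some $p>1$, $\mathbf Y_0=(Y_0^1,\dots,Y_0^m)\in(\mathbb R^d)^m$, i.i.d. random variables $X_0^1,\dots,X_0^N$ with law $\mu_0$, and independent $d$-dimensional Brownian motions $W^1,\dots,W^N$. $\mathcal U\subset\mathbb R^{d\times\ell}$ is a compact set. $L^1([0,T];\mathcal U)$ is the set of integrable functions with values in $\mathcal U$. $\mathcal G$ is the compact subset of $C^0(\mathcal W_1(\mathbb R^d);\mathbb R^\ell)$ made up of the functions that are bounded by $M$ and $L$-Lipschitz.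 $E=L^1([0,T];\mathcal U)\times\mathcal G$, and elements of $E^m$ are written $(\mathbf h,\mathbf g)$ with $\mathbf h=(h^1,\dots,h^m)$, $\mathbf g=(g^1,\dots,g^m)$. $\Psi:(\mathbb R^{d\times\ell})^m\times(\mathbb R^\ell)^m\to\mathbb R$ is continuous and convex in the first variable. For $(\mathbf h,\mathbf g)\in E^m$, let $X^1,\dots,X^N,\mathbf Y=(Y^1,\dots,Y^m)$ be the (strong) solution of $$\begin{cases} dX^n(t)=\Big(\frac1N\sum_{l=1}^NH_1(X^l(t)-X^n(t))+\frac1m\sum_{j=1}^mK_1(Y^j(t)-X^n(t))\Big)dt+\sqrt{2\sigma}\,dW^n(t)\\ \frac{d}{dt}Y^i(t)=\frac1N\sum_{l=1}^NK_2(Y^i(t)-X^l(t))+\frac1m\sum_{j=1}^mH_2(Y^j(t)-Y^i(t))+h^i(t)\,g^i\Big(\frac1N\sum_{l=1}^N\delta_{X^l(t)}\Big)\\ X^n(0)=X_0^n,\ Y^i(0)=Y^i_0;\quad i=1,\dots,m,\ n=1,\dots,N,\end{cases}$$ where $h^i(t)g^i(\cdot)$ is the matrix-vector product, and set $$\mathcal F_N(\mathbf h,\mathbf g)=\mathbb E\Big[\int_0^T\mathcal L\Big(t,\mathbf Y(t),\frac1N\sum_{n=1}^N\delta_{X^n(t)}\Big)dt+\int_0^T\Psi\Big(\mathbf h(t),\mathbf g\Big(\frac1N\sum_{n=1}^N\delta_{X^n(t)}\Big)\Big)dt\Big],$$ where $\mathbf g(\mu)=(g^1(\mu),\dots,g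^m(\mu))$.
   Formalization: The compact set U is additionally assumed convex and non-empty; for U empty there are no controls, and for nonconvex U (e.g. U = {-1,1}, cost min(y^2,1), Ψ = (g-M)^2, zero kernels) the infimum need not be attained. *)

theory Defs
  imports "HOL-Probability.Probability"
begin

definition wasserstein_space :: "real \<Rightarrow> 'a::euclidean_space measure set" where
  "wasserstein_space p =
    {\<mu>. prob_space \<mu> \<and> sets \<mu> = sets borel \<and> integrable \<mu> (\<lambda>x. norm x powr p)}"

definition couplings ::
  "'a::euclidean_space measure \<Rightarrow> 'a measure \<Rightarrow> ('a \<times> 'a) measure set" where
  "couplings \<mu> \<nu> =
    {\<pi>. prob_space \<pi> \<and> sets \<pi> = sets borel \<and> distr \<pi> borel fst = \<mu> \<and> distr \<pi> borel snd = \<nu>}"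

definition wasserstein_dist ::
  "real \<Rightarrow> 'a::euclidean_space measure \<Rightarrow> 'a measure \<Rightarrow> real" where
  "wasserstein_dist p \<mu> \<nu> =
    (INF \<pi>\<in>couplings \<mu> \<nu>. \<integral>z. dist (fst z) (snd z) powr p \<partial>\<pi>) powr (1 / p)"

text \<open>The measure \<open>(1/N) (\<delta>\<^bsub>x 1\<^esub> + \<dots> + \<delta>\<^bsub>x N\<^esub>)\<close>, where \<open>N = CARD('n)\<close>,
  is the image under \<open>x\<close> of the uniform probability on the index set.\<close>

definition empirical :: "('n::finite \<Rightarrow> 'a::euclidean_space) \<Rightarrow> 'a measure" where
  "empirical x = distr (uniform_count_measure UNIV) borel x"

lemma emeasure_empirical:
  fixes x :: "'n::finite \<Rightarrow> 'a::euclidean_space"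
  assumes "A \<in> sets borel"
  shows "emeasure (empirical x) A =
    ennreal (1 / real CARD('n)) * (\<Sum>n\<in>UNIV. emeasure (return borel (x n)) A)"
proof -
  have "x \<in> measurable (uniform_count_measure UNIV) borel"
    by (simp add: measurable_def space_uniform_count_measure sets_uniform_count_measure)
  then have "emeasure (empirical x) A = ennreal (real (card (x -` A)) / real CARD('n))"
    unfolding empirical_def using assms
    by (simp add: emeasure_distr space_uniform_count_measure emeasure_uniform_count_measure)
  moreover have "(\<Sum>n\<in>UNIV. emeasure (return borel (x n)) A) = ennreal (real (card (x -` A)))"
  proof -
    have "(\<Sum>n\<in>UNIV. emeasure (return borel (x n)) A) = (\<Sum>n\<in>UNIV. indicator (x -` A) n)"
      using assms by (intro sum.cong) (auto simp: indicator_def)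
    also have "\<dots> = ennreal (real (card (x -` A)))"
      by (simp add: indicator_def sum.If_cases vimage_def ennreal_of_nat_eq_real_of_nat)
    finally show ?thesis .
  qed
  ultimately show ?thesis
    by (simp add: ennreal_mult[symmetric])
qed

text \<open>A standard \<open>d\<close>-dimensional Brownian motion with respect to the filtration \<open>F\<close>
  on the time set \<open>[0, \<infinity>)\<close>; all its sample paths are continuous.\<close>

definition brownian_motion ::
  "'w measure \<Rightarrow> (real \<Rightarrow> 'w measure) \<Rightarrow> (real \<Rightarrow> 'w \<Rightarrow> real ^ 'd) \<Rightarrow> bool" where
  "brownian_motion P F W \<longleftrightarrow>
    (\<forall>t\<ge>0. W t \<in> borel_measurable (F t)) \<and>
    (\<forall>\<omega>\<in>space P. continuous_on {0..} (\<lambda>t. W t \<omega>)) \<and>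
    (AE \<omega> in P. W 0 \<omega> = 0) \<and>
    (\<forall>s t. 0 \<le> s \<and> s < t \<longrightarrow>
      prob_space.indep_set P (sets (F s))
        {(\<lambda>\<omega>. W t \<omega> - W s \<omega>) -` B \<inter> space P | B. B \<in> sets borel} \<and>
      distributed P lborel (\<lambda>\<omega>. W t \<omega> - W s \<omega>)
        (\<lambda>x. ennreal (\<Prod>i\<in>UNIV. normal_density 0 (sqrt (t - s)) (x $ i))))"

text \<open>Elements of \<open>L\<^sup>1([0,T]; U)\<close> are represented by functions, not by classes modulo null sets;
  hence membership in \<open>U\<close> is required almost everywhere.\<close>

definition L1_controls :: "real \<Rightarrow> 'a::euclidean_space set \<Rightarrow> (real \<Rightarrow> 'a) set" where
  "L1_controls T U = {h. set_integrable lborel {0..T} h \<and> (AE t\<in>{0..T} in lborel. h t \<in> U)}"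

text \<open>Functions on the 1-Wasserstein space; only the values at measures in that space matter.\<close>

definition lipschitz_feedbacks ::
  "real \<Rightarrow> real \<Rightarrow> ((real ^ 'd) measure \<Rightarrow> real ^ 'l) set" where
  "lipschitz_feedbacks M L =
    {g. (\<forall>\<mu>\<in>wasserstein_space 1. norm (g \<mu>) \<le> M) \<and>
        (\<forall>\<mu>\<in>wasserstein_space 1. \<forall>\<nu>\<in>wasserstein_space 1.
           dist (g \<mu>) (g \<nu>) \<le> L * wasserstein_dist 1 \<mu> \<nu>)}"

definition control_pairs ::
  "real \<Rightarrow> (real ^ 'l ^ 'd) set \<Rightarrow> real \<Rightarrow> real \<Rightarrow>
    ((real \<Rightarrow> real ^ 'l ^ 'd) \<times> ((real ^ 'd) measure \<Rightarrow> real ^ 'l)) set" where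
  "control_pairs T U M L = L1_controls T U \<times> lipschitz_feedbacks M L"

text \<open>The \<open>m\<close>-th power of the preceding set, for \<open>m = CARD('m)\<close>, with its elements written
  as pairs of families.\<close>

definition control_tuples ::
  "real \<Rightarrow> (real ^ 'l ^ 'd) set \<Rightarrow> real \<Rightarrow> real \<Rightarrow>
    (('m::finite \<Rightarrow> real \<Rightarrow> real ^ 'l ^ 'd) \<times> ('m \<Rightarrow> (real ^ 'd) measure \<Rightarrow> real ^ 'l)) set" where
  "control_tuples T U M L = {(h, g). \<forall>i. (h i, g i) \<in> control_pairs T U M L}"

definition uniformly_continuous_cost ::
  "real \<Rightarrow> (real \<Rightarrow> real ^ 'd ^ 'm \<Rightarrow> (real ^ 'd) measure \<Rightarrow> real) \<Rightarrow> bool" where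
  "uniformly_continuous_cost T \<L> \<longleftrightarrow>
    (\<forall>\<epsilon>>0. \<exists>\<delta>>0. \<forall>t\<in>{0..T}. \<forall>t'\<in>{0..T}. \<forall>y y'.
       \<forall>\<mu>\<in>wasserstein_space 1. \<forall>\<mu>'\<in>wasserstein_space 1.
         dist t t' < \<delta> \<and> dist y y' < \<delta> \<and> wasserstein_dist 1 \<mu> \<mu>' < \<delta> \<longrightarrow>
         dist (\<L> t y \<mu>) (\<L> t' y' \<mu>') < \<epsilon>)"

text \<open>Since the noise is additive, the stochastic equation is stated in integral form without a
  stochastic integral. The controls are merely measurable in time, so the equation for \<open>Y\<close> is
  understood in integral (Caratheodory) form as well. All integrands below are integrable
  along continuous paths when the controls are admissible and \<open>U\<close> is compact.\<close>

definition strong_solution ::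
  "'w measure \<Rightarrow> (real \<Rightarrow> 'w measure) \<Rightarrow> real \<Rightarrow> real \<Rightarrow>
   (real ^ 'd \<Rightarrow> real ^ 'd) \<Rightarrow> (real ^ 'd \<Rightarrow> real ^ 'd) \<Rightarrow>
   (real ^ 'd \<Rightarrow> real ^ 'd) \<Rightarrow> (real ^ 'd \<Rightarrow> real ^ 'd) \<Rightarrow>
   ('n::finite \<Rightarrow> 'w \<Rightarrow> real ^ 'd) \<Rightarrow> real ^ 'd ^ 'm \<Rightarrow> ('n \<Rightarrow> real \<Rightarrow> 'w \<Rightarrow> real ^ 'd) \<Rightarrow>
   ('m::finite \<Rightarrow> real \<Rightarrow> real ^ 'l ^ 'd) \<Rightarrow> ('m \<Rightarrow> (real ^ 'd) measure \<Rightarrow> real ^ 'l) \<Rightarrow>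
   ('n \<Rightarrow> real \<Rightarrow> 'w \<Rightarrow> real ^ 'd) \<Rightarrow> (real \<Rightarrow> 'w \<Rightarrow> real ^ 'd ^ 'm) \<Rightarrow> bool" where
  "strong_solution P F T \<sigma> H1 H2 K1 K2 X0 Y0 W h g X Y \<longleftrightarrow>
    (\<forall>t\<in>{0..T}. \<forall>n. X n t \<in> borel_measurable (F t)) \<and>
    (\<forall>t\<in>{0..T}. Y t \<in> borel_measurable (F t)) \<and>
    (\<forall>\<omega>\<in>space P. \<forall>n. continuous_on {0..T} (\<lambda>t. X n t \<omega>)) \<and>
    (\<forall>\<omega>\<in>space P. continuous_on {0..T} (\<lambda>t. Y t \<omega>)) \<and>
    (AE \<omega> in P. \<forall>t\<in>{0..T}.
      (\<forall>n. X n t \<omega> = X0 n \<omega> +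
        (LINT s:{0..t}|lborel.
           (1 / real CARD('n)) *\<^sub>R (\<Sum>l\<in>UNIV. H1 (X l s \<omega> - X n s \<omega>)) +
           (1 / real CARD('m)) *\<^sub>R (\<Sum>j\<in>UNIV. K1 (Y s \<omega> $ j - X n s \<omega>))) +
        sqrt (2 * \<sigma>) *\<^sub>R W n t \<omega>) \<and>
      (\<forall>i. Y t \<omega> $ i = Y0 $ i +
        (LINT s:{0..t}|lborel.
           (1 / real CARD('n)) *\<^sub>R (\<Sum>l\<in>UNIV. K2 (Y s \<omega> $ i - X l s \<omega>)) +
           (1 / real CARD('m)) *\<^sub>R (\<Sum>j\<in>UNIV. H2 (Y s \<omega> $ j - Y s \<omega> $ i)) +
           h i s *v g i (empirical (\<lambda>l. X l s \<omega>)))))"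

definition expected_cost ::
  "'w measure \<Rightarrow> real \<Rightarrow>
   (real \<Rightarrow> real ^ 'd ^ 'm \<Rightarrow> (real ^ 'd) measure \<Rightarrow> real) \<Rightarrow>
   (real ^ 'l ^ 'd ^ 'm \<Rightarrow> real ^ 'l ^ 'm \<Rightarrow> real) \<Rightarrow>
   ('m::finite \<Rightarrow> real \<Rightarrow> real ^ 'l ^ 'd) \<Rightarrow> ('m \<Rightarrow> (real ^ 'd) measure \<Rightarrow> real ^ 'l) \<Rightarrow>
   ('n::finite \<Rightarrow> real \<Rightarrow> 'w \<Rightarrow> real ^ 'd) \<Rightarrow> (real \<Rightarrow> 'w \<Rightarrow> real ^ 'd ^ 'm) \<Rightarrow> real" where
  "expected_cost P T \<L> \<Psi> h g X Y =
    (\<integral>\<omega>. (LINT t:{0..T}|lborel. \<L> t (Y t \<omega>) (empirical (\<lambda>n. X n t \<omega>))) +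
         (LINT t:{0..T}|lborel.
            \<Psi> (\<chi> i. h i t) (\<chi> i. g i (empirical (\<lambda>n. X n t \<omega>)))) \<partial>P)"

text \<open>The solution is unique up to indistinguishability, and the expected cost does not depend
  on the version that is chosen.\<close>

definition cost_functional ::
  "'w measure \<Rightarrow> (real \<Rightarrow> 'w measure) \<Rightarrow> real \<Rightarrow> real \<Rightarrow>
   (real ^ 'd \<Rightarrow> real ^ 'd) \<Rightarrow> (real ^ 'd \<Rightarrow> real ^ 'd) \<Rightarrow>
   (real ^ 'd \<Rightarrow> real ^ 'd) \<Rightarrow> (real ^ 'd \<Rightarrow> real ^ 'd) \<Rightarrow>
   ('n::finite \<Rightarrow> 'w \<Rightarrow> real ^ 'd) \<Rightarrow> real ^ 'd ^ 'm \<Rightarrow> ('n \<Rightarrow> real \<Rightarrow> 'w \<Rightarrow> real ^ 'd) \<Rightarrow>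
   (real \<Rightarrow> real ^ 'd ^ 'm \<Rightarrow> (real ^ 'd) measure \<Rightarrow> real) \<Rightarrow>
   (real ^ 'l ^ 'd ^ 'm \<Rightarrow> real ^ 'l ^ 'm \<Rightarrow> real) \<Rightarrow>
   ('m::finite \<Rightarrow> real \<Rightarrow> real ^ 'l ^ 'd) \<times> ('m \<Rightarrow> (real ^ 'd) measure \<Rightarrow> real ^ 'l) \<Rightarrow> real" where
  "cost_functional P F T \<sigma> H1 H2 K1 K2 X0 Y0 W \<L> \<Psi> =
    (\<lambda>(h, g).
      let (X, Y) = (SOME (X, Y). strong_solution P F T \<sigma> H1 H2 K1 K2 X0 Y0 W h g X Y)
      in expected_cost P T \<L> \<Psi> h g X Y)"

end

theory Submission
  imports Defs "HOL-Complex_Analysis.Great_Picard"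
begin

text \<open>
  The direct method. Since the noise is additive, the system is for each \<open>\<omega>\<close> an integral equation
  for a continuous path, which Picard iteration solves and which is stable by Gronwall's
  inequality. Along a minimizing sequence the primitives of the controls converge and so do the
  feedbacks at empirical measures, so the trajectories converge for almost every \<open>\<omega>\<close>.
  Midpoint combinations of the controls converge almost everywhere (Mazur), so that convexity of
  \<open>\<Psi>\<close> gives lower semicontinuity of the control cost along the sequence.

  Trajectories of two admissible controls differ by at most a deterministic constant. As the
  running cost is uniformly continuous, it is integrable either for all controls or for none;
  hence no moment bounds for the Brownian motions or the initial data enter.
\<close>

section \<open>Path integrals and Gronwall's inequality\<close>

text \<open>The trajectory depends nonlinearly on the control, so a Mazur combination of controls
  does not drive the same combination of trajectories. Two limits are therefore kept apart.
  Trajectories are followed along the original sequence: the control enters the right-hand side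
  linearly and is tested there against a continuous function of the limit path, for which
  convergence of the primitives suffices. The control cost is first rewritten with the feedback
  values frozen at the limit path; only then is it a convex function of the control alone, and
  combinations may be taken. Both limits belong to one control, because combinations of ever later
  tails keep the limit of the primitives. Convexity of \<open>U\<close> keeps the combinations, and
  with them the limit control, admissible. A feedback acts on the dynamics only through its values
  at empirical measures, that is, through a Lipschitz function of finitely many particle positions.
  Compactness is needed only for these functions; the minimizing feedback itself must still be a map
  on the whole Wasserstein space.\<close>

lemma borel_measurable_Caratheodory:
  fixes \<phi> :: "'w \<Rightarrow> real \<Rightarrow> 'b::metric_space"
  assumes "0 \<le> T"
    and meas: "\<And>t. t \<in> {0..T} \<Longrightarrow> (\<lambda>\<omega>. \<phi> \<omega> t) \<in> borel_measurable N"
    and cont: "\<And>\<omega>. \<omega> \<in> space N \<Longrightarrow> continuous_on {0..T} (\<phi> \<omega>)"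
  shows "(\<lambda>x. \<phi> (fst x) (max 0 (min T (snd x)))) \<in> borel_measurable (N \<Otimes>\<^sub>M lborel)"
proof -
  define c where "c t = max 0 (min T t)" for t :: real
  have c: "c t \<in> {0..T}" for t using assms(1) by (auto simp: c_def)
  \<comment> \<open>Times are rounded down to the grid of mesh \<open>1 / Suc n\<close>. Each
    approximation takes countably many time values, so measurability at fixed times suffices, and
    continuity of the paths gives the limit. The clamp \<open>c\<close> is applied after the
    rounding, which may leave [0, T].\<close>
  define q where "q n t = of_int \<lfloor>real (Suc n) * t\<rfloor> / real (Suc n)" for n and t :: real
  have "(\<lambda>x. \<phi> (fst x) (c (q n (snd x)))) \<in> borel_measurable (N \<Otimes>\<^sub>M lborel)" for n
    unfolding q_def
  proof (rule measurable_compose_countable[where f="\<lambda>i x. \<phi> (fst x) (c (of_int i / real (Suc n)))"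
        and g="\<lambda>x. \<lfloor>real (Suc n) * snd x\<rfloor>"])
    show "(\<lambda>x. \<phi> (fst x) (c (of_int i / real (Suc n)))) \<in> borel_measurable (N \<Otimes>\<^sub>M lborel)" for i
      by (rule measurable_compose[OF measurable_fst meas[OF c]])
    show "(\<lambda>x. \<lfloor>real (Suc n) * snd x\<rfloor>) \<in> measurable (N \<Otimes>\<^sub>M lborel) (count_space UNIV)"
      by measurable
  qed
  moreover have "(\<lambda>n. \<phi> (fst x) (c (q n (snd x)))) \<longlonglongrightarrow> \<phi> (fst x) (c (snd x))"
    if x: "x \<in> space (N \<Otimes>\<^sub>M lborel)" for x
  proof -
    have "fst x \<in> space N" using x by (auto simp: space_pair_measure)
    have "(\<lambda>n. q n (snd x)) \<longlonglongrightarrow> snd x"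
    proof (rule real_tendsto_sandwich)
      show "\<forall>\<^sub>F n in sequentially. snd x - 1 / real (Suc n) \<le> q n (snd x)"
      proof (intro always_eventually allI)
        fix n
        have "real (Suc n) * snd x - 1 \<le> of_int \<lfloor>real (Suc n) * snd x\<rfloor>" by linarith
        then have "(real (Suc n) * snd x - 1) / real (Suc n) \<le> q n (snd x)"
          unfolding q_def by (intro divide_right_mono) auto
        then show "snd x - 1 / real (Suc n) \<le> q n (snd x)"
          by (simp add: diff_divide_distrib del: of_nat_Suc)
      qed
      show "\<forall>\<^sub>F n in sequentially. q n (snd x) \<le> snd x"
      proof (intro always_eventually allI)
        fix n
        have "of_int \<lfloor>real (Suc n) * snd x\<rfloor> \<le> real (Suc n) * snd x" by linarith
        then show "q n (snd x) \<le> snd x"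
          unfolding q_def by (simp add: field_simps del: of_nat_Suc)
      qed
      show "(\<lambda>n. snd x - 1 / real (Suc n)) \<longlonglongrightarrow> snd x"
        using tendsto_diff[OF tendsto_const LIMSEQ_inverse_real_of_nat, of "snd x"]
        by (simp add: inverse_eq_divide)
    qed simp
    then have "(\<lambda>n. c (q n (snd x))) \<longlonglongrightarrow> c (snd x)"
      unfolding c_def by (intro tendsto_intros)
    then show ?thesis
      using continuous_on_tendsto_compose[OF cont[OF \<open>fst x \<in> space N\<close>], of "\<lambda>n. c (q n (snd x))"] c
      by auto
  qed
  ultimately have "(\<lambda>x. \<phi> (fst x) (c (snd x))) \<in> borel_measurable (N \<Otimes>\<^sub>M lborel)"
    by (rule borel_measurable_LIMSEQ_metric)
  then show ?thesis by (simp add: c_def)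
qed

text \<open>Measurability of \<open>f\<close> is asked only after multiplication by the indicator,
  because a control is measurable on [0, T] only. The measure \<open>N\<close> is left open: it is
  \<open>F t\<close> where adaptedness is shown and \<open>P\<close> for the costs.\<close>

lemma borel_measurable_set_integral_paths:
  fixes \<phi> :: "'w \<Rightarrow> real \<Rightarrow> 'b::{second_countable_topology, banach}"
    and f :: "real \<Rightarrow> 'b \<Rightarrow> 'c::{second_countable_topology, banach}"
  assumes "0 \<le> T"
    and meas: "\<And>t. t \<in> {0..T} \<Longrightarrow> (\<lambda>\<omega>. \<phi> \<omega> t) \<in> borel_measurable N"
    and cont: "\<And>\<omega>. \<omega> \<in> space N \<Longrightarrow> continuous_on {0..T} (\<phi> \<omega>)"
    and f: "(\<lambda>(t, x). indicator {0..T} t *\<^sub>R f t x) \<in> borel_measurable (borel \<Otimes>\<^sub>M borel)"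
  shows "(\<lambda>\<omega>. LINT t:{0..T}|lborel. f t (\<phi> \<omega> t)) \<in> borel_measurable N"
proof -
  note [measurable] = borel_measurable_Caratheodory[OF assms(1-3)]
  have "(\<lambda>x. (snd x, \<phi> (fst x) (max 0 (min T (snd x))))) \<in> measurable (N \<Otimes>\<^sub>M lborel) (borel \<Otimes>\<^sub>M borel)"
    by measurable
  from measurable_compose[OF this f]
  have "(\<lambda>x. indicator {0..T} (snd x) *\<^sub>R f (snd x) (\<phi> (fst x) (max 0 (min T (snd x)))))
     \<in> borel_measurable (N \<Otimes>\<^sub>M lborel)" by simp
  also have "?this \<longleftrightarrow> (\<lambda>(\<omega>, t). indicator {0..T} t *\<^sub>R f t (\<phi> \<omega> t)) \<in> borel_measurable (N \<Otimes>\<^sub>M lborel)"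
    by (rule measurable_cong) (auto simp: indicator_def max_def min_def)
  finally show ?thesis
    unfolding set_lebesgue_integral_def
    by (rule lborel.borel_measurable_lebesgue_integral)
qed

lemma set_integrable_bounded:
  fixes f :: "real \<Rightarrow> 'b::{banach, second_countable_topology}"
  assumes "set_borel_measurable lborel {a..b} f" "AE s\<in>{a..b} in lborel. norm (f s) \<le> B"
  shows "set_integrable lborel {a..b} f"
proof (rule set_integrable_bound[OF _ assms(1)])
  show "set_integrable lborel {a..b} (\<lambda>_. B)"
    by (intro borel_integrable_atLeastAtMost' continuous_intros)
  show "AE x in lborel. x \<in> {a..b} \<longrightarrow> norm (f x) \<le> norm B"
    using assms(2) by eventually_elim (auto intro: order_trans)
qed

lemma set_borel_measurable_continuous_on_Icc:
  fixes f :: "real \<Rightarrow> 'b::{banach, second_countable_topology}"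
  assumes "continuous_on {a..b} f"
  shows "set_borel_measurable lborel {a..b} f"
  using borel_measurable_continuous_on_indicator[OF _ assms] by (simp add: set_borel_measurable_def)

lemma norm_set_integral_le:
  fixes u :: "real \<Rightarrow> 'b::{banach, second_countable_topology}"
  assumes "set_integrable lborel A u" "set_integrable lborel A g"
    "AE s\<in>A in lborel. norm (u s) \<le> g s"
  shows "norm (LINT s:A|lborel. u s) \<le> (LINT s:A|lborel. g s)"
proof -
  have "norm (LINT s:A|lborel. u s) \<le> (LINT s:A|lborel. norm (u s))"
    using set_integral_norm_bound[OF assms(1)] .
  also have "\<dots> \<le> (LINT s:A|lborel. g s)"
    using set_integral_mono_AE[OF set_integrable_norm[OF assms(1)] assms(2)] assms(3) by simp
  finally show ?thesis .
qed

lemma set_integral_eq_integral_continuous: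
  fixes f :: "real \<Rightarrow> 'b::euclidean_space"
  assumes "continuous_on {a..b} f"
  shows "(LINT s:{a..b}|lborel. f s) = integral {a..b} f"
  using set_borel_integral_eq_integral(2)[OF borel_integrable_atLeastAtMost'[OF assms]] .

text \<open>The forcing \<open>\<epsilon>\<close> is a function and enters the bound through its
  value at \<open>t\<close> and its integral. Bounded pointwise convergence of the forcing to zero
  is then enough for convergence of \<open>e\<close>; uniformity in time is not asked for.\<close>

lemma Gronwall_integral:
  fixes e \<epsilon> :: "real \<Rightarrow> real"
  assumes D: "0 \<le> D"
    and e: "continuous_on {0..T} e" and \<epsilon>: "continuous_on {0..T} \<epsilon>"
    and le: "\<And>t. t \<in> {0..T} \<Longrightarrow> e t \<le> \<epsilon> t + D * (LINT s:{0..t}|lborel. e s)"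
    and \<epsilon>0: "\<And>t. t \<in> {0..T} \<Longrightarrow> 0 \<le> \<epsilon> t"
    and t: "t \<in> {0..T}"
  shows "e t \<le> \<epsilon> t + D * exp (D * T) * (LINT s:{0..T}|lborel. \<epsilon> s)"
proof -
  define E where "E x = integral {0..x} e" for x
  define A where "A x = integral {0..x} \<epsilon>" for x
  have LE: "(LINT s:{0..x}|lborel. e s) = E x" if "x \<in> {0..T}" for x
    unfolding E_def using that
    by (intro set_integral_eq_integral_continuous continuous_on_subset[OF e]) auto
  have dE: "(E has_real_derivative e x) (at x)" and dA: "(A has_real_derivative \<epsilon> x) (at x)"
    if "0 < x" "x < T" for x
  proof -
    have x: "x \<in> {0..T}" "x \<in> interior {0..T}" using that by auto
    show "(E has_real_derivative e x) (at x)"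
      using integral_has_real_derivative[OF e x(1)] at_within_interior[OF x(2)]
      unfolding E_def by simp
    show "(A has_real_derivative \<epsilon> x) (at x)"
      using integral_has_real_derivative[OF \<epsilon> x(1)] at_within_interior[OF x(2)]
      unfolding A_def by simp
  qed
  have cE: "continuous_on {0..T} E" "continuous_on {0..T} A"
    unfolding E_def A_def
    by (intro indefinite_integral_continuous_1 integrable_continuous_real e \<epsilon>)+
  \<comment> \<open>The hypothesis says \<open>e - D * E \<le> \<epsilon>\<close>. With the
    integrating factor, the derivative of \<open>\<phi>\<close> is at most
    \<open>exp (- (D * x)) * \<epsilon> x - \<epsilon> x\<close>, which is not positive since
    \<epsilon> is nonnegative.\<close>
  define \<phi> where "\<phi> x = exp (- (D * x)) * E x - A x" for x
  have "\<phi> t \<le> \<phi> 0"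
  proof (rule DERIV_nonpos_imp_decreasing_open[of 0 t \<phi>])
    show "0 \<le> t" using t by auto
    show "continuous_on {0..t} \<phi>"
      unfolding \<phi>_def using t by (intro continuous_intros continuous_on_subset[OF cE(1)] continuous_on_subset[OF cE(2)]) auto
    fix x assume x: "0 < x" "x < t"
    then have xT: "0 < x" "x < T" "x \<in> {0..T}" using t by auto
    have "(\<phi> has_real_derivative exp (- (D * x)) * (e x - D * E x) - \<epsilon> x) (at x)"
      unfolding \<phi>_def using dE[OF xT(1,2)] dA[OF xT(1,2)]
      by (auto intro!: derivative_eq_intros simp: algebra_simps)
    moreover have "exp (- (D * x)) * (e x - D * E x) \<le> 1 * \<epsilon> x"
    proof -
      have "exp (- (D * x)) * (e x - D * E x) \<le> exp (- (D * x)) * \<epsilon> x"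
        using le[OF xT(3)] LE[OF xT(3)] by (intro mult_left_mono) auto
      also have "\<dots> \<le> 1 * \<epsilon> x"
        using D x \<epsilon>0[OF xT(3)] by (intro mult_right_mono) auto
      finally show ?thesis .
    qed
    ultimately show "\<exists>y. (\<phi> has_real_derivative y) (at x) \<and> y \<le> 0" by fastforce
  qed
  then have "exp (- (D * t)) * E t \<le> A t" by (simp add: \<phi>_def E_def A_def)
  then have "E t \<le> exp (D * t) * A t"
    by (simp add: exp_minus field_simps)
  also have "\<dots> \<le> exp (D * T) * A T"
  proof (rule mult_mono)
    show "exp (D * t) \<le> exp (D * T)" using t D by (auto intro: mult_left_mono)
    show "A t \<le> A T" unfolding A_def using t \<epsilon>0
      by (intro integral_subset_le integrable_continuous_real \<epsilon> continuous_on_subset[OF \<epsilon>]) auto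
    show "0 \<le> A t" unfolding A_def using t \<epsilon>0
      by (intro integral_nonneg integrable_continuous_real continuous_on_subset[OF \<epsilon>]) auto
  qed auto
  finally have "D * E t \<le> D * (exp (D * T) * A T)" using D by (rule mult_left_mono)
  moreover have "(LINT s:{0..T}|lborel. \<epsilon> s) = A T"
    unfolding A_def by (rule set_integral_eq_integral_continuous[OF \<epsilon>])
  ultimately show ?thesis using le[OF t] LE[OF t] by (simp add: algebra_simps)
qed

section \<open>Picard iteration and weak convergence\<close>

lemma continuous_on_Icc_bounded:
  fixes f :: "real \<Rightarrow> 'b::real_normed_vector"
  assumes "continuous_on {a..b} f"
  obtains B where "\<And>s. s \<in> {a..b} \<Longrightarrow> norm (f s) \<le> B"
proof -
  have "bounded (f ` {a..b})"
    by (intro compact_imp_bounded compact_continuous_image assms) simp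
  then show ?thesis using that unfolding bounded_iff by blast
qed

lemma continuous_on_indefinite_set_integral:
  fixes u :: "real \<Rightarrow> 'b::euclidean_space"
  assumes "set_integrable lborel {0..T} u"
  shows "continuous_on {0..T} (\<lambda>t. LINT s:{0..t}|lborel. u s)"
proof -
  have "continuous_on {0..T} (\<lambda>t. integral {0..t} u)"
    by (intro indefinite_integral_continuous_1 set_borel_integral_eq_integral(1)[OF assms])
  also have "?this \<longleftrightarrow> ?thesis"
    by (intro continuous_on_cong refl set_borel_integral_eq_integral(2)[symmetric]
        set_integrable_subset[OF assms]) auto
  finally show ?thesis .
qed

text \<open>The iterates are kept explicit as functions of the forcing \<open>w\<close>:
  measurability in \<omega> is proved for each of them by induction and passes to the solution as
  their pointwise limit.\<close>

primrec picard :: "(real \<Rightarrow> 'v::euclidean_space) \<Rightarrow> (real \<Rightarrow> 'v \<Rightarrow> 'v) \<Rightarrow> nat \<Rightarrow> real \<Rightarrow> 'v" where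
  "picard w f 0 = w"
| "picard w f (Suc n) = (\<lambda>t. w t + (LINT s:{0..t}|lborel. f s (picard w f n s)))"

lemma continuous_on_picard:
  fixes f :: "real \<Rightarrow> 'v::euclidean_space \<Rightarrow> 'v"
  assumes "continuous_on {0..T} w"
    and "\<And>z. continuous_on {0..T} z \<Longrightarrow> set_integrable lborel {0..T} (\<lambda>s. f s (z s))"
  shows "continuous_on {0..T} (picard w f n)"
  by (induction n) (auto intro!: continuous_intros continuous_on_indefinite_set_integral assms)

text \<open>The Lipschitz bound is asked only almost everywhere in time because a control obeys its
  bound only there. Convergence of the iterates belongs to the conclusion since adaptedness of the
  solution is derived from it.\<close>

lemma picard_converges:
  fixes f :: "real \<Rightarrow> 'v::euclidean_space \<Rightarrow> 'v"
  assumes D: "0 < D" and w: "continuous_on {0..T} w"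
    and int: "\<And>z. continuous_on {0..T} z \<Longrightarrow> set_integrable lborel {0..T} (\<lambda>s. f s (z s))"
    and lip: "AE s\<in>{0..T} in lborel. \<forall>x y. norm (f s x - f s y) \<le> D * norm (x - y)"
  obtains z where "continuous_on {0..T} z"
    "\<And>t. t \<in> {0..T} \<Longrightarrow> z t = w t + (LINT s:{0..t}|lborel. f s (z s))"
    "\<And>t. t \<in> {0..T} \<Longrightarrow> (\<lambda>n. picard w f n t) \<longlonglongrightarrow> z t"
proof -
  let ?p = "picard w f"
  have cont: "continuous_on {0..T} (?p n)" for n
    by (rule continuous_on_picard[OF w int])
  \<comment> \<open>One Picard step measured by an arbitrary continuous majorant \<open>g\<close> of
    the distance. An exponential \<open>g\<close> yields the geometric decay, a constant
    \<open>g\<close> the passage to the limit under the integral.\<close>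
  have step: "norm ((LINT s:{0..t}|lborel. f s (x s)) - (LINT s:{0..t}|lborel. f s (y s)))
      \<le> (LINT s:{0..t}|lborel. D * g s)"
    if x: "continuous_on {0..T} x" and y: "continuous_on {0..T} y" and g: "continuous_on {0..T} g"
      and le: "\<And>s. s \<in> {0..T} \<Longrightarrow> norm (x s - y s) \<le> g s" and t: "t \<in> {0..T}" for x y g t
  proof -
    have sub: "{0..t} \<subseteq> {0..T}" using t by auto
    have ix: "set_integrable lborel {0..t} (\<lambda>s. f s (x s))"
      and iy: "set_integrable lborel {0..t} (\<lambda>s. f s (y s))"
      using set_integrable_subset[OF int[OF x]] set_integrable_subset[OF int[OF y]] sub by auto
    have "set_integrable lborel {0..t} (\<lambda>s. D * g s)"
      by (intro borel_integrable_atLeastAtMost' continuous_intros continuous_on_subset[OF g sub])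
    moreover have "AE s\<in>{0..t} in lborel. norm (f s (x s) - f s (y s)) \<le> D * g s"
      using lip
    proof eventually_elim
      case (elim s)
      show ?case
      proof
        assume "s \<in> {0..t}"
        then have s: "s \<in> {0..T}" using sub by auto
        then have "norm (f s (x s) - f s (y s)) \<le> D * norm (x s - y s)" using elim by auto
        also have "\<dots> \<le> D * g s" using le[OF s] D by (intro mult_left_mono) auto
        finally show "norm (f s (x s) - f s (y s)) \<le> D * g s" .
      qed
    qed
    ultimately have "norm (LINT s:{0..t}|lborel. f s (x s) - f s (y s)) \<le> (LINT s:{0..t}|lborel. D * g s)"
      by (intro norm_set_integral_le set_integral_diff ix iy)
    then show ?thesis using set_integral_diff(2)[OF ix iy] by simp
  qed
  obtain S where S: "\<And>t. t \<in> {0..T} \<Longrightarrow> norm (?p (Suc 0) t - ?p 0 t) \<le> S"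
    using continuous_on_Icc_bounded[OF continuous_on_diff[OF cont cont]] by blast
  text \<open>In the norm weighted by \<open>exp (- 2 D t)\<close> the Picard operator contracts with factor \<open>1/2\<close>.\<close>
  have geo: "norm (?p (Suc n) t - ?p n t) \<le> \<bar>S\<bar> * exp (2 * D * t) / 2 ^ n" if "t \<in> {0..T}" for n t
    using that
  proof (induction n arbitrary: t)
    case 0
    have "\<bar>S\<bar> * 1 \<le> \<bar>S\<bar> * exp (2 * D * t)" using D 0 by (intro mult_left_mono) auto
    then show ?case using S[OF 0] by simp
  next
    case (Suc n)
    let ?g = "\<lambda>s. \<bar>S\<bar> * exp (2 * D * s) / 2 ^ n"
    let ?G = "\<lambda>s. \<bar>S\<bar> * exp (2 * D * s) / 2 ^ Suc n"
    have g: "continuous_on {0..T} ?g" by (intro continuous_intros) auto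
    have "?p (Suc (Suc n)) t - ?p (Suc n) t
        = (LINT s:{0..t}|lborel. f s (?p (Suc n) s)) - (LINT s:{0..t}|lborel. f s (?p n s))"
      by simp
    also have "norm \<dots> \<le> (LINT s:{0..t}|lborel. D * ?g s)"
      by (rule step[OF cont cont g Suc.IH Suc.prems])
    finally have "norm (?p (Suc (Suc n)) t - ?p (Suc n) t) \<le> (LINT s:{0..t}|lborel. D * ?g s)" .
    also have "\<dots> = integral {0..t} (\<lambda>s. D * ?g s)"
      by (intro set_integral_eq_integral_continuous continuous_intros) auto
    also have "\<dots> = ?G t - ?G 0"
    proof (rule integral_unique, rule fundamental_theorem_of_calculus)
      show "0 \<le> t" using Suc.prems by auto
      show "(?G has_vector_derivative D * ?g s) (at s within {0..t})" for s
        unfolding has_real_derivative_iff_has_vector_derivative[symmetric]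
        by (auto intro!: derivative_eq_intros simp: field_simps)
    qed
    also have "\<dots> \<le> ?G t" by simp
    finally show ?case .
  qed
  let ?M = "\<lambda>n. \<bar>S\<bar> * exp (2 * D * T) * (1 / 2) ^ n"
  have "uniform_limit {0..T} (\<lambda>n t. \<Sum>i<n. ?p (Suc i) t - ?p i t) (\<lambda>t. \<Sum>i. ?p (Suc i) t - ?p i t) sequentially"
  proof (rule Weierstrass_m_test)
    fix n t assume t: "t \<in> {0..T}"
    have "\<bar>S\<bar> * exp (2 * D * t) / 2 ^ n \<le> \<bar>S\<bar> * exp (2 * D * T) / 2 ^ n"
      using t D by (intro divide_right_mono mult_left_mono) auto
    then show "norm (?p (Suc n) t - ?p n t) \<le> ?M n"
      using geo[OF t, of n] by (simp add: power_one_over)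
  next
    show "summable ?M" by (intro summable_mult summable_geometric) auto
  qed
  moreover have "uniform_limit {0..T} (\<lambda>n. w) w sequentially"
    by (simp add: uniform_limit_iff)
  ultimately
  have "uniform_limit {0..T} (\<lambda>n t. w t + (\<Sum>i<n. ?p (Suc i) t - ?p i t))
      (\<lambda>t. w t + (\<Sum>i. ?p (Suc i) t - ?p i t)) sequentially"
    by (rule uniform_limit_add[rotated])
  moreover have "w t + (\<Sum>i<n. ?p (Suc i) t - ?p i t) = ?p n t" for n t
    unfolding sum_lessThan_telescope[of "\<lambda>i. ?p i t"] by simp
  ultimately
  have ul: "uniform_limit {0..T} (\<lambda>n t. ?p n t) (\<lambda>t. w t + (\<Sum>i. ?p (Suc i) t - ?p i t)) sequentially"
    by (simp only:)
  define z where "z = (\<lambda>t. w t + (\<Sum>i. ?p (Suc i) t - ?p i t))"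
  note ul = ul[folded z_def]
  have z: "continuous_on {0..T} z"
    by (rule uniform_limit_theorem[OF _ ul]) (auto intro!: always_eventually cont)
  have lim: "(\<lambda>n. ?p n t) \<longlonglongrightarrow> z t" if "t \<in> {0..T}" for t
    using tendsto_uniform_limitI[OF ul that] .
  show ?thesis
  proof (rule that[OF z _ lim])
    fix t assume t: "t \<in> {0..T}"
    have "(\<lambda>n. LINT s:{0..t}|lborel. f s (?p n s)) \<longlonglongrightarrow> (LINT s:{0..t}|lborel. f s (z s))"
    proof (rule tendstoI)
      fix e :: real assume "0 < e"
      define d where "d = e / (2 * (D * T + 1))"
      have DT: "0 \<le> D * T" using D t by auto
      have d: "0 < d" using DT \<open>0 < e\<close> by (auto simp: d_def)
      have "\<forall>\<^sub>F n in sequentially. \<forall>s\<in>{0..T}. dist (?p n s) (z s) < d"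
        using uniform_limitD[OF ul d] .
      then show "\<forall>\<^sub>F n in sequentially. dist (LINT s:{0..t}|lborel. f s (?p n s)) (LINT s:{0..t}|lborel. f s (z s)) < e"
      proof eventually_elim
        case (elim n)
        have "dist (LINT s:{0..t}|lborel. f s (?p n s)) (LINT s:{0..t}|lborel. f s (z s))
          \<le> (LINT s:{0..t}|lborel. D * d)"
          using elim unfolding dist_norm
          by (intro step[OF cont z _ _ t] continuous_intros) (auto simp: less_imp_le)
        also have "\<dots> = t * (D * d)" using t by (subst set_integral_const) auto
        also have "\<dots> \<le> T * (D * d)" using t D d by (intro mult_right_mono) auto
        also have "\<dots> = (D * T / (D * T + 1)) * (e / 2)" by (simp add: d_def algebra_simps)
        also have "\<dots> \<le> 1 * (e / 2)" using DT \<open>0 < e\<close> by (intro mult_right_mono) auto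
        also have "\<dots> < e" using \<open>0 < e\<close> by simp
        finally show ?case .
      qed
    qed
    then have "(\<lambda>n. ?p (Suc n) t) \<longlonglongrightarrow> w t + (LINT s:{0..t}|lborel. f s (z s))"
      by (auto intro!: tendsto_intros)
    moreover have "(\<lambda>n. ?p (Suc n) t) \<longlonglongrightarrow> z t"
      using lim[OF t] by (rule LIMSEQ_Suc)
    ultimately show "z t = w t + (LINT s:{0..t}|lborel. f s (z s))"
      using LIMSEQ_unique by blast
  qed
qed

section \<open>Weak convergence against continuous functions\<close>

lemma set_borel_measurable_bilinear:
  fixes pr :: "'a::euclidean_space \<Rightarrow> 'b::euclidean_space \<Rightarrow> 'c::euclidean_space"
  assumes "bounded_bilinear pr"
    and u: "set_borel_measurable lborel A u" and v: "set_borel_measurable lborel A v"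
  shows "set_borel_measurable lborel A (\<lambda>s. pr (u s) (v s))"
proof -
  interpret bounded_bilinear pr by fact
  have "(\<lambda>s. pr (indicator A s *\<^sub>R u s) (indicator A s *\<^sub>R v s)) \<in> borel_measurable lborel"
    using u v unfolding set_borel_measurable_def
    by (intro borel_measurable_continuous_Pair[of _ _ _ pr] continuous_intros
        bounded_bilinear.continuous_on[OF assms(1)])
  then show ?thesis
    unfolding set_borel_measurable_def
    by (rule measurable_cong[THEN iffD1, rotated])
      (auto simp: indicator_def zero_left)
qed

lemma set_integral_Icc_add:
  fixes u :: "real \<Rightarrow> 'b::euclidean_space"
  assumes "set_integrable lborel {0..T} u" "0 \<le> x" "x \<le> y" "y \<le> T"
  shows "(LINT s:{0..y}|lborel. u s) = (LINT s:{0..x}|lborel. u s) + (LINT s:{x..y}|lborel. u s)"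
proof -
  have *: "set_integrable lborel {a..b} u" if "0 \<le> a" "b \<le> T" for a b
    using that by (intro set_integrable_subset[OF assms(1)]) auto
  have "integral {0..x} u + integral {x..y} u = integral {0..y} u"
    using assms by (intro Henstock_Kurzweil_Integration.integral_combine set_borel_integral_eq_integral(1)[OF *]) auto
  then show ?thesis
    using assms by (simp add: set_borel_integral_eq_integral(2)[OF *])
qed

lemma set_integral_bilinear_const:
  fixes pr :: "'a::euclidean_space \<Rightarrow> 'b::euclidean_space \<Rightarrow> 'c::euclidean_space"
  assumes "bounded_bilinear pr" "set_integrable lborel A u"
  shows "(LINT s:A|lborel. pr (u s) c) = pr (LINT s:A|lborel. u s) c"
proof -
  interpret bounded_bilinear pr by fact
  have "integrable lborel (\<lambda>s. indicator A s *\<^sub>R u s)" using assms(2) by (simp add: set_integrable_def)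
  from integral_bounded_linear[OF bounded_linear_left this]
  show ?thesis by (simp add: set_lebesgue_integral_def scaleR_left)
qed

text \<open>If the primitives tend to zero, so do the integrals over every subinterval, which
  settles the case of a step function. Uniform continuity of \<open>\<phi>\<close> and the common
  bound \<open>R\<close> reduce the general case to it.\<close>

lemma bilinear_weak_convergence_zero:
  fixes d :: "nat \<Rightarrow> real \<Rightarrow> 'a::euclidean_space" and \<phi> :: "real \<Rightarrow> 'b::euclidean_space"
    and pr :: "'a \<Rightarrow> 'b \<Rightarrow> 'c::euclidean_space"
  assumes pr: "bounded_bilinear pr"
    and d: "\<And>k. set_integrable lborel {0..T} (d k)"
    and R: "\<And>k. AE s\<in>{0..T} in lborel. norm (d k s) \<le> R"
    and lim: "\<And>t. t \<in> {0..T} \<Longrightarrow> (\<lambda>k. LINT s:{0..t}|lborel. d k s) \<longlonglongrightarrow> 0"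
    and \<phi>: "continuous_on {0..T} \<phi>" and t: "t \<in> {0..T}"
  shows "(\<lambda>k. LINT s:{0..t}|lborel. pr (d k s) (\<phi> s)) \<longlonglongrightarrow> 0"
proof (rule tendstoI)
  fix e :: real assume "0 < e"
  interpret bounded_bilinear pr by fact
  obtain K where K: "0 < K" "\<And>a b. norm (pr a b) \<le> norm a * norm b * K" using pos_bounded by blast
  \<comment> \<open>Replacing \<open>\<phi>\<close> on each mesh interval by its value at the left
    end costs at most \<open>T * (\<bar>R\<bar> * \<rho> * K)\<close> in total, and this choice
    makes that at most \<open>e / 2\<close>.\<close>
  define \<rho> where "\<rho> = e / (2 * (\<bar>R\<bar> * K * T + 1))"
  have RKT: "0 \<le> \<bar>R\<bar> * K * T" using K t by auto
  have \<rho>: "0 < \<rho>" using RKT \<open>0 < e\<close> by (auto simp: \<rho>_def)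
  have "uniformly_continuous_on {0..T} \<phi>" by (intro compact_uniformly_continuous \<phi>) auto
  then obtain \<delta> where \<delta>: "0 < \<delta>"
    "\<And>s s'. s \<in> {0..T} \<Longrightarrow> s' \<in> {0..T} \<Longrightarrow> dist s' s < \<delta> \<Longrightarrow> dist (\<phi> s') (\<phi> s) < \<rho>"
    using \<rho> unfolding uniformly_continuous_on_def by metis
  obtain N :: nat where N: "T / \<delta> < real N" using reals_Archimedean2 by blast
  have N0: "0 < real N" using N t \<delta> by (smt (verit) atLeastAtMost_iff divide_nonneg_pos)
  define \<eta> where "\<eta> = t / real N"
  have \<eta>: "0 \<le> \<eta>" "\<eta> < \<delta>" "real N * \<eta> = t"
  proof -
    show "0 \<le> \<eta>" "real N * \<eta> = t" using t N0 by (auto simp: \<eta>_def)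
    have "t < real N * \<delta>" using N \<delta>(1) t by (simp add: field_simps)
    then show "\<eta> < \<delta>" unfolding \<eta>_def using N0 by (simp add: field_simps)
  qed
  have m: "set_borel_measurable lborel {0..T} (d k)" for k
    using d[of k] unfolding set_integrable_def set_borel_measurable_def by auto
  have int: "set_integrable lborel {0..T} (\<lambda>s. pr (d k s) (\<psi> s))"
    if \<psi>: "continuous_on {0..T} \<psi>" for k \<psi>
  proof -
    obtain B where B: "\<And>s. s \<in> {0..T} \<Longrightarrow> norm (\<psi> s) \<le> B"
      using continuous_on_Icc_bounded[OF \<psi>] by blast
    show ?thesis
    proof (rule set_integrable_bounded)
      show "set_borel_measurable lborel {0..T} (\<lambda>s. pr (d k s) (\<psi> s))"
        by (rule set_borel_measurable_bilinear[OF pr m set_borel_measurable_continuous_on_Icc[OF \<psi>]])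
      show "AE s\<in>{0..T} in lborel. norm (pr (d k s) (\<psi> s)) \<le> \<bar>R\<bar> * \<bar>B\<bar> * K"
        using R[of k]
      proof eventually_elim
        case (elim s)
        show ?case
        proof
          assume s: "s \<in> {0..T}"
          have "norm (pr (d k s) (\<psi> s)) \<le> norm (d k s) * norm (\<psi> s) * K" by (rule K)
          also have "\<dots> \<le> \<bar>R\<bar> * \<bar>B\<bar> * K"
            using elim s B[OF s] K by (intro mult_mono) auto
          finally show "norm (pr (d k s) (\<psi> s)) \<le> \<bar>R\<bar> * \<bar>B\<bar> * K" .
        qed
      qed
    qed
  qed
  \<comment> \<open>The tolerance \<open>\<gamma>\<close> is arbitrary, so that each induction step
    can spend half of it on the new mesh interval and hand the other half to the induction
    hypothesis.\<close>
  have claim: "\<forall>\<^sub>F k in sequentially. norm (LINT s:{0..real j * \<eta>}|lborel. pr (d k s) (\<phi> s))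
      < real j * \<eta> * (\<bar>R\<bar> * \<rho> * K) + \<gamma>"
    if "j \<le> N" "0 < \<gamma>" for j \<gamma>
    using that
  proof (induction j arbitrary: \<gamma>)
    case 0
    have "(LINT s:{0..0}|lborel. pr (d k s) (\<phi> s)) = 0" for k
      unfolding set_lebesgue_integral_def
      by (rule integral_eq_zero_AE)
        (use AE_lborel_singleton[of 0] in eventually_elim, auto simp: indicator_def)
    then show ?case using 0 by simp
  next
    case (Suc j)
    let ?x = "real j * \<eta>" and ?y = "real (Suc j) * \<eta>"
    have xy: "0 \<le> ?x" "?x \<le> ?y" "?y \<le> T" "?y - ?x = \<eta>"
    proof -
      have "?y \<le> real N * \<eta>" using Suc.prems \<eta> by (intro mult_right_mono) auto
      then show "?y \<le> T" using \<eta> t by auto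
    qed (use \<eta> in \<open>auto simp: algebra_simps\<close>)
    have xT: "?x \<in> {0..T}" using xy by auto
    have "(\<lambda>k. pr ((LINT s:{0..?y}|lborel. d k s) - (LINT s:{0..?x}|lborel. d k s)) (\<phi> ?x)) \<longlonglongrightarrow> pr (0 - 0) (\<phi> ?x)"
      using xy by (intro tendsto[OF tendsto_diff[OF lim lim] tendsto_const]) auto
    then have "\<forall>\<^sub>F k in sequentially. dist (pr ((LINT s:{0..?y}|lborel. d k s) - (LINT s:{0..?x}|lborel. d k s)) (\<phi> ?x)) 0 < \<gamma>/2"
      using Suc.prems by (intro tendstoD) (auto simp: zero_left)
    moreover have "\<forall>\<^sub>F k in sequentially. norm (LINT s:{0..?x}|lborel. pr (d k s) (\<phi> s)) < ?x * (\<bar>R\<bar> * \<rho> * K) + \<gamma>/2"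
      using Suc.prems by (intro Suc.IH) auto
    ultimately show ?case
    proof eventually_elim
      case (elim k)
      have sub: "{?x..?y} \<subseteq> {0..T}" using xy by auto
      have i1: "set_integrable lborel {?x..?y} (\<lambda>s. pr (d k s) (\<phi> s))"
        using set_integrable_subset[OF int[OF \<phi>] _ sub] by auto
      have i2: "set_integrable lborel {?x..?y} (\<lambda>s. pr (d k s) (\<phi> ?x))"
        using set_integrable_subset[OF int _ sub, of "\<lambda>_. \<phi> ?x"] by auto
      have i3: "set_integrable lborel {?x..?y} (d k)"
        using set_integrable_subset[OF d _ sub] by auto
      have e1: "norm ((LINT s:{?x..?y}|lborel. pr (d k s) (\<phi> s)) - (LINT s:{?x..?y}|lborel. pr (d k s) (\<phi> ?x)))
          \<le> (LINT s:{?x..?y}|lborel. \<bar>R\<bar> * \<rho> * K)"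
        unfolding set_integral_diff(2)[OF i1 i2, symmetric]
      proof (rule norm_set_integral_le[OF set_integral_diff(1)[OF i1 i2]])
        show "set_integrable lborel {?x..?y} (\<lambda>s. \<bar>R\<bar> * \<rho> * K)"
          by (intro borel_integrable_atLeastAtMost' continuous_intros)
        show "AE s\<in>{?x..?y} in lborel. norm (pr (d k s) (\<phi> s) - pr (d k s) (\<phi> ?x)) \<le> \<bar>R\<bar> * \<rho> * K"
          using R[of k]
        proof eventually_elim
          case (elim s)
          show ?case
          proof
            assume s: "s \<in> {?x..?y}"
            then have sT: "s \<in> {0..T}" using sub by auto
            have "dist s ?x < \<delta>" using s xy \<eta> by (auto simp: dist_real_def)
            then have "norm (\<phi> s - \<phi> ?x) \<le> \<rho>"
              using \<delta>(2)[OF xT sT] by (auto simp: dist_norm)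
            moreover have "norm (d k s) \<le> \<bar>R\<bar>" using elim sT by auto
            ultimately have "norm (d k s) * norm (\<phi> s - \<phi> ?x) * K \<le> \<bar>R\<bar> * \<rho> * K"
              using K \<rho> by (intro mult_mono) auto
            then show "norm (pr (d k s) (\<phi> s) - pr (d k s) (\<phi> ?x)) \<le> \<bar>R\<bar> * \<rho> * K"
              using K(2)[of "d k s" "\<phi> s - \<phi> ?x"] by (simp add: diff_right)
          qed
        qed
      qed
      also have "\<dots> = \<eta> * (\<bar>R\<bar> * \<rho> * K)"
        using xy by (subst set_integral_const) auto
      finally have e1: "norm ((LINT s:{?x..?y}|lborel. pr (d k s) (\<phi> s)) - (LINT s:{?x..?y}|lborel. pr (d k s) (\<phi> ?x)))
          \<le> \<eta> * (\<bar>R\<bar> * \<rho> * K)" .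
      have e2: "(LINT s:{?x..?y}|lborel. pr (d k s) (\<phi> ?x)) = pr ((LINT s:{0..?y}|lborel. d k s) - (LINT s:{0..?x}|lborel. d k s)) (\<phi> ?x)"
        using set_integral_Icc_add[OF d xy(1-3), of k] set_integral_bilinear_const[OF pr i3] by simp
      have e3: "(LINT s:{0..?y}|lborel. pr (d k s) (\<phi> s)) = (LINT s:{0..?x}|lborel. pr (d k s) (\<phi> s)) + (LINT s:{?x..?y}|lborel. pr (d k s) (\<phi> s))"
        by (rule set_integral_Icc_add[OF int[OF \<phi>] xy(1-3)])
      have tri: "norm (a + b) < x + g / 2 + h + g / 2" if "norm a < x + g/2" "norm (b - c) \<le> h" "norm c < g/2" for a b c :: 'c and x g h :: real
        using that norm_triangle_ineq[of a b] norm_triangle_ineq[of "b - c" c] by simp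
      have "norm (LINT s:{0..?y}|lborel. pr (d k s) (\<phi> s)) < ?x * (\<bar>R\<bar> * \<rho> * K) + \<gamma>/2 + \<eta> * (\<bar>R\<bar> * \<rho> * K) + \<gamma>/2"
        unfolding e3 by (rule tri[OF elim(2) e1]) (use elim(1) e2 in simp)
      then show ?case by (simp add: algebra_simps)
    qed
  qed
  have "t * (\<bar>R\<bar> * \<rho> * K) \<le> T * (\<bar>R\<bar> * \<rho> * K)"
    using t K \<rho> by (intro mult_right_mono) auto
  also have "\<dots> = (\<bar>R\<bar> * K * T / (\<bar>R\<bar> * K * T + 1)) * (e / 2)" by (simp add: \<rho>_def algebra_simps)
  also have "\<dots> \<le> 1 * (e / 2)" using RKT \<open>0 < e\<close> by (intro mult_right_mono) auto
  finally have "t * (\<bar>R\<bar> * \<rho> * K) + e / 2 \<le> e" by simp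
  moreover have "\<forall>\<^sub>F k in sequentially. norm (LINT s:{0..t}|lborel. pr (d k s) (\<phi> s)) < t * (\<bar>R\<bar> * \<rho> * K) + e/2"
    using claim[of N "e/2"] \<eta> \<open>0 < e\<close> by simp
  ultimately show "\<forall>\<^sub>F k in sequentially. dist (LINT s:{0..t}|lborel. pr (d k s) (\<phi> s)) 0 < e"
    by (auto elim!: eventually_mono)
qed

section \<open>Compactness and Mazur combinations\<close>

text \<open>Tychonoff's theorem. For an uncountable index set the product is compact but need not be
  sequentially compact, so the result is a cluster point, approached infinitely often on each finite
  set of coordinates, and not the limit of a subsequence.\<close>

lemma pointwise_cluster_point:
  fixes f :: "nat \<Rightarrow> 'i \<Rightarrow> 'b::metric_space"
  assumes K: "\<And>i. compact (K i)" and f: "\<And>n i. f n i \<in> K i"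
  obtains g where "\<And>J e. finite J \<Longrightarrow> 0 < e \<Longrightarrow> \<exists>\<^sub>F n in sequentially. \<forall>i\<in>J. dist (f n i) (g i) < e"
proof -
  have "compactin (product_topology (\<lambda>_. euclidean) UNIV) (PiE UNIV K)"
    using K by (simp add: compactin_PiE)
  then have "compact (PiE UNIV K)"
    by (simp add: euclidean_product_topology)
  moreover have "eventually (\<lambda>x. x \<in> PiE UNIV K) (filtermap f sequentially)"
    using f by (auto simp: eventually_filtermap PiE_UNIV_domain)
  moreover have "filtermap f sequentially \<noteq> bot" by (simp add: filtermap_bot_iff)
  ultimately obtain g where g: "inf (nhds g) (filtermap f sequentially) \<noteq> bot"
    unfolding compact_filter by blast
  show ?thesis
  proof (rule that)
    fix J :: "'i set" and e :: real
    assume J: "finite J" and e: "0 < e"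
    have "\<forall>\<^sub>F x in nhds g. dist (x i) (g i) < e" for i
    proof -
      have "open ((\<lambda>x. x i) -` ball (g i) e)"
        by (rule open_vimage) (auto intro: continuous_on_product_coordinates)
      then show ?thesis
        using e by (auto simp: eventually_nhds dist_commute intro!: exI[of _ "(\<lambda>x. x i) -` ball (g i) e"])
    qed
    then have ev: "\<forall>\<^sub>F x in nhds g. \<forall>i\<in>J. dist (x i) (g i) < e"
      using J by (auto intro: eventually_ball_finite)
    show "\<exists>\<^sub>F n in sequentially. \<forall>i\<in>J. dist (f n i) (g i) < e"
    proof (rule ccontr)
      assume "\<not> ?thesis"
      then have "\<forall>\<^sub>F x in filtermap f sequentially. \<not> (\<forall>i\<in>J. dist (x i) (g i) < e)"
        unfolding frequently_def eventually_filtermap by simp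
      with ev have "\<forall>\<^sub>F x in inf (nhds g) (filtermap f sequentially). False"
        unfolding eventually_inf by blast
      with g show False by (simp add: trivial_limit_def)
    qed
  qed
qed

text \<open>Diagonal extraction on a countable dense subset; the common Lipschitz constant carries
  the Cauchy property from there to all of \<open>S\<close>. Only pointwise convergence is claimed,
  so \<open>S\<close> may be unbounded: it is [0, T] for the primitives of controls and the whole
  state space for feedbacks.\<close>

lemma equi_Lipschitz_subsequence:
  fixes f :: "nat \<Rightarrow> 'a::{metric_space, second_countable_topology} \<Rightarrow> 'b::euclidean_space"
  assumes lip: "\<And>n. C-lipschitz_on S (f n)" and B: "\<And>n x. x \<in> S \<Longrightarrow> norm (f n x) \<le> B"
  obtains r :: "nat \<Rightarrow> nat" and g where "strict_mono r" "\<And>x. x \<in> S \<Longrightarrow> (\<lambda>n. f (r n) x) \<longlonglongrightarrow> g x"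
proof -
  obtain Q where Q: "countable Q" "Q \<subseteq> S" "S \<subseteq> closure Q" using separable .
  obtain r :: "nat \<Rightarrow> nat" where r: "strict_mono r" "\<And>x. x \<in> Q \<Longrightarrow> \<exists>l. (\<lambda>n. f (r n) x) \<longlonglongrightarrow> l"
    using function_convergent_subsequence[OF Q(1), of f B] B Q(2) by blast
  have C: "0 \<le> C" using lipschitz_on_nonneg[OF lip] .
  have "convergent (\<lambda>n. f (r n) x)" if x: "x \<in> S" for x
  proof (rule Cauchy_convergent, rule metric_CauchyI)
    fix e :: real assume e: "0 < e"
    obtain q where q: "q \<in> Q" "dist q x < e / (4 * (C + 1))"
      using Q(3) x e C by (metis closure_approachable subsetD divide_pos_pos add_nonneg_pos mult_pos_pos zero_less_numeral zero_less_one)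
    have "Cauchy (\<lambda>n. f (r n) q)"
      using r(2)[OF q(1)] by (auto intro: LIMSEQ_imp_Cauchy)
    then obtain N where N: "\<And>m n. m \<ge> N \<Longrightarrow> n \<ge> N \<Longrightarrow> dist (f (r m) q) (f (r n) q) < e / 2"
      using e by (meson half_gt_zero metric_CauchyD)
    have close: "dist (f n x) (f n q) \<le> e / 4" for n
    proof -
      have "dist (f n x) (f n q) \<le> C * dist x q" using lipschitz_onD[OF lip x] q Q(2) by auto
      also have "\<dots> \<le> (C + 1) * (e / (4 * (C + 1)))"
        using q C by (intro mult_mono) (auto simp: dist_commute less_imp_le)
      also have "\<dots> = e / 4" using C by (simp add: field_simps)
      finally show ?thesis .
    qed
    have "dist (f (r m) x) (f (r n) x) < e" if mn: "m \<ge> N" "n \<ge> N" for m n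
      using close[of "r m"] close[of "r n"] N[OF mn]
        dist_triangle[of "f (r m) x" "f (r n) x" "f (r m) q"] dist_triangle[of "f (r m) q" "f (r n) x" "f (r n) q"]
      by (simp add: dist_commute)
    then show "\<exists>N. \<forall>m\<ge>N. \<forall>n\<ge>N. dist (f (r m) x) (f (r n) x) < e" by blast
  qed
  then have "(\<lambda>n. f (r n) x) \<longlonglongrightarrow> lim (\<lambda>n. f (r n) x)" if "x \<in> S" for x
    using that convergent_LIMSEQ_iff by blast
  with r(1) show ?thesis by (rule that)
qed

text \<open>Dyadic convex combinations. Midpoints are all that the parallelogram law and the
  convexity inequality require, and whatever they preserve holds on the hull by induction, without
  any handling of weights.\<close>

inductive_set midpoint_hull :: "('t \<Rightarrow> 'a::real_vector) set \<Rightarrow> ('t \<Rightarrow> 'a) set" for A where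
  base: "f \<in> A \<Longrightarrow> f \<in> midpoint_hull A"
| midpoint: "f \<in> midpoint_hull A \<Longrightarrow> g \<in> midpoint_hull A \<Longrightarrow> (\<lambda>x. (1/2) *\<^sub>R (f x + g x)) \<in> midpoint_hull A"

lemma midpoint_hull_mono:
  assumes "A \<subseteq> B" shows "midpoint_hull A \<subseteq> midpoint_hull B"
proof
  fix f assume "f \<in> midpoint_hull A"
  then show "f \<in> midpoint_hull B"
    by induction (use assms in \<open>auto intro: midpoint_hull.intros\<close>)
qed

text \<open>Almost minimizers of the \<open>L\<^sup>2\<close> norm in the midpoint hulls of the tails form a Cauchy sequence
  by the parallelogram law.\<close>

lemma midpoint_hull_converges_AE:
  fixes h :: "nat \<Rightarrow> 't \<Rightarrow> 'a::euclidean_space"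
  assumes "finite_measure M" and h: "\<And>k. h k \<in> borel_measurable M"
    and R: "\<And>k. AE x in M. norm (h k x) \<le> R"
  obtains f g where "\<And>j. f j \<in> midpoint_hull (h ` {j..})" "g \<in> borel_measurable M"
    "AE x in M. (\<lambda>j. f j x) \<longlonglongrightarrow> g x"
proof -
  interpret finite_measure M by fact
  define C where "C j = midpoint_hull (h ` {j..})" for j :: nat
  have C_anti: "C j \<subseteq> C i" if "i \<le> j" for i j
    unfolding C_def using that by (intro midpoint_hull_mono) auto
  have C: "f \<in> borel_measurable M \<and> (AE x in M. norm (f x) \<le> R)" if "f \<in> C j" for f j
    using that unfolding C_def
  proof induction
    case (base f)
    then show ?case using h R by auto
  next
    case (midpoint f g)
    then have [measurable]: "f \<in> borel_measurable M" "g \<in> borel_measurable M" by auto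
    have "AE x in M. norm ((1/2) *\<^sub>R (f x + g x)) \<le> R"
      using midpoint.IH[THEN conjunct2]
    proof eventually_elim
      case (elim x)
      then show ?case using norm_triangle_ineq[of "f x" "g x"] by simp
    qed
    then show ?case by simp
  qed
  note Cm = C[THEN conjunct1] and CR = C[THEN conjunct2]
  define N where "N f = (\<integral>x. (norm (f x))\<^sup>2 \<partial>M)" for f :: "'t \<Rightarrow> 'a"
  have intg: "integrable M (\<lambda>x. (norm (f x))\<^sup>2)"
    if "f \<in> borel_measurable M" "AE x in M. norm (f x) \<le> B" for f :: "'t \<Rightarrow> 'a" and B
  proof (rule integrable_const_bound[where B="B\<^sup>2"])
    show "AE x in M. norm ((norm (f x))\<^sup>2) \<le> B\<^sup>2"
      using that(2) by eventually_elim (auto intro: power_mono)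
  qed (use that(1) in measurable)
  have int1: "integrable M (\<lambda>x. (norm (f x))\<^sup>2)" if "f \<in> C j" for f j
    using intg[OF Cm[OF that] CR[OF that]] .
  have N0: "0 \<le> N f" for f unfolding N_def by simp
  \<comment> \<open>The squared L^2 distance of the hull from the origin. It grows with
    \<open>j\<close> because the hulls of later tails are smaller, and the common bound
    \<open>R\<close> makes it converge.\<close>
  define I where "I j = Inf (N ` C j)" for j
  have bdd: "bdd_below (N ` C j)" for j using N0 by (intro bdd_belowI[of _ 0]) auto
  have hC: "h j \<in> C j" for j unfolding C_def by (auto intro: midpoint_hull.base)
  have ex: "\<exists>f. f \<in> C j \<and> N f < I j + 1 / real (Suc j)" for j
  proof -
    have "\<exists>y\<in>N ` C j. y < I j + 1 / real (Suc j)"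
      using hC[of j] unfolding I_def by (intro cInf_lessD) auto
    then show ?thesis by auto
  qed
  then obtain f where f: "\<And>j. f j \<in> C j" "\<And>j. N (f j) < I j + 1 / real (Suc j)" by metis
  have I_mono: "I i \<le> I j" if "i \<le> j" for i j
    unfolding I_def using hC[of j] C_anti[OF that] bdd by (intro cInf_superset_mono) auto
  have I_bdd: "I j \<le> R\<^sup>2 * measure M (space M)" for j
  proof -
    have "I j \<le> N (h j)" unfolding I_def using hC bdd by (auto intro: cInf_lower)
    also have "\<dots> \<le> (\<integral>x. R\<^sup>2 \<partial>M)" unfolding N_def
    proof (rule integral_mono_AE[OF int1[OF hC]])
      show "AE x in M. (norm (h j x))\<^sup>2 \<le> R\<^sup>2"
        using R[of j] by eventually_elim (auto intro: power_mono)
    qed simp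
    finally show ?thesis by (simp add: mult.commute)
  qed
  obtain d where d: "I \<longlonglongrightarrow> d" "\<And>j. I j \<le> d"
    using incseq_convergent[of I "R\<^sup>2 * measure M (space M)"] I_mono I_bdd by (auto simp: incseq_def)
  \<comment> \<open>Both functions lie in \<open>C n\<close>, hence so does their midpoint, whose
    squared norm is at least \<open>I n\<close>. The parallelogram law then leaves only the gap
    \<open>d - I n\<close> and the tolerance of the almost minimizers.\<close>
  have key: "N (\<lambda>x. f i x - f j x) \<le> 4 * (d - I n) + 4 / real (Suc n)" if n: "n \<le> i" "n \<le> j" for i j n
  proof -
    let ?m = "\<lambda>x. (1/2) *\<^sub>R (f i x + f j x)"
    have fC: "f i \<in> C n" "f j \<in> C n" using f(1) C_anti n by auto
    then have mC: "?m \<in> C n" unfolding C_def by (rule midpoint_hull.midpoint)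
    have "N (\<lambda>x. f i x - f j x) = (\<integral>x. 2 * (norm (f i x))\<^sup>2 + 2 * (norm (f j x))\<^sup>2 - 4 * (norm (?m x))\<^sup>2 \<partial>M)"
      unfolding N_def
      by (intro Bochner_Integration.integral_cong refl)
        (simp add: power2_norm_eq_inner inner_diff inner_add inner_commute algebra_simps)
    also have "\<dots> = 2 * N (f i) + 2 * N (f j) - 4 * N ?m"
      unfolding N_def using int1[OF fC(1)] int1[OF fC(2)] int1[OF mC] by simp
    also have "\<dots> \<le> 2 * (d + 1 / real (Suc n)) + 2 * (d + 1 / real (Suc n)) - 4 * I n"
    proof -
      have "N (f k) \<le> d + 1 / real (Suc n)" if "n \<le> k" for k
      proof -
        have "1 / real (Suc k) \<le> 1 / real (Suc n)" using that by (intro divide_left_mono) auto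
        then show ?thesis using f(2)[of k] d(2)[of k] by linarith
      qed
      moreover have "I n \<le> N ?m" unfolding I_def using mC bdd by (auto intro: cInf_lower)
      ultimately show ?thesis using n by (smt (verit))
    qed
    finally show ?thesis by (simp add: algebra_simps)
  qed
  have fint: "integrable M (f j)" for j
    by (rule integrable_const_bound[OF CR[OF f(1)] Cm[OF f(1)]])
  have "\<exists>N. \<forall>i\<ge>N. \<forall>j\<ge>N. (LINT x|M. norm (f i x - f j x)) < e" if e: "0 < e" for e
  proof -
    define V where "V = measure M (space M)"
    define \<eta> where "\<eta> = e / (V + 1)"
    have V: "0 \<le> V" by (simp add: V_def)
    have \<eta>: "0 < \<eta>" "\<eta> * V < e"
    proof -
      show "0 < \<eta>" using V e by (simp add: \<eta>_def)
      have "e * V < e * (V + 1)" using e by (simp add: algebra_simps)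
      then show "\<eta> * V < e" using V by (simp add: \<eta>_def divide_simps)
    qed
    have "(\<lambda>n. 4 * (d - I n) + 4 * inverse (real (Suc n))) \<longlonglongrightarrow> 4 * (d - d) + 4 * 0"
      by (intro tendsto_intros d LIMSEQ_inverse_real_of_nat)
    then have "\<forall>\<^sub>F n in sequentially. 4 * (d - I n) + 4 * inverse (real (Suc n)) < \<eta> * e"
      using \<eta> e by (intro order_tendstoD(2)) auto
    then obtain n where n: "4 * (d - I n) + 4 / real (Suc n) < \<eta> * e"
      by (auto simp: eventually_sequentially divide_inverse)
    have "(LINT x|M. norm (f i x - f j x)) < e" if "n \<le> i" "n \<le> j" for i j
    proof -
      have i1: "integrable M (\<lambda>x. (norm (f i x - f j x))\<^sup>2)"
      proof (rule intg)
        show "AE x in M. norm (f i x - f j x) \<le> 2 * R"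
          using CR[OF f(1)[of i]] CR[OF f(1)[of j]]
        proof eventually_elim
          case (elim x)
          then show ?case using norm_triangle_ineq4[of "f i x" "f j x"] by simp
        qed
      qed (use Cm[OF f(1)] in measurable)
      \<comment> \<open>Young's inequality passes from the squared L^2 norm to the L^1 norm on a
        finite measure space. By the choice of \<open>n\<close> the first summand contributes less
        than \<open>e / 2\<close>, and \<open>\<eta> * V < e\<close> bounds the second
        likewise.\<close>
      have "(LINT x|M. norm (f i x - f j x)) \<le> (LINT x|M. (norm (f i x - f j x))\<^sup>2 / (2 * \<eta>) + \<eta> / 2)"
      proof (rule integral_mono)
        fix x
        have "2 * \<eta> * norm (f i x - f j x) \<le> (norm (f i x - f j x))\<^sup>2 + \<eta>\<^sup>2"
          using zero_le_power2[of "norm (f i x - f j x) - \<eta>"] by (simp add: power2_diff algebra_simps)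
        then show "norm (f i x - f j x) \<le> (norm (f i x - f j x))\<^sup>2 / (2 * \<eta>) + \<eta> / 2"
          using \<eta>(1) by (simp add: field_simps power2_eq_square)
      qed (use fint i1 in auto)
      also have "\<dots> = N (\<lambda>x. f i x - f j x) / (2 * \<eta>) + V * (\<eta> / 2)"
        using i1 by (simp add: N_def V_def)
      also have "\<dots> < (\<eta> * e) / (2 * \<eta>) + V * (\<eta> / 2)"
        using key[OF that] n \<eta>(1) by (intro add_strict_right_mono divide_strict_right_mono) auto
      also have "\<dots> \<le> e" using \<eta> by (simp add: field_simps)
      finally show ?thesis .
    qed
    then show ?thesis by blast
  qed
  from cauchy_L1_AE_cauchy_subseq[OF fint this]
  obtain r where r: "strict_mono r" "AE x in M. Cauchy (\<lambda>i. f (r i) x)" by blast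
  show ?thesis
  proof (rule that[of "\<lambda>j. f (r j)" "\<lambda>x. lim (\<lambda>j. f (r j) x)"])
    show "f (r j) \<in> midpoint_hull (h ` {j..})" for j
      using f(1)[of "r j"] C_anti[OF seq_suble[OF r(1), of j]] unfolding C_def by auto
    show "(\<lambda>x. lim (\<lambda>j. f (r j) x)) \<in> borel_measurable M"
      using Cm[OF f(1)] by (intro borel_measurable_lim_metric) auto
    show "AE x in M. (\<lambda>j. f (r j) x) \<longlonglongrightarrow> lim (\<lambda>j. f (r j) x)"
      using r(2) by eventually_elim (simp add: Cauchy_convergent_iff convergent_LIMSEQ_iff)
  qed
qed

section \<open>Controlled integral equations\<close>

lemma set_integral_tendsto_bounded:
  fixes u :: "nat \<Rightarrow> real \<Rightarrow> 'b::{banach, second_countable_topology}"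
  assumes u: "\<And>k. set_borel_measurable lborel {a..b} (u k)" and v: "set_borel_measurable lborel {a..b} v"
    and lim: "AE s\<in>{a..b} in lborel. (\<lambda>k. u k s) \<longlonglongrightarrow> v s"
    and B: "\<And>k. AE s\<in>{a..b} in lborel. norm (u k s) \<le> B"
  shows "(\<lambda>k. LINT s:{a..b}|lborel. u k s) \<longlonglongrightarrow> (LINT s:{a..b}|lborel. v s)"
  unfolding set_lebesgue_integral_def
proof (rule integral_dominated_convergence[where w="\<lambda>s. indicator {a..b} s *\<^sub>R B"])
  show "(\<lambda>s. indicator {a..b} s *\<^sub>R v s) \<in> borel_measurable lborel"
    "(\<lambda>s. indicator {a..b} s *\<^sub>R u k s) \<in> borel_measurable lborel" for k
    using u v by (auto simp: set_borel_measurable_def)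
  have "set_integrable lborel {a..b} (\<lambda>_. B)"
    by (intro borel_integrable_atLeastAtMost' continuous_intros)
  then show "integrable lborel (\<lambda>s. indicator {a..b} s *\<^sub>R B)" by (simp add: set_integrable_def)
  show "AE s in lborel. (\<lambda>k. indicator {a..b} s *\<^sub>R u k s) \<longlonglongrightarrow> indicator {a..b} s *\<^sub>R v s"
    using lim by eventually_elim (auto simp: indicator_def)
  show "AE s in lborel. norm (indicator {a..b} s *\<^sub>R u k s) \<le> indicator {a..b} s *\<^sub>R B" for k
    using B[of k] by eventually_elim (auto simp: indicator_def)
qed

lemma set_borel_measurable_subset:
  fixes u :: "'t \<Rightarrow> 'b::{banach, second_countable_topology}"
  assumes "set_borel_measurable M A u" "B \<in> sets M" "B \<subseteq> A"
  shows "set_borel_measurable M B u"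
proof -
  have "(\<lambda>x. indicator B x *\<^sub>R (indicator A x *\<^sub>R u x)) \<in> borel_measurable M"
    using assms unfolding set_borel_measurable_def by measurable
  moreover have "(\<lambda>x. indicator B x *\<^sub>R (indicator A x *\<^sub>R u x)) = (\<lambda>x. indicator B x *\<^sub>R u x)"
    using assms(3) by (auto simp: indicator_def fun_eq_iff)
  ultimately show ?thesis by (simp add: set_borel_measurable_def)
qed

lemma set_integrable_imp_set_borel_measurable:
  "set_integrable M A f \<Longrightarrow> set_borel_measurable M A f"
  by (auto simp: set_integrable_def set_borel_measurable_def)

lemma set_integral_le_const:
  fixes u :: "real \<Rightarrow> real"
  assumes "set_integrable lborel {0..t} u" "AE s\<in>{0..t} in lborel. u s \<le> B" "0 \<le> t"
  shows "(LINT s:{0..t}|lborel. u s) \<le> t * B"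
proof -
  have "(LINT s:{0..t}|lborel. u s) \<le> (LINT s:{0..t}|lborel. B)"
    by (rule set_integral_mono_AE[OF assms(1) borel_integrable_atLeastAtMost' assms(2)]) simp
  then show ?thesis using assms(3) by (subst (asm) set_integral_const) auto
qed

text \<open>All particles and agents form a single state in a Euclidean space, and the action of the
  controls is an abstract bounded bilinear \<open>pr\<close>. Stability and compactness can then be
  treated with neither measures nor indices in sight.\<close>

locale controlled_equation =
  fixes T C K R M L :: real and b :: "'v::euclidean_space \<Rightarrow> 'v"
    and pr :: "'a::euclidean_space \<Rightarrow> 'b::euclidean_space \<Rightarrow> 'v" and U :: "'a set"
  assumes T: "0 < T" and b: "C-lipschitz_on UNIV b"
    and bilinear: "bounded_bilinear pr" and K: "0 < K" "\<And>x y. norm (pr x y) \<le> K * norm x * norm y"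
    and U: "compact U" "convex U" and R: "0 < R" "\<And>x. x \<in> U \<Longrightarrow> norm x \<le> R"
begin

definition feedback :: "('v \<Rightarrow> 'b) \<Rightarrow> bool" where
  "feedback \<gamma> \<longleftrightarrow> L-lipschitz_on UNIV \<gamma> \<and> (\<forall>x. norm (\<gamma> x) \<le> M)"

definition rhs :: "(real \<Rightarrow> 'a) \<Rightarrow> ('v \<Rightarrow> 'b) \<Rightarrow> real \<Rightarrow> 'v \<Rightarrow> 'v" where
  "rhs h \<gamma> s x = b x + pr (h s) (\<gamma> x)"

text \<open>The forcing \<open>w\<close> carries the initial state and the additive noise. For a
  fixed \<omega> the Brownian motions thus enter as one continuous path, and the difference of two
  solutions with the same forcing does not contain it.\<close>

definition solves :: "(real \<Rightarrow> 'v) \<Rightarrow> (real \<Rightarrow> 'a) \<Rightarrow> ('v \<Rightarrow> 'b) \<Rightarrow> (real \<Rightarrow> 'v) \<Rightarrow> bool" where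
  "solves w h \<gamma> z \<longleftrightarrow> continuous_on {0..T} z \<and>
    (\<forall>t\<in>{0..T}. z t = w t + (LINT s:{0..t}|lborel. rhs h \<gamma> s (z s)))"

abbreviation controls :: "(real \<Rightarrow> 'a) set" where
  "controls \<equiv> L1_controls T U"

text \<open>\<open>C + K * R * L\<close> is a Lipschitz constant of the right-hand side at almost
  every time. The added 1 makes it strictly positive, as the weighted norm in
  \<open>picard_converges\<close> requires.\<close>

abbreviation D :: real where "D \<equiv> C + K * R * L + 1"

lemma control_measurable: "h \<in> controls \<Longrightarrow> set_borel_measurable lborel {0..T} h"
  by (auto simp: L1_controls_def intro: set_integrable_imp_set_borel_measurable)

lemma control_integrable: "h \<in> controls \<Longrightarrow> set_integrable lborel {0..T} h"
  by (simp add: L1_controls_def)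

lemma control_in: "h \<in> controls \<Longrightarrow> AE s\<in>{0..T} in lborel. h s \<in> U"
  by (simp add: L1_controls_def)

lemma control_bound:
  assumes "h \<in> controls"
  shows "AE s\<in>{0..T} in lborel. norm (h s) \<le> R"
  using control_in[OF assms] by eventually_elim (auto intro: R)

lemma feedback_continuous: "feedback \<gamma> \<Longrightarrow> continuous_on A \<gamma>"
  unfolding feedback_def
  by (meson lipschitz_on_continuous_on continuous_on_subset subset_UNIV)

lemma feedback_compose: "feedback \<gamma> \<Longrightarrow> continuous_on A z \<Longrightarrow> continuous_on A (\<lambda>s. \<gamma> (z s))"
  using continuous_on_compose2[OF feedback_continuous] by blast

lemma feedback_bound: "feedback \<gamma> \<Longrightarrow> norm (\<gamma> x) \<le> M"
  by (simp add: feedback_def)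

lemma feedback_nonneg: "feedback \<gamma> \<Longrightarrow> 0 \<le> M" "feedback \<gamma> \<Longrightarrow> 0 \<le> L"
  using feedback_bound norm_ge_zero order_trans apply blast
  by (auto simp: feedback_def dest: lipschitz_on_nonneg)

lemma C_nonneg: "0 \<le> C"
  using b by (rule lipschitz_on_nonneg)

lemma D_pos: "feedback \<gamma> \<Longrightarrow> 0 < D"
  using C_nonneg K(1) R(1) feedback_nonneg(2)[of \<gamma>] by (simp add: add_nonneg_pos)

lemma pr_bound: "norm x \<le> r \<Longrightarrow> norm y \<le> m \<Longrightarrow> norm (pr x y) \<le> K * r * m"
proof -
  assume a: "norm x \<le> r" "norm y \<le> m"
  have "norm (pr x y) \<le> K * norm x * norm y" by (rule K)
  also have "\<dots> \<le> K * r * m"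
    using a K(1) order_trans[OF norm_ge_zero a(1)] by (intro mult_mono) auto
  finally show ?thesis .
qed

lemma pr_integrable:
  assumes h: "set_borel_measurable lborel {0..T} h" "AE s\<in>{0..T} in lborel. norm (h s) \<le> r"
    and \<phi>: "continuous_on {0..T} \<phi>"
  shows "set_integrable lborel {0..T} (\<lambda>s. pr (h s) (\<phi> s))"
proof -
  obtain B where B: "\<And>s. s \<in> {0..T} \<Longrightarrow> norm (\<phi> s) \<le> B"
    using continuous_on_Icc_bounded[OF \<phi>] by blast
  show ?thesis
  proof (rule set_integrable_bounded)
    show "set_borel_measurable lborel {0..T} (\<lambda>s. pr (h s) (\<phi> s))"
      by (rule set_borel_measurable_bilinear[OF bilinear h(1) set_borel_measurable_continuous_on_Icc[OF \<phi>]])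
    show "AE s\<in>{0..T} in lborel. norm (pr (h s) (\<phi> s)) \<le> K * r * B"
      using h(2) by eventually_elim (auto intro!: pr_bound B)
  qed
qed

lemma b_compose: "continuous_on A z \<Longrightarrow> continuous_on A (\<lambda>s. b (z s))"
  using continuous_on_compose2[OF lipschitz_on_continuous_on[OF b]] by blast

lemma rhs_integrable:
  assumes "h \<in> controls" "feedback \<gamma>" "continuous_on {0..T} z"
  shows "set_integrable lborel {0..T} (\<lambda>s. rhs h \<gamma> s (z s))"
  unfolding rhs_def
  by (intro set_integral_add borel_integrable_atLeastAtMost' b_compose assms
      pr_integrable[OF control_measurable control_bound feedback_compose])

lemma rhs_lipschitz:
  assumes "h \<in> controls" "feedback \<gamma>"
  shows "AE s\<in>{0..T} in lborel. \<forall>x y. norm (rhs h \<gamma> s x - rhs h \<gamma> s y) \<le> D * norm (x - y)"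
  using control_bound[OF assms(1)]
proof eventually_elim
  case (elim s)
  interpret bounded_bilinear pr by (rule bilinear)
  show ?case
  proof (intro impI allI)
    fix x y assume "s \<in> {0..T}"
    then have h: "norm (h s) \<le> R" using elim by auto
    have "norm (pr (h s) (\<gamma> x - \<gamma> y)) \<le> K * R * (L * norm (x - y))"
      using assms(2) by (intro pr_bound h) (auto simp: feedback_def lipschitz_on_def dist_norm)
    moreover have "norm (b x - b y) \<le> C * norm (x - y)"
      using b by (auto simp: lipschitz_on_def dist_norm)
    moreover have "rhs h \<gamma> s x - rhs h \<gamma> s y = (b x - b y) + pr (h s) (\<gamma> x - \<gamma> y)"
      by (simp add: rhs_def diff_right)
    ultimately have "norm (rhs h \<gamma> s x - rhs h \<gamma> s y) \<le> C * norm (x - y) + K * R * (L * norm (x - y))"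
      by (simp add: norm_triangle_le)
    then show "norm (rhs h \<gamma> s x - rhs h \<gamma> s y) \<le> D * norm (x - y)"
      by (simp add: algebra_simps) (smt (verit) norm_ge_zero)
  qed
qed

text \<open>A Picard iterate at time \<open>t\<close> involves the forcing up to time
  \<open>t\<close> only. With \<open>t\<close> as the horizon and \<open>F t\<close> as the measure
  of the path integral lemma, induction shows it to be \<open>F t\<close>-measurable, and the
  solution inherits this as a pointwise limit.\<close>

lemma adapted_solution_exists:
  assumes h: "h \<in> controls" and \<gamma>: "feedback \<gamma>"
    and F: "\<And>t. 0 \<le> t \<Longrightarrow> subalgebra P (F t)" "\<And>s t. 0 \<le> s \<Longrightarrow> s \<le> t \<Longrightarrow> subalgebra (F t) (F s)"
    and w: "\<And>\<omega>. \<omega> \<in> space P \<Longrightarrow> continuous_on {0..T} (w \<omega>)"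
      "\<And>t. t \<in> {0..T} \<Longrightarrow> (\<lambda>\<omega>. w \<omega> t) \<in> borel_measurable (F t)"
  obtains Z where "\<And>\<omega>. \<omega> \<in> space P \<Longrightarrow> solves (w \<omega>) h \<gamma> (Z \<omega>)"
    "\<And>t. t \<in> {0..T} \<Longrightarrow> (\<lambda>\<omega>. Z \<omega> t) \<in> borel_measurable (F t)"
proof -
  have "\<exists>z. solves (w \<omega>) h \<gamma> z \<and> (\<forall>t\<in>{0..T}. (\<lambda>n. picard (w \<omega>) (rhs h \<gamma>) n t) \<longlonglongrightarrow> z t)"
    if "\<omega> \<in> space P" for \<omega>
    by (rule picard_converges[OF D_pos[OF \<gamma>] w(1)[OF that] rhs_integrable[OF h \<gamma>] rhs_lipschitz[OF h \<gamma>]])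
      (auto simp: solves_def)
  then obtain Z where Z: "\<And>\<omega>. \<omega> \<in> space P \<Longrightarrow> solves (w \<omega>) h \<gamma> (Z \<omega>)"
    "\<And>\<omega> t. \<omega> \<in> space P \<Longrightarrow> t \<in> {0..T} \<Longrightarrow> (\<lambda>n. picard (w \<omega>) (rhs h \<gamma>) n t) \<longlonglongrightarrow> Z \<omega> t"
    by metis
  have sp: "space (F t) = space P" if "0 \<le> t" for t
    using F(1)[OF that] by (simp add: subalgebra_def)
  have m: "(\<lambda>\<omega>. picard (w \<omega>) (rhs h \<gamma>) n t) \<in> borel_measurable (F t)" if "t \<in> {0..T}" for n t
    using that
  proof (induction n arbitrary: t)
    case 0
    then show ?case using w(2) by simp
  next
    case (Suc n)
    have "(\<lambda>\<omega>. LINT s:{0..t}|lborel. rhs h \<gamma> s (picard (w \<omega>) (rhs h \<gamma>) n s)) \<in> borel_measurable (F t)"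
    proof (rule borel_measurable_set_integral_paths[where \<phi>="\<lambda>\<omega>. picard (w \<omega>) (rhs h \<gamma>) n" and f="rhs h \<gamma>"])
      show "0 \<le> t" using Suc.prems by auto
      show "(\<lambda>\<omega>. picard (w \<omega>) (rhs h \<gamma>) n s) \<in> borel_measurable (F t)" if "s \<in> {0..t}" for s
        by (rule measurable_from_subalg[OF F(2)[of s t] Suc.IH]) (use that Suc.prems in auto)
      show "continuous_on {0..t} (picard (w \<omega>) (rhs h \<gamma>) n)" if "\<omega> \<in> space (F t)" for \<omega>
        using that Suc.prems
        by (intro continuous_on_subset[OF continuous_on_picard[OF w(1) rhs_integrable[OF h \<gamma>]]]) (auto simp: sp)
      have [measurable]: "(\<lambda>s. indicator {0..t} s *\<^sub>R h s) \<in> borel_measurable borel"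
        using set_borel_measurable_subset[OF control_measurable[OF h], of "{0..t}"] Suc.prems
        by (simp add: set_borel_measurable_def)
      have [measurable]: "b \<in> borel_measurable borel" "\<gamma> \<in> borel_measurable borel"
        using lipschitz_on_continuous_on[OF b] feedback_continuous[OF \<gamma>]
        by (auto intro: borel_measurable_continuous_onI)
      have "(\<lambda>x. pr (indicator {0..t} (fst x) *\<^sub>R h (fst x)) (\<gamma> (snd x))) \<in> borel_measurable (borel \<Otimes>\<^sub>M borel)"
        by (rule borel_measurable_continuous_Pair[of _ _ _ pr])
          (measurable, intro bounded_bilinear.continuous_on[OF bilinear] continuous_intros)
      then have "(\<lambda>x. indicator {0..t} (fst x) *\<^sub>R b (snd x) + pr (indicator {0..t} (fst x) *\<^sub>R h (fst x)) (\<gamma> (snd x)))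
          \<in> borel_measurable (borel \<Otimes>\<^sub>M borel)"
        by measurable
      also have "(\<lambda>x. indicator {0..t} (fst x) *\<^sub>R b (snd x) + pr (indicator {0..t} (fst x) *\<^sub>R h (fst x)) (\<gamma> (snd x)))
         = (\<lambda>(s, x). indicator {0..t} s *\<^sub>R rhs h \<gamma> s x)"
        by (auto simp: fun_eq_iff rhs_def indicator_def bounded_bilinear.zero_left[OF bilinear])
      finally show "(\<lambda>(s, x). indicator {0..t} s *\<^sub>R rhs h \<gamma> s x) \<in> borel_measurable (borel \<Otimes>\<^sub>M borel)" .
    qed
    then show ?case using w(2)[OF Suc.prems] by simp
  qed
  show ?thesis
  proof (rule that[of Z])
    show "(\<lambda>\<omega>. Z \<omega> t) \<in> borel_measurable (F t)" if "t \<in> {0..T}" for t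
      using that by (intro borel_measurable_LIMSEQ_metric[OF m[OF that] Z(2)]) (auto simp: sp)
  qed (rule Z(1))
qed

text \<open>Both terms are evaluated along the reference path \<open>z'\<close>, so they can be
  shown to vanish before anything is known about the other solution. In the second term the norm
  stays outside the integral, because the controls converge only weakly.\<close>

definition gap :: "(real \<Rightarrow> 'a) \<Rightarrow> ('v \<Rightarrow> 'b) \<Rightarrow> (real \<Rightarrow> 'a) \<Rightarrow> ('v \<Rightarrow> 'b) \<Rightarrow> (real \<Rightarrow> 'v) \<Rightarrow> real \<Rightarrow> real" where
  "gap h \<gamma> h' \<gamma>' z' t = K * R * (LINT s:{0..t}|lborel. norm (\<gamma> (z' s) - \<gamma>' (z' s)))
     + norm (LINT s:{0..t}|lborel. pr (h s - h' s) (\<gamma>' (z' s)))"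

context
  fixes h h' :: "real \<Rightarrow> 'a" and \<gamma> \<gamma>' :: "'v \<Rightarrow> 'b" and z' :: "real \<Rightarrow> 'v"
  assumes h: "h \<in> controls" "h' \<in> controls" and \<gamma>: "feedback \<gamma>" "feedback \<gamma>'"
    and z': "continuous_on {0..T} z'"
begin

lemma control_diff:
  "set_integrable lborel {0..T} (\<lambda>s. h s - h' s)"
  "AE s\<in>{0..T} in lborel. norm (h s - h' s) \<le> 2 * R"
proof -
  show "set_integrable lborel {0..T} (\<lambda>s. h s - h' s)"
    by (intro set_integral_diff control_integrable h)
  show "AE s\<in>{0..T} in lborel. norm (h s - h' s) \<le> 2 * R"
    using control_bound[OF h(1)] control_bound[OF h(2)]
  proof eventually_elim
    case (elim s)
    then show ?case using norm_triangle_ineq4[of "h s" "h' s"] by auto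
  qed
qed

lemma control_diff_integrable:
  "set_integrable lborel {0..T} (\<lambda>s. pr (h s - h' s) (\<gamma>' (z' s)))"
  by (intro pr_integrable[OF set_integrable_imp_set_borel_measurable[OF control_diff(1)] control_diff(2)]
      feedback_compose \<gamma> z')

lemma feedback_diff_continuous: "continuous_on {0..T} (\<lambda>s. norm (\<gamma> (z' s) - \<gamma>' (z' s)))"
  by (intro continuous_intros feedback_compose \<gamma> z')

lemma feedback_diff_bound: "norm (\<gamma> x - \<gamma>' x) \<le> 2 * M"
  using norm_triangle_ineq4[of "\<gamma> x" "\<gamma>' x"] feedback_bound[OF \<gamma>(1), of x] feedback_bound[OF \<gamma>(2), of x] by simp

lemma gap_continuous: "continuous_on {0..T} (gap h \<gamma> h' \<gamma>' z')"
  unfolding gap_def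
  by (intro continuous_intros continuous_on_indefinite_set_integral control_diff_integrable
      borel_integrable_atLeastAtMost' feedback_diff_continuous)

lemma gap_nonneg: "0 \<le> gap h \<gamma> h' \<gamma>' z' t"
  unfolding gap_def using K R by (auto simp: set_lebesgue_integral_def intro!: add_nonneg_nonneg mult_nonneg_nonneg integral_nonneg)

lemma gap_bounded:
  assumes t: "t \<in> {0..T}"
  shows "gap h \<gamma> h' \<gamma>' z' t \<le> 4 * K * R * M * T"
proof -
  have sub: "{0..t} \<subseteq> {0..T}" using t by auto
  have M: "0 \<le> M" using feedback_nonneg(1)[OF \<gamma>(1)] .
  have "(LINT s:{0..t}|lborel. norm (\<gamma> (z' s) - \<gamma>' (z' s))) \<le> t * (2 * M)"
    using t feedback_diff_bound
    by (intro set_integral_le_const borel_integrable_atLeastAtMost' continuous_on_subset[OF feedback_diff_continuous sub]) auto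
  also have "\<dots> \<le> T * (2 * M)" using t M by (intro mult_right_mono) auto
  finally have 1: "K * R * (LINT s:{0..t}|lborel. norm (\<gamma> (z' s) - \<gamma>' (z' s))) \<le> K * R * (T * (2 * M))"
    using K R by (intro mult_left_mono) auto
  have "norm (LINT s:{0..t}|lborel. pr (h s - h' s) (\<gamma>' (z' s))) \<le> (LINT s:{0..t}|lborel. K * (2 * R) * M)"
  proof (rule norm_set_integral_le)
    show "set_integrable lborel {0..t} (\<lambda>s. pr (h s - h' s) (\<gamma>' (z' s)))"
      by (rule set_integrable_subset[OF control_diff_integrable _ sub]) auto
    show "AE s\<in>{0..t} in lborel. norm (pr (h s - h' s) (\<gamma>' (z' s))) \<le> K * (2 * R) * M"
      using control_diff(2)
    proof eventually_elim
      case (elim s)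
      then show ?case using sub by (auto intro!: pr_bound feedback_bound \<gamma>)
    qed
  qed (intro borel_integrable_atLeastAtMost' continuous_intros)
  also have "\<dots> = t * (K * (2 * R) * M)" using t by (subst set_integral_const) auto
  also have "\<dots> \<le> T * (K * (2 * R) * M)" using t M K R by (intro mult_right_mono) auto
  finally show ?thesis unfolding gap_def using 1 by (simp add: algebra_simps)
qed

lemma solution_difference:
  assumes z: "solves w h \<gamma> z" and z'_solves: "solves w h' \<gamma>' z'" and t: "t \<in> {0..T}"
  shows "norm (z t - z' t) \<le> gap h \<gamma> h' \<gamma>' z' t + D * exp (D * T) * (LINT s:{0..T}|lborel. gap h \<gamma> h' \<gamma>' z' s)"
proof (rule Gronwall_integral[OF _ _ gap_continuous _ gap_nonneg t])
  interpret bounded_bilinear pr by (rule bilinear)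
  show "0 \<le> D" using D_pos[OF \<gamma>(1)] by simp
  have zc: "continuous_on {0..T} z" using z by (simp add: solves_def)
  show nc: "continuous_on {0..T} (\<lambda>t. norm (z t - z' t))" by (intro continuous_intros zc z')
  fix t assume t: "t \<in> {0..T}"
  have sub: "{0..t} \<subseteq> {0..T}" using t by auto
  \<comment> \<open>The difference of the right-hand sides is telescoped: \<open>A\<close> changes
    the state, \<open>B\<close> the feedback at \<open>z'\<close>, and \<open>G\<close> the control
    at \<open>z'\<close>. Gronwall's inequality absorbs \<open>A\<close>; the other two make up
    \<open>gap\<close>.\<close>
  define A where "A s = rhs h \<gamma> s (z s) - rhs h \<gamma> s (z' s)" for s
  define B where "B s = pr (h s) (\<gamma> (z' s) - \<gamma>' (z' s))" for s
  define G where "G s = pr (h s - h' s) (\<gamma>' (z' s))" for s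
  have i: "set_integrable lborel {0..t} A" "set_integrable lborel {0..t} B" "set_integrable lborel {0..t} G"
    unfolding A_def B_def G_def
    by (rule set_integrable_subset[OF _ _ sub], 
       intro set_integral_diff rhs_integrable h \<gamma> zc z' control_diff_integrable
       pr_integrable[OF control_measurable control_bound] continuous_intros feedback_compose, simp)+
  have ir: "set_integrable lborel {0..t} (\<lambda>s. rhs h \<gamma> s (z s))" "set_integrable lborel {0..t} (\<lambda>s. rhs h' \<gamma>' s (z' s))"
    by (rule set_integrable_subset[OF _ _ sub], intro rhs_integrable h \<gamma> zc z', simp)+
  have "z t - z' t = (LINT s:{0..t}|lborel. rhs h \<gamma> s (z s)) - (LINT s:{0..t}|lborel. rhs h' \<gamma>' s (z' s))"
    using z z'_solves t by (simp add: solves_def)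
  also have "\<dots> = (LINT s:{0..t}|lborel. rhs h \<gamma> s (z s) - rhs h' \<gamma>' s (z' s))"
    using set_integral_diff(2)[OF ir] by simp
  also have "\<dots> = (LINT s:{0..t}|lborel. (A s + B s) + G s)"
    by (intro arg_cong[where f="set_lebesgue_integral lborel {0..t}"] ext)
      (simp add: A_def B_def G_def rhs_def diff_left diff_right)
  also have "\<dots> = (LINT s:{0..t}|lborel. A s) + (LINT s:{0..t}|lborel. B s) + (LINT s:{0..t}|lborel. G s)"
    using set_integral_add(2)[OF set_integral_add(1)[OF i(1,2)] i(3)] set_integral_add(2)[OF i(1,2)] by simp
  finally have eq: "z t - z' t = \<dots>" .
  have "norm (LINT s:{0..t}|lborel. A s) \<le> (LINT s:{0..t}|lborel. D * norm (z s - z' s))"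
  proof (rule norm_set_integral_le[OF i(1)])
    show "set_integrable lborel {0..t} (\<lambda>s. D * norm (z s - z' s))"
      by (intro borel_integrable_atLeastAtMost' continuous_on_mult_left continuous_on_subset[OF nc sub])
    show "AE s\<in>{0..t} in lborel. norm (A s) \<le> D * norm (z s - z' s)"
      using rhs_lipschitz[OF h(1) \<gamma>(1)] by eventually_elim (use sub in \<open>auto simp: A_def\<close>)
  qed
  then have 1: "norm (LINT s:{0..t}|lborel. A s) \<le> D * (LINT s:{0..t}|lborel. norm (z s - z' s))" 
    by (simp only: set_integral_mult_right)
  have "norm (LINT s:{0..t}|lborel. B s) \<le> (LINT s:{0..t}|lborel. K * R * norm (\<gamma> (z' s) - \<gamma>' (z' s)))"
  proof (rule norm_set_integral_le[OF i(2)])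
    show "set_integrable lborel {0..t} (\<lambda>s. K * R * norm (\<gamma> (z' s) - \<gamma>' (z' s)))"
      by (intro borel_integrable_atLeastAtMost' continuous_on_mult_left continuous_on_subset[OF feedback_diff_continuous sub])
    show "AE s\<in>{0..t} in lborel. norm (B s) \<le> K * R * norm (\<gamma> (z' s) - \<gamma>' (z' s))"
      using control_bound[OF h(1)] by eventually_elim (use sub in \<open>auto simp: B_def intro!: pr_bound\<close>)
  qed
  then have 2: "norm (LINT s:{0..t}|lborel. B s) \<le> K * R * (LINT s:{0..t}|lborel. norm (\<gamma> (z' s) - \<gamma>' (z' s)))"
    by (simp only: set_integral_mult_right)
  show "norm (z t - z' t) \<le> gap h \<gamma> h' \<gamma>' z' t + D * (LINT s:{0..t}|lborel. norm (z s - z' s))"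
    unfolding eq gap_def G_def[symmetric]
    using 1 2 norm_triangle_ineq[of "(LINT s:{0..t}|lborel. A s) + (LINT s:{0..t}|lborel. B s)" "LINT s:{0..t}|lborel. G s"]
      norm_triangle_ineq[of "LINT s:{0..t}|lborel. A s" "LINT s:{0..t}|lborel. B s"] by linarith
qed

end

text \<open>Each of the two terms of \<open>gap\<close> is at most \<open>2 * K * R * M * T\<close>;
  the sum is inserted into the Gronwall estimate. The result depends neither on the forcing nor on
  the controls, hence not on \<omega>.\<close>

definition spread :: real where
  "spread = 4 * K * R * M * T + D * exp (D * T) * (T * (4 * K * R * M * T))"

lemma solution_spread:
  assumes "h \<in> controls" "h' \<in> controls" "feedback \<gamma>" "feedback \<gamma>'"
    and "solves w h \<gamma> z" "solves w h' \<gamma>' z'" and t: "t \<in> {0..T}"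
  shows "norm (z t - z' t) \<le> spread"
proof -
  have z': "continuous_on {0..T} z'" using assms by (simp add: solves_def)
  note gp = assms(1-4) z'
  have "(LINT s:{0..T}|lborel. gap h \<gamma> h' \<gamma>' z' s) \<le> T * (4 * K * R * M * T)"
    using T gap_bounded[OF gp]
    by (intro set_integral_le_const borel_integrable_atLeastAtMost' gap_continuous[OF gp]) auto
  then have "D * exp (D * T) * (LINT s:{0..T}|lborel. gap h \<gamma> h' \<gamma>' z' s) \<le> D * exp (D * T) * (T * (4 * K * R * M * T))"
    using D_pos[OF assms(3)] by (intro mult_left_mono) auto
  then show ?thesis
    using solution_difference[OF gp assms(5,6) t] gap_bounded[OF gp t] unfolding spread_def by linarith
qed

text \<open>Along the fixed path \<open>z'\<close> the feedback term of \<open>gap\<close> vanishes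
  by dominated convergence, and the control term by weak convergence against the continuous function
  \<open>\<gamma>' (z' s)\<close>. Bounded convergence treats the integral of \<open>gap\<close>,
  and Gronwall's inequality concludes.\<close>

lemma solution_convergence:
  assumes h: "\<And>k. h k \<in> controls" "h' \<in> controls" and \<gamma>: "\<And>k. feedback (\<gamma> k)" "feedback \<gamma>'"
    and h_lim: "\<And>t. t \<in> {0..T} \<Longrightarrow> (\<lambda>k. LINT s:{0..t}|lborel. h k s) \<longlonglongrightarrow> (LINT s:{0..t}|lborel. h' s)"
    and \<gamma>_lim: "\<And>x. (\<lambda>k. \<gamma> k x) \<longlonglongrightarrow> \<gamma>' x"
    and z: "\<And>k. solves w (h k) (\<gamma> k) (z k)" and z': "solves w h' \<gamma>' z'" and t: "t \<in> {0..T}"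
  shows "(\<lambda>k. z k t) \<longlonglongrightarrow> z' t"
proof -
  have zc: "continuous_on {0..T} z'" using z' by (simp add: solves_def)
  note gp = h(1) h(2) \<gamma>(1) \<gamma>(2) zc
  let ?g = "\<lambda>k. gap (h k) (\<gamma> k) h' \<gamma>' z'"
  have g: "(\<lambda>k. ?g k t) \<longlonglongrightarrow> 0" if t: "t \<in> {0..T}" for t
  proof -
    have sub: "{0..t} \<subseteq> {0..T}" using t by auto
    have "(\<lambda>k. LINT s:{0..t}|lborel. norm (\<gamma> k (z' s) - \<gamma>' (z' s))) \<longlonglongrightarrow> (LINT s:{0..t}|lborel. 0::real)"
    proof (rule set_integral_tendsto_bounded)
      show "set_borel_measurable lborel {0..t} (\<lambda>s. norm (\<gamma> k (z' s) - \<gamma>' (z' s)))" for k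
        by (intro set_borel_measurable_continuous_on_Icc continuous_on_subset[OF feedback_diff_continuous[OF gp] sub])
      show "AE s\<in>{0..t} in lborel. (\<lambda>k. norm (\<gamma> k (z' s) - \<gamma>' (z' s))) \<longlonglongrightarrow> 0"
        using \<gamma>_lim by (auto intro!: tendsto_norm_zero simp: LIM_zero)
      show "AE s\<in>{0..t} in lborel. norm (norm (\<gamma> k (z' s) - \<gamma>' (z' s))) \<le> 2 * M" for k
        using feedback_diff_bound[OF gp] by auto
    qed (simp add: set_borel_measurable_def)
    then have 1: "(\<lambda>k. K * R * (LINT s:{0..t}|lborel. norm (\<gamma> k (z' s) - \<gamma>' (z' s)))) \<longlonglongrightarrow> 0"
      by (intro tendsto_mult_right_zero) simp
    have "(\<lambda>k. LINT s:{0..t}|lborel. pr (h k s - h' s) (\<gamma>' (z' s))) \<longlonglongrightarrow> 0"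
    proof (rule bilinear_weak_convergence_zero[OF bilinear control_diff[OF gp] _ feedback_compose[OF \<gamma>(2) zc] t])
      fix t assume t: "t \<in> {0..T}"
      have "(\<lambda>k. (LINT s:{0..t}|lborel. h k s) - (LINT s:{0..t}|lborel. h' s)) \<longlonglongrightarrow> 0"
        using h_lim[OF t] by (rule LIM_zero)
      moreover have "(LINT s:{0..t}|lborel. h k s - h' s) = (LINT s:{0..t}|lborel. h k s) - (LINT s:{0..t}|lborel. h' s)" for k
        using t by (intro set_integral_diff set_integrable_subset[OF control_integrable] h) auto
      ultimately show "(\<lambda>k. LINT s:{0..t}|lborel. h k s - h' s) \<longlonglongrightarrow> 0" by simp
    qed
    from tendsto_add[OF 1 tendsto_norm_zero[OF this]] show ?thesis unfolding gap_def by simp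
  qed
  have "(\<lambda>k. LINT s:{0..T}|lborel. ?g k s) \<longlonglongrightarrow> (LINT s:{0..T}|lborel. 0::real)"
  proof (rule set_integral_tendsto_bounded)
    show "set_borel_measurable lborel {0..T} (?g k)" for k
      by (intro set_borel_measurable_continuous_on_Icc gap_continuous[OF gp])
    show "AE s\<in>{0..T} in lborel. (\<lambda>k. ?g k s) \<longlonglongrightarrow> 0" using g by auto
    show "AE s\<in>{0..T} in lborel. norm (?g k s) \<le> 4 * K * R * M * T" for k
      using gap_bounded[OF gp] gap_nonneg[OF gp] by auto
  qed (simp add: set_borel_measurable_def)
  then have "(\<lambda>k. ?g k t + D * exp (D * T) * (LINT s:{0..T}|lborel. ?g k s)) \<longlonglongrightarrow> 0 + D * exp (D * T) * 0"
    by (intro tendsto_add tendsto_mult tendsto_const g t) simp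
  then have lim0: "(\<lambda>k. ?g k t + D * exp (D * T) * (LINT s:{0..T}|lborel. ?g k s)) \<longlonglongrightarrow> 0"
    by simp
  have "(\<lambda>k. z k t - z' t) \<longlonglongrightarrow> 0"
    by (rule Lim_null_comparison[OF always_eventually lim0]) (rule allI, rule solution_difference[OF gp z z' t])
  then show ?thesis by (rule LIM_zero_cancel)
qed

end

section \<open>Costs\<close>

context controlled_equation begin

lemma midpoint_hull_controls:
  assumes "A \<subseteq> controls" shows "midpoint_hull A \<subseteq> controls"
proof
  fix f assume "f \<in> midpoint_hull A"
  then show "f \<in> controls"
  proof induction
    case (base f)
    then show ?case using assms by auto
  next
    case (midpoint f g)
    have "AE s\<in>{0..T} in lborel. (1/2) *\<^sub>R (f s + g s) \<in> U"
      using control_in[OF midpoint.IH(1)] control_in[OF midpoint.IH(2)]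
    proof eventually_elim
      case (elim s)
      show ?case
        using elim convexD[OF U(2), of "f s" "g s" "1/2" "1/2"] by (auto simp: scaleR_add_right)
    qed
    moreover have "set_integrable lborel {0..T} (\<lambda>s. (1/2) *\<^sub>R (f s + g s))"
      by (intro set_integrable_scaleR_right set_integral_add control_integrable midpoint.IH)
    ultimately show ?case by (simp add: L1_controls_def)
  qed
qed

text \<open>The integral is linear in the control and balls are convex. Applied to a tail of a
  sequence with convergent primitives, this shows that the combinations have the same limit of
  primitives.\<close>

lemma midpoint_hull_integral_close:
  assumes "f \<in> midpoint_hull A" "A \<subseteq> controls" "t \<in> {0..T}"
    and "\<And>f. f \<in> A \<Longrightarrow> norm ((LINT s:{0..t}|lborel. f s) - H) \<le> e"
  shows "norm ((LINT s:{0..t}|lborel. f s) - H) \<le> e"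
  using assms(1)
proof induction
  case (base f)
  then show ?case by (rule assms)
next
  case (midpoint f g)
  have "set_integrable lborel {0..t} f'" if "f' \<in> midpoint_hull A" for f'
    using midpoint_hull_controls[OF assms(2)] that assms(3)
    by (intro set_integrable_subset[OF control_integrable]) auto
  then have "(LINT s:{0..t}|lborel. (1/2) *\<^sub>R (f s + g s)) - H
      = (1/2) *\<^sub>R (((LINT s:{0..t}|lborel. f s) - H) + ((LINT s:{0..t}|lborel. g s) - H))"
    using midpoint.hyps by (simp add: set_integral_add(2) algebra_simps flip: scaleR_left.add)
  also have "norm \<dots> \<le> e"
    using midpoint.IH norm_triangle_ineq[of "(LINT s:{0..t}|lborel. f s) - H" "(LINT s:{0..t}|lborel. g s) - H"] by simp
  finally show ?case .
qed

text \<open>Identifies \<open>H\<close> as the primitive of an admissible control. The almost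
  everywhere limit of the combinations has values in \<open>U\<close> because \<open>U\<close> is
  closed and convex, and dominated convergence computes its primitive. The combinations
  \<open>f\<close> stay in the conclusion since the cost estimate is applied to them.\<close>

lemma weak_control_limit:
  assumes h: "\<And>k. h k \<in> controls"
    and H: "\<And>t. t \<in> {0..T} \<Longrightarrow> (\<lambda>k. LINT s:{0..t}|lborel. h k s) \<longlonglongrightarrow> H t"
  obtains f h' where "\<And>j. f j \<in> midpoint_hull (h ` {j..})" "h' \<in> controls"
    "AE s\<in>{0..T} in lborel. (\<lambda>j. f j s) \<longlonglongrightarrow> h' s"
    "\<And>t. t \<in> {0..T} \<Longrightarrow> (LINT s:{0..t}|lborel. h' s) = H t"
proof -
  let ?N = "restrict_space lborel {0..T}"
  have N: "{0..T} \<inter> space lborel \<in> sets lborel" by simp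
  obtain f h' where f: "\<And>j. f j \<in> midpoint_hull (h ` {j..})" and h'm: "h' \<in> borel_measurable ?N"
    and lim: "AE s in ?N. (\<lambda>j. f j s) \<longlonglongrightarrow> h' s"
  proof (rule midpoint_hull_converges_AE[of ?N h R])
    show "finite_measure ?N" by (rule finite_measureI) (use T in \<open>simp add: emeasure_restrict_space space_restrict_space\<close>)
    show "h k \<in> borel_measurable ?N" for k
      using control_measurable[OF h] unfolding borel_measurable_restrict_space_iff[OF N] set_borel_measurable_def .
    show "AE s in ?N. norm (h k s) \<le> R" for k
      unfolding AE_restrict_space_iff[OF N] using control_bound[OF h] .
  qed blast
  have lim: "AE s\<in>{0..T} in lborel. (\<lambda>j. f j s) \<longlonglongrightarrow> h' s"
    using lim unfolding AE_restrict_space_iff[OF N] .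
  have hm: "set_borel_measurable lborel {0..T} h'"
    using h'm unfolding borel_measurable_restrict_space_iff[OF N] set_borel_measurable_def .
  have hA: "h ` {j..} \<subseteq> controls" for j using h by auto
  have fc: "f j \<in> controls" for j
    using midpoint_hull_controls[OF hA] f by blast
  have "AE s in lborel. \<forall>j. s \<in> {0..T} \<longrightarrow> f j s \<in> U"
    unfolding AE_all_countable using control_in[OF fc] by blast
  then have h'U: "AE s\<in>{0..T} in lborel. h' s \<in> U"
    using lim
  proof eventually_elim
    case (elim s)
    show ?case
    proof
      assume "s \<in> {0..T}"
      then have "\<And>j. f j s \<in> U" "(\<lambda>j. f j s) \<longlonglongrightarrow> h' s" using elim by auto
      then show "h' s \<in> U" by (rule closed_sequentially[OF compact_imp_closed[OF U(1)]])
    qed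
  qed
  have "AE s\<in>{0..T} in lborel. norm (h' s) \<le> R"
    using h'U by eventually_elim (auto intro: R)
  then have h'c: "h' \<in> controls"
    using set_integrable_bounded[OF hm] h'U by (simp add: L1_controls_def)
  show ?thesis
  proof (rule that[OF f h'c lim])
    fix t assume t: "t \<in> {0..T}"
    have sub: "{0..t} \<subseteq> {0..T}" using t by auto
    have "(\<lambda>j. LINT s:{0..t}|lborel. f j s) \<longlonglongrightarrow> (LINT s:{0..t}|lborel. h' s)"
    proof (rule set_integral_tendsto_bounded)
      show "set_borel_measurable lborel {0..t} (f j)" for j
        by (rule set_borel_measurable_subset[OF control_measurable[OF fc] _ sub]) simp
      show "set_borel_measurable lborel {0..t} h'"
        by (rule set_borel_measurable_subset[OF hm _ sub]) simp
      show "AE s\<in>{0..t} in lborel. (\<lambda>j. f j s) \<longlonglongrightarrow> h' s"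
        using lim by eventually_elim (use sub in auto)
      show "AE s\<in>{0..t} in lborel. norm (f j s) \<le> R" for j
        using control_bound[OF fc] by eventually_elim (use sub in auto)
    qed
    moreover have "(\<lambda>j. LINT s:{0..t}|lborel. f j s) \<longlonglongrightarrow> H t"
    proof (rule LIMSEQ_I)
      fix e :: real assume e: "0 < e"
      then obtain n where n: "\<And>k. n \<le> k \<Longrightarrow> norm ((LINT s:{0..t}|lborel. h k s) - H t) < e / 2"
        using LIMSEQ_D[OF H[OF t], of "e/2"] by auto
      have "norm ((LINT s:{0..t}|lborel. f j s) - H t) < e" if j: "n \<le> j" for j
      proof -
        have "norm ((LINT s:{0..t}|lborel. f j s) - H t) \<le> e / 2"
          by (rule midpoint_hull_integral_close[OF f hA t]) (use n j in \<open>auto intro: less_imp_le\<close>)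
        then show ?thesis using e by simp
      qed
      then show "\<exists>n. \<forall>j\<ge>n. norm ((LINT s:{0..t}|lborel. f j s) - H t) < e" by blast
    qed
    ultimately show "(LINT s:{0..t}|lborel. h' s) = H t" by (rule LIMSEQ_unique)
  qed
qed

text \<open>Primitives of controls bounded by \<open>R\<close> are \<open>R\<close>-Lipschitz, so a
  subsequence of them converges pointwise. That \<open>H\<close> is again the primitive of a control
  is left to \<open>weak_control_limit\<close>.\<close>

lemma control_subsequence:
  assumes h: "\<And>k. h k \<in> controls"
  obtains r :: "nat \<Rightarrow> nat" and H where "strict_mono r"
    "\<And>t. t \<in> {0..T} \<Longrightarrow> (\<lambda>k. LINT s:{0..t}|lborel. h (r k) s) \<longlonglongrightarrow> H t"
proof (rule equi_Lipschitz_subsequence[of R "{0..T}" "\<lambda>k t. LINT s:{0..t}|lborel. h k s" "T * R"])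
  have bnd: "norm (LINT s:{x..y}|lborel. h k s) \<le> (y - x) * R" if "0 \<le> x" "x \<le> y" "y \<le> T" for k x y
  proof -
    have sub: "{x..y} \<subseteq> {0..T}" using that by auto
    have "norm (LINT s:{x..y}|lborel. h k s) \<le> (LINT s:{x..y}|lborel. R)"
    proof (rule norm_set_integral_le)
      show "set_integrable lborel {x..y} (h k)"
        by (rule set_integrable_subset[OF control_integrable[OF h] _ sub]) simp
      show "AE s\<in>{x..y} in lborel. norm (h k s) \<le> R"
        using control_bound[OF h] by eventually_elim (use sub in auto)
    qed (intro borel_integrable_atLeastAtMost' continuous_intros)
    also have "\<dots> = (y - x) * R" using that by (subst set_integral_const) auto
    finally show ?thesis .
  qed
  show "R-lipschitz_on {0..T} (\<lambda>t. LINT s:{0..t}|lborel. h k s)" for k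
  proof (rule lipschitz_onI)
    have *: "dist (LINT s:{0..x}|lborel. h k s) (LINT s:{0..y}|lborel. h k s) \<le> R * dist x y"
      if xy: "0 \<le> x" "x \<le> y" "y \<le> T" for x y
      using bnd[OF xy, of k] set_integral_Icc_add[OF control_integrable[OF h] xy, of k] xy
      by (simp add: dist_norm norm_minus_commute dist_real_def mult.commute)
    fix x y assume "x \<in> {0..T}" "y \<in> {0..T}"
    then show "dist (LINT s:{0..x}|lborel. h k s) (LINT s:{0..y}|lborel. h k s) \<le> R * dist x y"
      using *[of x y] *[of y x] by (cases "x \<le> y") (auto simp: dist_commute)
  qed (use R in simp)
  show "norm (LINT s:{0..x}|lborel. h k s) \<le> T * R" if "x \<in> {0..T}" for k x
  proof -
    have "x * R \<le> T * R" using that R(1) by (intro mult_right_mono) auto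
    then show ?thesis using bnd[of 0 x k] that by simp
  qed
qed (auto intro: that)

lemma feedback_limit:
  assumes "\<And>k. feedback (\<gamma> k)" "\<And>x. (\<lambda>k. \<gamma> k x) \<longlonglongrightarrow> \<gamma>' x"
  shows "feedback \<gamma>'"
  unfolding feedback_def
proof (intro conjI allI lipschitz_onI)
  show "norm (\<gamma>' x) \<le> M" for x
    using feedback_bound[OF assms(1)] by (intro LIMSEQ_le_const2[OF tendsto_norm[OF assms(2)]]) auto
  show "dist (\<gamma>' x) (\<gamma>' y) \<le> L * dist x y" for x y
    using assms(1) by (intro LIMSEQ_le_const2[OF tendsto_dist[OF assms(2) assms(2)]])
      (auto simp: feedback_def lipschitz_on_def)
  show "0 \<le> L" by (rule feedback_nonneg(2)[OF assms(1)[of 0]])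
qed

lemma feedback_subsequence:
  assumes "\<And>k. feedback (\<gamma> k)"
  obtains r :: "nat \<Rightarrow> nat" and \<gamma>' where "strict_mono r" "feedback \<gamma>'" "\<And>x. (\<lambda>k. \<gamma> (r k) x) \<longlonglongrightarrow> \<gamma>' x"
proof (rule equi_Lipschitz_subsequence[of L UNIV \<gamma> M])
  show "L-lipschitz_on UNIV (\<gamma> k)" for k using assms by (simp add: feedback_def)
  show "norm (\<gamma> k x) \<le> M" for k x by (rule feedback_bound[OF assms])
  fix r :: "nat \<Rightarrow> nat" and \<gamma>' assume r: "strict_mono r" "\<And>x. x \<in> UNIV \<Longrightarrow> (\<lambda>k. \<gamma> (r k) x) \<longlonglongrightarrow> \<gamma>' x"
  have "feedback \<gamma>'" by (rule feedback_limit[of "\<lambda>k. \<gamma> (r k)"]) (use assms r in auto)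
  with r show ?thesis by (intro that) auto
qed

end

section \<open>Random forcing and the two parts of the cost\<close>

locale controlled_process = controlled_equation T C K R M L b pr U + prob_space P
  for T C K R M L :: real and b :: "'v::euclidean_space \<Rightarrow> 'v"
    and pr :: "'a::euclidean_space \<Rightarrow> 'b::euclidean_space \<Rightarrow> 'v" and U :: "'a set"
    and P :: "'w measure" +
  fixes w :: "'w \<Rightarrow> real \<Rightarrow> 'v" and \<l> :: "real \<Rightarrow> 'v \<Rightarrow> real" and \<Psi> :: "'a \<Rightarrow> 'b \<Rightarrow> real"
  assumes running_cost: "uniformly_continuous_on ({0..T} \<times> UNIV) (\<lambda>(t, x). \<l> t x)"
    and control_cost: "continuous_on UNIV (\<lambda>(a, c). \<Psi> a c)" "\<And>c. convex_on UNIV (\<lambda>a. \<Psi> a c)"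
begin

definition process :: "(real \<Rightarrow> 'a) \<Rightarrow> ('v \<Rightarrow> 'b) \<Rightarrow> ('w \<Rightarrow> real \<Rightarrow> 'v) \<Rightarrow> bool" where
  "process h \<gamma> Z \<longleftrightarrow> (\<forall>t\<in>{0..T}. (\<lambda>\<omega>. Z \<omega> t) \<in> borel_measurable P) \<and>
    (\<forall>\<omega>\<in>space P. continuous_on {0..T} (Z \<omega>)) \<and> (AE \<omega> in P. solves (w \<omega>) h \<gamma> (Z \<omega>))"

text \<open>Abstracts the values of a feedback along a trajectory. It decouples them from the
  control, so that the controls of a sequence can be paired with the feedback values along the limit
  path.\<close>

definition bounded_process :: "('w \<Rightarrow> real \<Rightarrow> 'b) \<Rightarrow> bool" where
  "bounded_process \<phi> \<longleftrightarrow> (\<forall>t\<in>{0..T}. (\<lambda>\<omega>. \<phi> \<omega> t) \<in> borel_measurable P) \<and>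
    (\<forall>\<omega>\<in>space P. continuous_on {0..T} (\<phi> \<omega>)) \<and> (\<forall>\<omega> t. norm (\<phi> \<omega> t) \<le> M)"

definition running :: "('w \<Rightarrow> real \<Rightarrow> 'v) \<Rightarrow> 'w \<Rightarrow> real" where
  "running Z \<omega> = (LINT t:{0..T}|lborel. \<l> t (Z \<omega> t))"

definition effort :: "(real \<Rightarrow> 'a) \<Rightarrow> ('w \<Rightarrow> real \<Rightarrow> 'b) \<Rightarrow> 'w \<Rightarrow> real" where
  "effort h \<phi> \<omega> = (LINT t:{0..T}|lborel. \<Psi> (h t) (\<phi> \<omega> t))"

definition cost :: "(real \<Rightarrow> 'a) \<Rightarrow> ('v \<Rightarrow> 'b) \<Rightarrow> ('w \<Rightarrow> real \<Rightarrow> 'v) \<Rightarrow> real" where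
  "cost h \<gamma> Z = (\<integral>\<omega>. running Z \<omega> + effort h (\<lambda>\<omega> t. \<gamma> (Z \<omega> t)) \<omega> \<partial>P)"

lemma process_path: "process h \<gamma> Z \<Longrightarrow> \<omega> \<in> space P \<Longrightarrow> continuous_on {0..T} (Z \<omega>)"
  by (simp add: process_def)

lemma bounded_process_feedback:
  assumes "process h \<gamma> Z" "feedback \<gamma>"
  shows "bounded_process (\<lambda>\<omega> t. \<gamma> (Z \<omega> t))"
  unfolding bounded_process_def
proof (intro conjI ballI allI)
  show "(\<lambda>\<omega>. \<gamma> (Z \<omega> t)) \<in> borel_measurable P" if "t \<in> {0..T}" for t
    using assms that
    by (intro measurable_compose[OF _ borel_measurable_continuous_onI[OF feedback_continuous]])
      (auto simp: process_def)
qed (auto intro: feedback_compose[OF assms(2) process_path[OF assms(1)]] feedback_bound[OF assms(2)])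

section \<open>The running cost along trajectories\<close>

lemma running_cost_compose:
  assumes "continuous_on {0..T} z" shows "continuous_on {0..T} (\<lambda>t. \<l> t (z t))"
proof -
  have "continuous_on {0..T} (\<lambda>t. case (t, z t) of (t, x) \<Rightarrow> \<l> t x)"
    by (rule continuous_on_compose2[OF uniformly_continuous_imp_continuous[OF running_cost]])
      (auto intro!: continuous_intros assms)
  then show ?thesis by simp
qed

lemma running_cost_continuous:
  assumes "t \<in> {0..T}" shows "continuous_on UNIV (\<l> t)"
proof -
  have "continuous_on UNIV (\<lambda>x. case (t, x) of (t, x) \<Rightarrow> \<l> t x)"
    by (rule continuous_on_compose2[OF uniformly_continuous_imp_continuous[OF running_cost]])
      (use assms in \<open>auto intro!: continuous_intros\<close>)
  then show ?thesis by simp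
qed

lemma running_measurable:
  assumes "process h \<gamma> Z" shows "running Z \<in> borel_measurable P"
  unfolding running_def[abs_def]
proof (rule borel_measurable_set_integral_paths[where \<phi>="\<lambda>\<omega> t. \<l> t (Z \<omega> t)" and f="\<lambda>t x. x"])
  show "0 \<le> T" using T by simp
  show "(\<lambda>\<omega>. \<l> t (Z \<omega> t)) \<in> borel_measurable P" if "t \<in> {0..T}" for t
    using assms that
    by (intro measurable_compose[OF _ borel_measurable_continuous_onI[OF running_cost_continuous]])
      (auto simp: process_def)
  show "continuous_on {0..T} (\<lambda>t. \<l> t (Z \<omega> t))" if "\<omega> \<in> space P" for \<omega>
    by (rule running_cost_compose[OF process_path[OF assms that]])
qed measurable

text \<open>Uniform continuity bounds the increment over any fixed distance: the segment between two
  states is cut into finitely many pieces shorter than \<open>\<delta>\<close>, each of which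
  changes the cost by less than 1.\<close>

lemma running_cost_spread:
  obtains B where "0 \<le> B" "\<And>t x y. t \<in> {0..T} \<Longrightarrow> norm (x - y) \<le> spread \<Longrightarrow> \<bar>\<l> t x - \<l> t y\<bar> \<le> B"
proof -
  obtain \<delta> where \<delta>: "0 < \<delta>" and uc: "\<And>t x y. t \<in> {0..T} \<Longrightarrow> norm (x - y) < \<delta> \<Longrightarrow> \<bar>\<l> t x - \<l> t y\<bar> < 1"
  proof -
    obtain \<delta> where "0 < \<delta>" and d: "\<And>p q. p \<in> {0..T} \<times> UNIV \<Longrightarrow> q \<in> {0..T} \<times> UNIV \<Longrightarrow> dist q p < \<delta>
        \<Longrightarrow> dist (case q of (t, x) \<Rightarrow> \<l> t x) (case p of (t, x) \<Rightarrow> \<l> t x) < 1"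
      using running_cost unfolding uniformly_continuous_on_def by (meson zero_less_one)
    have "\<bar>\<l> t x - \<l> t y\<bar> < 1" if "t \<in> {0..T}" "norm (x - y) < \<delta>" for t x y
      using d[of "(t, y)" "(t, x)"] that by (simp add: dist_Pair_Pair dist_norm)
    with \<open>0 < \<delta>\<close> show ?thesis by (rule that)
  qed
  have chain: "\<bar>\<l> t x - \<l> t y\<bar> \<le> real (Suc n)" if "t \<in> {0..T}" "norm (x - y) < real (Suc n) * \<delta>" for t x y n
    using that(2)
  proof (induction n arbitrary: y)
    case 0
    then show ?case using uc[OF that(1), of x y] by simp
  next
    case (Suc n)
    \<comment> \<open>\<open>y'\<close> ends the first of \<open>n + 2\<close> equal pieces of the
      segment from \<open>y\<close> to \<open>x\<close>: that piece is shorter than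
      \<open>\<delta>\<close>, and the rest is shorter than \<open>Suc n * \<delta>\<close>.\<close>
    define c where "c = 1 / real (Suc (Suc n))"
    have c: "0 < c" "c * real (Suc (Suc n)) = 1" by (auto simp: c_def)
    have c': "(1 - c) * real (Suc (Suc n)) = real (Suc n)" "0 \<le> 1 - c"
      by (auto simp: c_def field_simps)
    define y' where "y' = y + c *\<^sub>R (x - y)"
    have "x - y' = (1 - c) *\<^sub>R (x - y)" by (simp add: y'_def algebra_simps)
    then have "norm (x - y') = (1 - c) * norm (x - y)" using c' by simp
    also have "\<dots> < (1 - c) * (real (Suc (Suc n)) * \<delta>)"
      using Suc.prems by (intro mult_strict_left_mono) (auto simp: c_def)
    also have "\<dots> = real (Suc n) * \<delta>" using c' by (metis mult.assoc)
    finally have 1: "\<bar>\<l> t x - \<l> t y'\<bar> \<le> real (Suc n)" by (rule Suc.IH)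
    have "norm (y' - y) = c * norm (x - y)" using c by (simp add: y'_def)
    also have "\<dots> < c * (real (Suc (Suc n)) * \<delta>)"
      using Suc.prems c by (intro mult_strict_left_mono) auto
    also have "\<dots> = \<delta>" using c by (metis mult.assoc mult_1)
    finally have "\<bar>\<l> t y' - \<l> t y\<bar> < 1" by (rule uc[OF that(1)])
    with 1 show ?case by simp
  qed
  obtain n :: nat where "spread / \<delta> < real n" using reals_Archimedean2 by blast
  then have "spread < real (Suc n) * \<delta>" using \<delta> by (simp add: field_simps)
  then show ?thesis using chain by (intro that[of "real (Suc n)"]) auto
qed

lemma running_spread:
  obtains B where "\<And>h h' \<gamma> \<gamma>' Z Z'. h \<in> controls \<Longrightarrow> h' \<in> controls \<Longrightarrow> feedback \<gamma> \<Longrightarrow> feedback \<gamma>' \<Longrightarrow>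
    process h \<gamma> Z \<Longrightarrow> process h' \<gamma>' Z' \<Longrightarrow> AE \<omega> in P. \<bar>running Z \<omega> - running Z' \<omega>\<bar> \<le> B"
proof -
  obtain B where B: "0 \<le> B" "\<And>t x y. t \<in> {0..T} \<Longrightarrow> norm (x - y) \<le> spread \<Longrightarrow> \<bar>\<l> t x - \<l> t y\<bar> \<le> B"
    using running_cost_spread by blast
  show ?thesis
  proof (rule that[of "T * B"])
    fix h h' \<gamma> \<gamma>' Z Z'
    assume *: "h \<in> controls" "h' \<in> controls" "feedback \<gamma>" "feedback \<gamma>'" and Z: "process h \<gamma> Z" "process h' \<gamma>' Z'"
    have "AE \<omega> in P. solves (w \<omega>) h \<gamma> (Z \<omega>)" "AE \<omega> in P. solves (w \<omega>) h' \<gamma>' (Z' \<omega>)"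
      using Z by (auto simp: process_def)
    with AE_space show "AE \<omega> in P. \<bar>running Z \<omega> - running Z' \<omega>\<bar> \<le> T * B"
    proof eventually_elim
      case (elim \<omega>)
      have i: "set_integrable lborel {0..T} (\<lambda>t. \<l> t (Z \<omega> t))" "set_integrable lborel {0..T} (\<lambda>t. \<l> t (Z' \<omega> t))"
        using Z elim(1) by (auto intro!: borel_integrable_atLeastAtMost' running_cost_compose process_path)
      have "norm (LINT t:{0..T}|lborel. \<l> t (Z \<omega> t) - \<l> t (Z' \<omega> t)) \<le> (LINT t:{0..T}|lborel. B)"
      proof (rule norm_set_integral_le[OF set_integral_diff(1)[OF i]])
        show "AE t\<in>{0..T} in lborel. norm (\<l> t (Z \<omega> t) - \<l> t (Z' \<omega> t)) \<le> B"
          using B(2) solution_spread[OF * elim(2,3)] by auto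
      qed (intro borel_integrable_atLeastAtMost' continuous_intros)
      also have "\<dots> = T * B" using T by (subst set_integral_const) auto
      finally show ?case unfolding running_def using set_integral_diff(2)[OF i] by simp
    qed
  qed
qed

lemma running_integrable_iff:
  assumes "h \<in> controls" "h' \<in> controls" "feedback \<gamma>" "feedback \<gamma>'" "process h \<gamma> Z" "process h' \<gamma>' Z'"
  shows "integrable P (running Z) \<longleftrightarrow> integrable P (running Z')"
proof -
  obtain B where "\<And>h h' \<gamma> \<gamma>' Z Z'. h \<in> controls \<Longrightarrow> h' \<in> controls \<Longrightarrow> feedback \<gamma> \<Longrightarrow> feedback \<gamma>' \<Longrightarrow>
    process h \<gamma> Z \<Longrightarrow> process h' \<gamma>' Z' \<Longrightarrow> AE \<omega> in P. \<bar>running Z \<omega> - running Z' \<omega>\<bar> \<le> B"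
    using running_spread by blast
  from this[OF assms] have "AE \<omega> in P. \<bar>running Z \<omega> - running Z' \<omega>\<bar> \<le> B" .
  then have d: "integrable P (\<lambda>\<omega>. running Z \<omega> - running Z' \<omega>)"
    using running_measurable[OF assms(5)] running_measurable[OF assms(6)]
    by (intro integrable_const_bound[of _ B]) auto
  show ?thesis
  proof
    assume "integrable P (running Z)"
    from Bochner_Integration.integrable_diff[OF this d] show "integrable P (running Z')" by simp
  next
    assume "integrable P (running Z')"
    from Bochner_Integration.integrable_add[OF this d] show "integrable P (running Z)" by simp
  qed
qed

section \<open>The control cost along bounded feedback paths\<close>

lemma control_cost_bounded:
  obtains B where "\<And>a c. a \<in> U \<Longrightarrow> norm c \<le> M \<Longrightarrow> \<bar>\<Psi> a c\<bar> \<le> B"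
proof -
  have "bounded ((\<lambda>(a, c). \<Psi> a c) ` (U \<times> cball 0 M))"
    by (intro compact_imp_bounded compact_continuous_image continuous_on_subset[OF control_cost(1)]
        compact_Times U compact_cball) auto
  then show ?thesis using that unfolding bounded_iff by (force simp: dist_norm)
qed

lemma effort_integrand_measurable:
  assumes h: "h \<in> controls" and u: "continuous_on {0..T} u"
  shows "set_borel_measurable lborel {0..T} (\<lambda>t. \<Psi> (h t) (u t))"
proof -
  \<comment> \<open>\<open>\<Psi>\<close> need not vanish at the origin. The indicator inside its
    arguments provides measurability, and a second indicator outside restores the integrand on
    [0, T].\<close>
  have "(\<lambda>t. \<Psi> (indicator {0..T} t *\<^sub>R h t) (indicator {0..T} t *\<^sub>R u t)) \<in> borel_measurable lborel"
    using control_measurable[OF h] set_borel_measurable_continuous_on_Icc[OF u]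
    unfolding set_borel_measurable_def
    by (intro borel_measurable_continuous_Pair[of _ _ _ \<Psi>])
      (use control_cost(1) in \<open>simp_all add: case_prod_beta\<close>)
  then have "(\<lambda>t. indicator {0..T} t *\<^sub>R \<Psi> (indicator {0..T} t *\<^sub>R h t) (indicator {0..T} t *\<^sub>R u t)) \<in> borel_measurable lborel"
    by measurable
  then show ?thesis unfolding set_borel_measurable_def
    by (rule measurable_cong[THEN iffD1, rotated]) (auto simp: indicator_def)
qed

lemma effort_integrand_bounded:
  obtains B where "\<And>h u. h \<in> controls \<Longrightarrow> (\<And>t. norm (u t) \<le> M) \<Longrightarrow>
    AE t\<in>{0..T} in lborel. norm (\<Psi> (h t) (u t)) \<le> B"
proof -
  obtain B where B: "\<And>a c. a \<in> U \<Longrightarrow> norm c \<le> M \<Longrightarrow> \<bar>\<Psi> a c\<bar> \<le> B"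
    using control_cost_bounded by blast
  show ?thesis
  proof (rule that[of B])
    fix h :: "real \<Rightarrow> 'a" and u :: "real \<Rightarrow> 'b"
    assume h: "h \<in> controls" and u: "\<And>t. norm (u t) \<le> M"
    show "AE t\<in>{0..T} in lborel. norm (\<Psi> (h t) (u t)) \<le> B"
      using control_in[OF h] by eventually_elim (use B u in auto)
  qed
qed

lemma effort_integrand_integrable:
  assumes "h \<in> controls" "bounded_process \<phi>" "\<omega> \<in> space P"
  shows "set_integrable lborel {0..T} (\<lambda>t. \<Psi> (h t) (\<phi> \<omega> t))"
proof -
  have *: "continuous_on {0..T} (\<phi> \<omega>)" "\<And>t. norm (\<phi> \<omega> t) \<le> M"
    using assms by (auto simp: bounded_process_def)
  obtain B where "AE t\<in>{0..T} in lborel. norm (\<Psi> (h t) (\<phi> \<omega> t)) \<le> B"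
    using effort_integrand_bounded assms(1) *(2) by metis
  then show ?thesis by (rule set_integrable_bounded[OF effort_integrand_measurable[OF assms(1) *(1)]])
qed

lemma effort_measurable:
  assumes "h \<in> controls" "bounded_process \<phi>"
  shows "effort h \<phi> \<in> borel_measurable P"
  unfolding effort_def[abs_def]
proof (rule borel_measurable_set_integral_paths[where \<phi>=\<phi> and f="\<lambda>t x. \<Psi> (h t) x"])
  show "0 \<le> T" using T by simp
  have [measurable]: "(\<lambda>s. indicator {0..T} s *\<^sub>R h s) \<in> borel_measurable borel"
    using control_measurable[OF assms(1)] by (simp add: set_borel_measurable_def)
  have "(\<lambda>x. \<Psi> (indicator {0..T} (fst x) *\<^sub>R h (fst x)) (snd x)) \<in> borel_measurable (borel \<Otimes>\<^sub>M borel)"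
    by (rule borel_measurable_continuous_Pair[of _ _ _ \<Psi>])
      (measurable, use control_cost(1) in \<open>simp add: case_prod_beta\<close>)
  then have "(\<lambda>x. indicator {0..T} (fst x) *\<^sub>R \<Psi> (indicator {0..T} (fst x) *\<^sub>R h (fst x)) (snd x)) \<in> borel_measurable (borel \<Otimes>\<^sub>M borel)"
    by measurable
  also have "(\<lambda>x. indicator {0..T} (fst x) *\<^sub>R \<Psi> (indicator {0..T} (fst x) *\<^sub>R h (fst x)) (snd x))
      = (\<lambda>(t, x). indicator {0..T} t *\<^sub>R \<Psi> (h t) x)"
    by (auto simp: fun_eq_iff indicator_def)
  finally show "(\<lambda>(t, x). indicator {0..T} t *\<^sub>R \<Psi> (h t) x) \<in> borel_measurable (borel \<Otimes>\<^sub>M borel)" .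
qed (use assms(2) in \<open>auto simp: bounded_process_def\<close>)

lemma effort_bounded:
  obtains B where "\<And>h \<phi> \<omega>. h \<in> controls \<Longrightarrow> bounded_process \<phi> \<Longrightarrow> \<omega> \<in> space P \<Longrightarrow> \<bar>effort h \<phi> \<omega>\<bar> \<le> B"
proof -
  obtain B where B: "\<And>h u. h \<in> controls \<Longrightarrow> (\<And>t. norm (u t) \<le> M) \<Longrightarrow>
    AE t\<in>{0..T} in lborel. norm (\<Psi> (h t) (u t)) \<le> B" using effort_integrand_bounded by blast
  show ?thesis
  proof (rule that[of "T * B"])
    fix h \<phi> \<omega> assume *: "h \<in> controls" "bounded_process \<phi>" "\<omega> \<in> space P"
    have "norm (effort h \<phi> \<omega>) \<le> (LINT t:{0..T}|lborel. B)"
      unfolding effort_def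
      by (rule norm_set_integral_le[OF effort_integrand_integrable[OF *] borel_integrable_atLeastAtMost' B])
        (use * in \<open>auto simp: bounded_process_def\<close>)
    also have "\<dots> = T * B" using T by (subst set_integral_const) auto
    finally show "\<bar>effort h \<phi> \<omega>\<bar> \<le> T * B" by simp
  qed
qed

lemma effort_integrable:
  assumes "h \<in> controls" "bounded_process \<phi>"
  shows "integrable P (effort h \<phi>)"
proof -
  obtain B where "\<And>h \<phi> \<omega>. h \<in> controls \<Longrightarrow> bounded_process \<phi> \<Longrightarrow> \<omega> \<in> space P \<Longrightarrow> \<bar>effort h \<phi> \<omega>\<bar> \<le> B"
    using effort_bounded by blast
  then show ?thesis
    using assms by (intro integrable_const_bound[of _ B] effort_measurable) auto
qed

lemma effort_midpoint:
  assumes f: "f \<in> controls" and g: "g \<in> controls" and \<phi>: "bounded_process \<phi>" and \<omega>: "\<omega> \<in> space P"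
  shows "effort (\<lambda>t. (1/2) *\<^sub>R (f t + g t)) \<phi> \<omega> \<le> (effort f \<phi> \<omega> + effort g \<phi> \<omega>) / 2"
proof -
  let ?m = "\<lambda>t. (1/2) *\<^sub>R (f t + g t)"
  have "?m \<in> controls"
    using midpoint_hull_controls[of "{f, g}"] midpoint_hull.midpoint[OF midpoint_hull.base midpoint_hull.base, of f "{f, g}" g] f g
    by auto
  note i = effort_integrand_integrable[OF this \<phi> \<omega>] effort_integrand_integrable[OF f \<phi> \<omega>]
    effort_integrand_integrable[OF g \<phi> \<omega>]
  have "effort ?m \<phi> \<omega> \<le> (LINT t:{0..T}|lborel. (\<Psi> (f t) (\<phi> \<omega> t) + \<Psi> (g t) (\<phi> \<omega> t)) / 2)"
    unfolding effort_def
  proof (rule set_integral_mono[OF i(1)])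
    show "set_integrable lborel {0..T} (\<lambda>t. (\<Psi> (f t) (\<phi> \<omega> t) + \<Psi> (g t) (\<phi> \<omega> t)) / 2)"
      by (intro set_integrable_divide set_integral_add i)
    fix t
    have "\<Psi> ((1/2) *\<^sub>R f t + (1/2) *\<^sub>R g t) (\<phi> \<omega> t) \<le> (1/2) * \<Psi> (f t) (\<phi> \<omega> t) + (1/2) * \<Psi> (g t) (\<phi> \<omega> t)"
      using convex_onD[OF control_cost(2)[of "\<phi> \<omega> t"], of "1/2" "f t" "g t"] by simp
    then show "\<Psi> ((1/2) *\<^sub>R (f t + g t)) (\<phi> \<omega> t) \<le> (\<Psi> (f t) (\<phi> \<omega> t) + \<Psi> (g t) (\<phi> \<omega> t)) / 2"
      by (simp add: scaleR_add_right add_divide_distrib)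
  qed
  also have "\<dots> = (effort f \<phi> \<omega> + effort g \<phi> \<omega>) / 2"
    unfolding effort_def using set_integral_add(2)[OF i(2,3)] by simp
  finally show ?thesis .
qed

text \<open>With \<open>\<phi>\<close> held fixed the expected control cost is midpoint convex in
  the control, so its sublevel sets are closed under the formation of the hull.\<close>

lemma expected_effort_midpoint_hull:
  assumes f: "f \<in> midpoint_hull A" and A: "A \<subseteq> controls" and \<phi>: "bounded_process \<phi>"
    and c: "\<And>h. h \<in> A \<Longrightarrow> expectation (effort h \<phi>) \<le> c"
  shows "expectation (effort f \<phi>) \<le> c"
  using f
proof induction
  case (base f)
  then show ?case by (rule c)
next
  case (midpoint f g)
  have fg: "f \<in> controls" "g \<in> controls" "(\<lambda>t. (1/2) *\<^sub>R (f t + g t)) \<in> controls"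
    using midpoint.hyps midpoint_hull.midpoint[OF midpoint.hyps(1,2)] midpoint_hull_controls[OF A] by auto
  have "expectation (effort (\<lambda>t. (1/2) *\<^sub>R (f t + g t)) \<phi>)
      \<le> expectation (\<lambda>\<omega>. (effort f \<phi> \<omega> + effort g \<phi> \<omega>) / 2)"
    using effort_integrable[OF _ \<phi>] fg by (intro integral_mono effort_midpoint \<phi>) auto
  also have "\<dots> = (expectation (effort f \<phi>) + expectation (effort g \<phi>)) / 2"
    using effort_integrable[OF _ \<phi>] fg by simp
  also have "\<dots> \<le> c" using midpoint.IH by simp
  finally show ?case .
qed

text \<open>Dominated convergence twice, in time for each \<omega> and then in \<omega>. It serves
  the combinations of controls, which converge almost everywhere, along one fixed path.\<close>

lemma expected_effort_tendsto:
  assumes f: "\<And>j. f j \<in> controls" and h: "h \<in> controls" and \<phi>: "bounded_process \<phi>"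
    and lim: "AE s\<in>{0..T} in lborel. (\<lambda>j. f j s) \<longlonglongrightarrow> h s"
  shows "(\<lambda>j. expectation (effort (f j) \<phi>)) \<longlonglongrightarrow> expectation (effort h \<phi>)"
proof -
  obtain B where B: "\<And>h \<phi> \<omega>. h \<in> controls \<Longrightarrow> bounded_process \<phi> \<Longrightarrow> \<omega> \<in> space P \<Longrightarrow> \<bar>effort h \<phi> \<omega>\<bar> \<le> B"
    using effort_bounded by blast
  obtain B' where B': "\<And>h u. h \<in> controls \<Longrightarrow> (\<And>t. norm (u t) \<le> M) \<Longrightarrow>
    AE t\<in>{0..T} in lborel. norm (\<Psi> (h t) (u t)) \<le> B'" using effort_integrand_bounded by blast
  show ?thesis
  proof (rule integral_dominated_convergence[where w="\<lambda>_. B"])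
    show "AE \<omega> in P. (\<lambda>j. effort (f j) \<phi> \<omega>) \<longlonglongrightarrow> effort h \<phi> \<omega>"
    proof (rule AE_I2)
      fix \<omega> assume \<omega>: "\<omega> \<in> space P"
      have p: "continuous_on {0..T} (\<phi> \<omega>)" "\<And>t. norm (\<phi> \<omega> t) \<le> M"
        using \<phi> \<omega> by (auto simp: bounded_process_def)
      show "(\<lambda>j. effort (f j) \<phi> \<omega>) \<longlonglongrightarrow> effort h \<phi> \<omega>"
        unfolding effort_def
      proof (rule set_integral_tendsto_bounded)
        show "AE t\<in>{0..T} in lborel. (\<lambda>j. \<Psi> (f j t) (\<phi> \<omega> t)) \<longlonglongrightarrow> \<Psi> (h t) (\<phi> \<omega> t)"
          using lim
        proof eventually_elim
          case (elim t)
          show ?case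
          proof
            assume "t \<in> {0..T}"
            then have "(\<lambda>j. (f j t, \<phi> \<omega> t)) \<longlonglongrightarrow> (h t, \<phi> \<omega> t)"
              using elim by (intro tendsto_intros) auto
            from continuous_on_tendsto_compose[OF control_cost(1) this]
            show "(\<lambda>j. \<Psi> (f j t) (\<phi> \<omega> t)) \<longlonglongrightarrow> \<Psi> (h t) (\<phi> \<omega> t)" by simp
          qed
        qed
        show "AE t\<in>{0..T} in lborel. norm (\<Psi> (f j t) (\<phi> \<omega> t)) \<le> B'" for j
          by (rule B'[OF f p(2)])
      qed (intro effort_integrand_measurable f h p)+
    qed
    show "AE \<omega> in P. norm (effort (f j) \<phi> \<omega>) \<le> B" for j
      using B[OF f[of j] \<phi>] by (intro AE_I2) simp
  qed (intro effort_measurable f h \<phi>, intro effort_measurable f h \<phi>, simp)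
qed

text \<open>The controls are not assumed to converge, so continuity of \<open>\<Psi>\<close> at a
  limit point is of no help. Uniform continuity on the compact set of control values and bounded
  feedback values makes the effect of changing \<open>\<phi>\<close> small uniformly in the
  control.\<close>

lemma expected_effort_perturbation:
  assumes h: "\<And>k. h k \<in> controls" and \<phi>: "\<And>k. bounded_process (\<phi> k)" "bounded_process \<phi>'"
    and lim: "AE \<omega> in P. \<forall>t\<in>{0..T}. (\<lambda>k. \<phi> k \<omega> t) \<longlonglongrightarrow> \<phi>' \<omega> t"
  shows "(\<lambda>k. expectation (effort (h k) (\<phi> k)) - expectation (effort (h k) \<phi>')) \<longlonglongrightarrow> 0"
proof -
  obtain B where B: "\<And>h \<phi> \<omega>. h \<in> controls \<Longrightarrow> bounded_process \<phi> \<Longrightarrow> \<omega> \<in> space P \<Longrightarrow> \<bar>effort h \<phi> \<omega>\<bar> \<le> B"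
    using effort_bounded by blast
  obtain B' where B': "\<And>h u. h \<in> controls \<Longrightarrow> (\<And>t. norm (u t) \<le> M) \<Longrightarrow>
    AE t\<in>{0..T} in lborel. norm (\<Psi> (h t) (u t)) \<le> B'" using effort_integrand_bounded by blast
  have uc: "uniformly_continuous_on (U \<times> cball 0 M) (\<lambda>(a, c). \<Psi> a c)"
    by (intro compact_uniformly_continuous continuous_on_subset[OF control_cost(1)] compact_Times U) auto
  have "(\<lambda>k. expectation (\<lambda>\<omega>. effort (h k) (\<phi> k) \<omega> - effort (h k) \<phi>' \<omega>)) \<longlonglongrightarrow> expectation (\<lambda>\<omega>. 0)"
  proof (rule integral_dominated_convergence[where w="\<lambda>_. B + B"])
    show "AE \<omega> in P. (\<lambda>k. effort (h k) (\<phi> k) \<omega> - effort (h k) \<phi>' \<omega>) \<longlonglongrightarrow> 0"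
      using lim AE_space
    proof eventually_elim
      case (elim \<omega>)
      have p: "continuous_on {0..T} (\<phi> k \<omega>)" "norm (\<phi> k \<omega> t) \<le> M"
          "continuous_on {0..T} (\<phi>' \<omega>)" "norm (\<phi>' \<omega> t) \<le> M" for k t
        using \<phi> elim(2) by (auto simp: bounded_process_def)
      note i = effort_integrand_integrable[OF h \<phi>(1) elim(2)] effort_integrand_integrable[OF h \<phi>(2) elim(2)]
      let ?d = "\<lambda>k t. \<Psi> (h k t) (\<phi> k \<omega> t) - \<Psi> (h k t) (\<phi>' \<omega> t)"
      have "(\<lambda>k. LINT t:{0..T}|lborel. ?d k t) \<longlonglongrightarrow> (LINT t:{0..T}|lborel. 0)"
      proof (rule set_integral_tendsto_bounded)
        show "set_borel_measurable lborel {0..T} (?d k)" for k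
          using set_integral_diff(1)[OF i] by (rule set_integrable_imp_set_borel_measurable)
        show "AE t\<in>{0..T} in lborel. norm (?d k t) \<le> B' + B'" for k
        proof -
          have "AE t\<in>{0..T} in lborel. norm (\<Psi> (h k t) (\<phi> k \<omega> t)) \<le> B'"
            "AE t\<in>{0..T} in lborel. norm (\<Psi> (h k t) (\<phi>' \<omega> t)) \<le> B'"
            by (rule B'[OF h p(2)], rule B'[OF h p(4)])
          then show ?thesis by eventually_elim auto
        qed
        have "AE t in lborel. \<forall>k. t \<in> {0..T} \<longrightarrow> h k t \<in> U"
          unfolding AE_all_countable using control_in[OF h] by blast
        then show "AE t\<in>{0..T} in lborel. (\<lambda>k. ?d k t) \<longlonglongrightarrow> 0"
        proof eventually_elim
          case U: (elim t)
          show ?case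
          proof
            assume t: "t \<in> {0..T}"
            show "(\<lambda>k. ?d k t) \<longlonglongrightarrow> 0"
            proof (rule tendstoI)
              fix e :: real assume "0 < e"
              then obtain \<delta> where \<delta>: "0 < \<delta>" "\<And>p q. p \<in> U \<times> cball 0 M \<Longrightarrow> q \<in> U \<times> cball 0 M \<Longrightarrow> dist q p < \<delta>
                  \<Longrightarrow> dist (case q of (a, c) \<Rightarrow> \<Psi> a c) (case p of (a, c) \<Rightarrow> \<Psi> a c) < e"
                using uc unfolding uniformly_continuous_on_def by meson
              have "\<forall>\<^sub>F k in sequentially. dist (\<phi> k \<omega> t) (\<phi>' \<omega> t) < \<delta>"
                using elim(1) t \<delta>(1) by (intro tendstoD) auto
              then show "\<forall>\<^sub>F k in sequentially. dist (?d k t) 0 < e"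
              proof eventually_elim
                case (elim k)
                then show ?case
                  using \<delta>(2)[of "(h k t, \<phi>' \<omega> t)" "(h k t, \<phi> k \<omega> t)"] U t p
                  by (simp add: dist_Pair_Pair dist_norm)
              qed
            qed
          qed
        qed
      qed (simp add: set_borel_measurable_def)
      moreover have "(LINT t:{0..T}|lborel. ?d k t) = effort (h k) (\<phi> k) \<omega> - effort (h k) \<phi>' \<omega>" for k
        unfolding effort_def by (rule set_integral_diff(2)[OF i])
      ultimately show ?case by simp
    qed
    show "AE \<omega> in P. norm (effort (h k) (\<phi> k) \<omega> - effort (h k) \<phi>' \<omega>) \<le> B + B" for k
    proof (rule AE_I2)
      fix \<omega> assume "\<omega> \<in> space P"
      with B[OF h[of k] \<phi>(1)[of k]] B[OF h[of k] \<phi>(2)]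
      show "norm (effort (h k) (\<phi> k) \<omega> - effort (h k) \<phi>' \<omega>) \<le> B + B" by (smt (verit) real_norm_def)
    qed
  qed (use effort_measurable[OF h] \<phi> in auto)
  then show ?thesis
    using effort_integrable[OF h] \<phi> by simp
qed

text \<open>The deterministic distance between trajectories supplies both dominating functions: in
  time a constant above the running cost of the limit path, and in \<omega> the integrable
  \<open>\<bar>running Z' \<omega>\<bar> + B'\<close>.\<close>

lemma expected_running_tendsto:
  assumes h: "\<And>k. h k \<in> controls" "h' \<in> controls" and \<gamma>: "\<And>k. feedback (\<gamma> k)" "feedback \<gamma>'"
    and Z: "\<And>k. process (h k) (\<gamma> k) (Z k)" "process h' \<gamma>' Z'"
    and int: "integrable P (running Z')"
    and lim: "AE \<omega> in P. \<forall>t\<in>{0..T}. (\<lambda>k. Z k \<omega> t) \<longlonglongrightarrow> Z' \<omega> t"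
  shows "(\<lambda>k. expectation (running (Z k))) \<longlonglongrightarrow> expectation (running Z')"
proof -
  obtain B where B: "\<And>t x y. t \<in> {0..T} \<Longrightarrow> norm (x - y) \<le> spread \<Longrightarrow> \<bar>\<l> t x - \<l> t y\<bar> \<le> B"
    using running_cost_spread by metis
  obtain B' where B': "\<And>h h' \<gamma> \<gamma>' Z Z'. h \<in> controls \<Longrightarrow> h' \<in> controls \<Longrightarrow> feedback \<gamma> \<Longrightarrow> feedback \<gamma>' \<Longrightarrow>
    process h \<gamma> Z \<Longrightarrow> process h' \<gamma>' Z' \<Longrightarrow> AE \<omega> in P. \<bar>running Z \<omega> - running Z' \<omega>\<bar> \<le> B'"
    using running_spread by blast
  have s: "AE \<omega> in P. \<forall>k. solves (w \<omega>) (h k) (\<gamma> k) (Z k \<omega>)" "AE \<omega> in P. solves (w \<omega>) h' \<gamma>' (Z' \<omega>)"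
    unfolding AE_all_countable using Z by (auto simp: process_def)
  show ?thesis
  proof (rule integral_dominated_convergence[where w="\<lambda>\<omega>. \<bar>running Z' \<omega>\<bar> + B'"])
    show "AE \<omega> in P. (\<lambda>k. running (Z k) \<omega>) \<longlonglongrightarrow> running Z' \<omega>"
      using lim AE_space s
    proof eventually_elim
      case (elim \<omega>)
      have p: "continuous_on {0..T} (Z k \<omega>)" "continuous_on {0..T} (Z' \<omega>)" for k
        using Z elim(2) by (auto intro: process_path)
      obtain B'' where B'': "\<And>t. t \<in> {0..T} \<Longrightarrow> norm (\<l> t (Z' \<omega> t)) \<le> B''"
        using continuous_on_Icc_bounded[OF running_cost_compose[OF p(2)]] by blast
      show ?case
        unfolding running_def
      proof (rule set_integral_tendsto_bounded)
        show "AE t\<in>{0..T} in lborel. (\<lambda>k. \<l> t (Z k \<omega> t)) \<longlonglongrightarrow> \<l> t (Z' \<omega> t)"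
        proof (intro always_eventually allI impI)
          fix t assume t: "t \<in> {0..T}"
          show "(\<lambda>k. \<l> t (Z k \<omega> t)) \<longlonglongrightarrow> \<l> t (Z' \<omega> t)"
            by (rule continuous_on_tendsto_compose[OF running_cost_continuous[OF t]]) (use elim(1) t in auto)
        qed
        show "AE t\<in>{0..T} in lborel. norm (\<l> t (Z k \<omega> t)) \<le> B + B''" for k
        proof (intro always_eventually allI impI)
          fix t assume t: "t \<in> {0..T}"
          have "norm (Z k \<omega> t - Z' \<omega> t) \<le> spread"
            using elim(3,4) by (intro solution_spread[OF h(1) h(2) \<gamma>(1) \<gamma>(2) _ _ t]) auto
          from B[OF t this] B''[OF t] show "norm (\<l> t (Z k \<omega> t)) \<le> B + B''" by (smt (verit) real_norm_def)
        qed
      qed (intro set_borel_measurable_continuous_on_Icc running_cost_compose p)+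
    qed
    show "AE \<omega> in P. norm (running (Z k) \<omega>) \<le> \<bar>running Z' \<omega>\<bar> + B'" for k
      using B'[OF h(1) h(2) \<gamma>(1) \<gamma>(2) Z(1)[of k] Z(2)] by eventually_elim (smt (verit) real_norm_def)
  qed (use int running_measurable[OF Z(1)] running_measurable[OF Z(2)] in auto)
qed

section \<open>Lower semicontinuity and lower bounds of the total cost\<close>

lemma cost_eq:
  assumes "h \<in> controls" "feedback \<gamma>" "process h \<gamma> Z" "integrable P (running Z)"
  shows "cost h \<gamma> Z = expectation (running Z) + expectation (effort h (\<lambda>\<omega> t. \<gamma> (Z \<omega> t)))"
  unfolding cost_def
  using assms(4) effort_integrable[OF assms(1) bounded_process_feedback[OF assms(3,2)]] by simp

text \<open>The running costs converge, so the control costs do too. Freezing the feedback values at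
  the limit path does not change their limit, and convexity bounds the control cost of
  \<open>h'\<close> by it. The estimate covers every process \<open>Z'\<close> of the limit pair,
  because the cost functional chooses some version of the solution.\<close>

lemma cost_lower_semicontinuous:
  assumes h: "\<And>k. h k \<in> controls" and \<gamma>: "\<And>k. feedback (\<gamma> k)" "feedback \<gamma>'"
    and Z: "\<And>k. process (h k) (\<gamma> k) (Z k)" and int: "integrable P (running (Z 0))"
    and H: "\<And>t. t \<in> {0..T} \<Longrightarrow> (\<lambda>k. LINT s:{0..t}|lborel. h k s) \<longlonglongrightarrow> H t"
    and \<gamma>_lim: "\<And>x. (\<lambda>k. \<gamma> k x) \<longlonglongrightarrow> \<gamma>' x"
    and J: "(\<lambda>k. cost (h k) (\<gamma> k) (Z k)) \<longlonglongrightarrow> J"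
  obtains h' where "h' \<in> controls" "\<And>Z'. process h' \<gamma>' Z' \<Longrightarrow> cost h' \<gamma>' Z' \<le> J"
proof -
  obtain f h' where f: "\<And>j. f j \<in> midpoint_hull (h ` {j..})" and h': "h' \<in> controls"
    and f_lim: "AE s\<in>{0..T} in lborel. (\<lambda>j. f j s) \<longlonglongrightarrow> h' s"
    and h'_int: "\<And>t. t \<in> {0..T} \<Longrightarrow> (LINT s:{0..t}|lborel. h' s) = H t"
    using weak_control_limit[OF h H] by blast
  have hA: "h ` {j..} \<subseteq> controls" for j using h by auto
  have fc: "f j \<in> controls" for j using midpoint_hull_controls[OF hA] f by blast
  show ?thesis
  proof (rule that[OF h'])
    fix Z' assume Z': "process h' \<gamma>' Z'"
    let ?\<phi> = "\<lambda>\<omega> t. \<gamma>' (Z' \<omega> t)"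
    have int': "integrable P (running (Z k))" "integrable P (running Z')" for k
      using int running_integrable_iff[OF h[of 0] h[of k] \<gamma>(1) \<gamma>(1) Z Z]
        running_integrable_iff[OF h[of 0] h' \<gamma>(1) \<gamma>(2) Z Z'] by auto
    have "AE \<omega> in P. \<forall>k. solves (w \<omega>) (h k) (\<gamma> k) (Z k \<omega>)" "AE \<omega> in P. solves (w \<omega>) h' \<gamma>' (Z' \<omega>)"
      unfolding AE_all_countable using Z Z' by (auto simp: process_def)
    then have Z_lim: "AE \<omega> in P. \<forall>t\<in>{0..T}. (\<lambda>k. Z k \<omega> t) \<longlonglongrightarrow> Z' \<omega> t"
    proof eventually_elim
      case (elim \<omega>)
      have "(\<lambda>k. LINT s:{0..t}|lborel. h k s) \<longlonglongrightarrow> (LINT s:{0..t}|lborel. h' s)" if "t \<in> {0..T}" for t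
        using H h'_int that by simp
      then show ?case
        using solution_convergence[OF h h' \<gamma> _ \<gamma>_lim elim(1)[rule_format] elim(2)] by blast
    qed
    \<comment> \<open>The feedbacks converge only pointwise and are evaluated at moving points;
      their common Lipschitz constant first replaces \<open>Z k\<close> by
      \<open>Z'\<close>.\<close>
    have "AE \<omega> in P. \<forall>t\<in>{0..T}. (\<lambda>k. \<gamma> k (Z k \<omega> t)) \<longlonglongrightarrow> ?\<phi> \<omega> t"
      using Z_lim
    proof eventually_elim
      case (elim \<omega>)
      show ?case
      proof
        fix t assume "t \<in> {0..T}"
        then have "(\<lambda>k. L * dist (Z k \<omega> t) (Z' \<omega> t)) \<longlonglongrightarrow> L * dist (Z' \<omega> t) (Z' \<omega> t)"
          using elim by (intro tendsto_intros) auto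
        then have "(\<lambda>k. L * dist (Z k \<omega> t) (Z' \<omega> t)) \<longlonglongrightarrow> 0" by simp
        moreover have "norm (\<gamma> k (Z k \<omega> t) - \<gamma> k (Z' \<omega> t)) \<le> L * dist (Z k \<omega> t) (Z' \<omega> t)" for k
          using \<gamma>(1)[of k] by (simp add: feedback_def lipschitz_on_def flip: dist_norm)
        ultimately have "(\<lambda>k. \<gamma> k (Z k \<omega> t) - \<gamma> k (Z' \<omega> t)) \<longlonglongrightarrow> 0"
          by (rule Lim_null_comparison[OF always_eventually[OF allI], rotated])
        from tendsto_add[OF this \<gamma>_lim[of "Z' \<omega> t"]]
        show "(\<lambda>k. \<gamma> k (Z k \<omega> t)) \<longlonglongrightarrow> ?\<phi> \<omega> t" by simp
      qed
    qed
    then have pert: "(\<lambda>k. expectation (effort (h k) (\<lambda>\<omega> t. \<gamma> k (Z k \<omega> t))) - expectation (effort (h k) ?\<phi>)) \<longlonglongrightarrow> 0"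
      by (intro expected_effort_perturbation bounded_process_feedback[OF Z \<gamma>(1)] bounded_process_feedback[OF Z' \<gamma>(2)] h)
    \<comment> \<open>\<open>J - r\<close> is the limit of the control costs alone, and by
      \<open>pert\<close> also of those with the feedback values frozen at the limit path.\<close>
    define r where "r = expectation (running Z')"
    have "(\<lambda>k. cost (h k) (\<gamma> k) (Z k) - expectation (running (Z k))
        - (expectation (effort (h k) (\<lambda>\<omega> t. \<gamma> k (Z k \<omega> t))) - expectation (effort (h k) ?\<phi>))) \<longlonglongrightarrow> J - r - 0"
      unfolding r_def
      by (intro tendsto_diff J pert expected_running_tendsto[OF h h' \<gamma> Z Z' int'(2) Z_lim])
    then have Q: "(\<lambda>k. expectation (effort (h k) ?\<phi>)) \<longlonglongrightarrow> J - r"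
      by (simp add: cost_eq[OF h \<gamma>(1) Z int'(1)])
    have "expectation (effort h' ?\<phi>) \<le> J - r"
    proof (rule field_le_epsilon)
      fix e :: real assume "0 < e"
      then obtain n where n: "\<And>k. n \<le> k \<Longrightarrow> expectation (effort (h k) ?\<phi>) < J - r + e"
        using order_tendstoD(2)[OF Q, of "J - r + e"] by (auto simp: eventually_sequentially)
      \<comment> \<open>\<open>f j\<close> combines only controls with index at least
        \<open>j\<close>, and all of these satisfy the bound once \<open>n \<le> j\<close>.\<close>
      have "expectation (effort (f j) ?\<phi>) \<le> J - r + e" if "n \<le> j" for j
        by (rule expected_effort_midpoint_hull[OF f hA bounded_process_feedback[OF Z' \<gamma>(2)]])
          (use n that in \<open>auto intro: less_imp_le\<close>)
      then show "expectation (effort h' ?\<phi>) \<le> J - r + e"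
        by (intro LIMSEQ_le_const2[OF expected_effort_tendsto[OF fc h' bounded_process_feedback[OF Z' \<gamma>(2)] f_lim]]) auto
    qed
    then show "cost h' \<gamma>' Z' \<le> J"
      by (simp add: cost_eq[OF h' \<gamma>(2) Z' int'(2)] r_def)
  qed
qed

lemma cost_bounded_below:
  assumes "h \<in> controls" "feedback \<gamma>" "process h \<gamma> Z" "integrable P (running Z)"
  obtains c where "\<And>h' \<gamma>' Z'. h' \<in> controls \<Longrightarrow> feedback \<gamma>' \<Longrightarrow> process h' \<gamma>' Z' \<Longrightarrow> c \<le> cost h' \<gamma>' Z'"
proof -
  obtain B where B: "\<And>h \<phi> \<omega>. h \<in> controls \<Longrightarrow> bounded_process \<phi> \<Longrightarrow> \<omega> \<in> space P \<Longrightarrow> \<bar>effort h \<phi> \<omega>\<bar> \<le> B"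
    using effort_bounded by blast
  obtain B' where B': "\<And>h h' \<gamma> \<gamma>' Z Z'. h \<in> controls \<Longrightarrow> h' \<in> controls \<Longrightarrow> feedback \<gamma> \<Longrightarrow> feedback \<gamma>' \<Longrightarrow>
    process h \<gamma> Z \<Longrightarrow> process h' \<gamma>' Z' \<Longrightarrow> AE \<omega> in P. \<bar>running Z \<omega> - running Z' \<omega>\<bar> \<le> B'"
    using running_spread by blast
  show ?thesis
  proof (rule that[of "expectation (\<lambda>\<omega>. running Z \<omega> - B' - B)"])
    fix h' \<gamma>' Z' assume a: "h' \<in> controls" "feedback \<gamma>'" "process h' \<gamma>' Z'"
    have i: "integrable P (running Z')"
      using running_integrable_iff[OF assms(1) a(1) assms(2) a(2) assms(3) a(3)] assms(4) by simp
    show "expectation (\<lambda>\<omega>. running Z \<omega> - B' - B) \<le> cost h' \<gamma>' Z'"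
      unfolding cost_def
    proof (rule integral_mono_AE)
      show "AE \<omega> in P. running Z \<omega> - B' - B \<le> running Z' \<omega> + effort h' (\<lambda>\<omega> t. \<gamma>' (Z' \<omega> t)) \<omega>"
        using B'[OF assms(1) a(1) assms(2) a(2) assms(3) a(3)] AE_space
      proof eventually_elim
        case (elim \<omega>)
        then show ?case using B[OF a(1) bounded_process_feedback[OF a(3,2)] elim(2)] by linarith
      qed
    qed (use assms(4) i effort_integrable[OF a(1) bounded_process_feedback[OF a(3,2)]] in auto)
  qed
qed

lemma cost_not_integrable:
  assumes "h \<in> controls" "feedback \<gamma>" "process h \<gamma> Z" "\<not> integrable P (running Z)"
  shows "cost h \<gamma> Z = 0"
proof -
  have e: "integrable P (effort h (\<lambda>\<omega> t. \<gamma> (Z \<omega> t)))"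
    by (rule effort_integrable[OF assms(1) bounded_process_feedback[OF assms(3,2)]])
  have "\<not> integrable P (\<lambda>\<omega>. running Z \<omega> + effort h (\<lambda>\<omega> t. \<gamma> (Z \<omega> t)) \<omega>)"
  proof
    assume "integrable P (\<lambda>\<omega>. running Z \<omega> + effort h (\<lambda>\<omega> t. \<gamma> (Z \<omega> t)) \<omega>)"
    from Bochner_Integration.integrable_diff[OF this e] show False using assms(4) by simp
  qed
  then show ?thesis unfolding cost_def by (rule not_integrable_integral_eq)
qed

end

section \<open>Empirical measures and the coefficients of the system\<close>

lemma empirical_in_wasserstein_space:
  fixes x :: "'n::finite \<Rightarrow> 'a::euclidean_space"
  shows "empirical x \<in> wasserstein_space 1"
proof -
  have x: "x \<in> measurable (uniform_count_measure UNIV) borel"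
    by (simp add: measurable_def space_uniform_count_measure sets_uniform_count_measure)
  interpret U: prob_space "uniform_count_measure (UNIV :: 'n set)"
    by (rule prob_space_uniform_count_measure) auto
  have "integrable (uniform_count_measure UNIV) (\<lambda>i. norm (x i) powr 1)"
    unfolding uniform_count_measure_def by (rule integrable_point_measure_finite) simp
  then have "integrable (empirical x) (\<lambda>y. norm y powr 1)"
    unfolding empirical_def by (subst integrable_distr_eq[OF x]) auto
  then show ?thesis
    using U.prob_space_distr[OF x] by (simp add: wasserstein_space_def empirical_def)
qed

lemma wasserstein_dist_nonneg: "0 \<le> wasserstein_dist p \<mu> \<nu>"
  by (simp add: wasserstein_dist_def)

text \<open>Particles with the same index are coupled, and the mean of their distances is at most
  the largest one. This turns a Lipschitz feedback on the Wasserstein space into a Lipschitz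
  function of the particle positions, and likewise for uniform continuity of the running
  cost.\<close>

lemma wasserstein_dist_empirical_le:
  fixes x y :: "'a::euclidean_space ^ 'n::finite"
  shows "wasserstein_dist 1 (empirical (\<lambda>l. x $ l)) (empirical (\<lambda>l. y $ l)) \<le> norm (x - y)"
proof -
  let ?N = "uniform_count_measure (UNIV :: 'n set)"
  interpret U: prob_space ?N
    by (rule prob_space_uniform_count_measure) auto
  have m: "f \<in> measurable ?N borel" for f :: "'n \<Rightarrow> 'b::topological_space"
    by (simp add: measurable_def space_uniform_count_measure sets_uniform_count_measure)
  define \<pi> where "\<pi> = distr ?N borel (\<lambda>l. (x $ l, y $ l))"
  have \<pi>: "\<pi> \<in> couplings (empirical (\<lambda>l. x $ l)) (empirical (\<lambda>l. y $ l))"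
    unfolding couplings_def \<pi>_def empirical_def
    using U.prob_space_distr[OF m] m
    by (auto simp: distr_distr comp_def borel_measurable_continuous_onI continuous_on_fst continuous_on_snd)
  have dm: "(\<lambda>z. dist (fst z) (snd z) powr 1) \<in> borel_measurable (borel :: ('a \<times> 'a) measure)"
    by (simp add: borel_measurable_continuous_onI continuous_on_dist continuous_on_fst continuous_on_snd)
  have "(INF \<pi>\<in>couplings (empirical (\<lambda>l. x $ l)) (empirical (\<lambda>l. y $ l)). \<integral>z. dist (fst z) (snd z) powr 1 \<partial>\<pi>)
      \<le> (\<integral>z. dist (fst z) (snd z) powr 1 \<partial>\<pi>)"
    by (rule cINF_lower[OF _ \<pi>]) (auto intro!: bdd_belowI[of _ 0])
  also have "\<dots> = (\<integral>l. dist (x $ l) (y $ l) powr 1 \<partial>?N)"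
    unfolding \<pi>_def by (subst integral_distr[OF m dm]) simp
  also have "\<dots> \<le> (\<integral>l. norm (x - y) \<partial>?N)"
  proof (rule integral_mono)
    show "integrable ?N (\<lambda>l. dist (x $ l) (y $ l) powr 1)" "integrable ?N (\<lambda>l. norm (x - y))"
      unfolding uniform_count_measure_def by (rule integrable_point_measure_finite, simp)+
    show "dist (x $ l) (y $ l) powr 1 \<le> norm (x - y)" for l
      using Finite_Cartesian_Product.norm_nth_le[of "x - y" l] by (simp add: dist_norm)
  qed
  also have "\<dots> = norm (x - y)" by (simp add: U.prob_space)
  finally have "(INF \<pi>\<in>couplings (empirical (\<lambda>l. x $ l)) (empirical (\<lambda>l. y $ l)). \<integral>z. dist (fst z) (snd z) powr 1 \<partial>\<pi>)
      \<le> norm (x - y)" .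
  \<comment> \<open>\<open>x powr 1 = x\<close> holds for nonnegative \<open>x\<close> only, so the
    sign of the infimum has to be known. The coupling \<open>\<pi>\<close> shows that the infimum is
    over a nonempty set.\<close>
  moreover have "0 \<le> (INF \<pi>\<in>couplings (empirical (\<lambda>l. x $ l)) (empirical (\<lambda>l. y $ l)). \<integral>z. dist (fst z) (snd z) powr 1 \<partial>\<pi>)"
    using \<pi> by (intro cINF_greatest) auto
  ultimately show ?thesis by (simp add: wasserstein_dist_def)
qed

text \<open>The 1-Wasserstein space is not locally compact, so a limiting feedback is taken as a cluster
  point in the product topology; it must be the limit wherever the sequence converges.\<close>

lemma lipschitz_feedbacks_cluster_point:
  fixes g :: "nat \<Rightarrow> 'm \<Rightarrow> (real ^ 'd) measure \<Rightarrow> real ^ 'l"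
  assumes g: "\<And>k i. g k i \<in> lipschitz_feedbacks M L"
  obtains gs where "\<And>i. gs i \<in> lipschitz_feedbacks M L"
    "\<And>i \<mu> l. \<mu> \<in> wasserstein_space 1 \<Longrightarrow> (\<lambda>k. g k i \<mu>) \<longlonglongrightarrow> l \<Longrightarrow> gs i \<mu> = l"
proof -
  let ?W = "wasserstein_space 1 :: (real ^ 'd) measure set"
  \<comment> \<open>Outside the Wasserstein space a feedback is unrestricted. Setting it to zero
    there puts every coordinate into one compact ball.\<close>
  define f where "f k = (\<lambda>(i, \<mu>). if \<mu> \<in> ?W then g k i \<mu> else 0)" for k
  have M: "0 \<le> M"
    using g[of 0 undefined] empirical_in_wasserstein_space[of "\<lambda>_::unit. 0 :: real ^ 'd"]
    unfolding lipschitz_feedbacks_def by (auto intro: order_trans[OF norm_ge_zero])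
  obtain gs where gs: "\<And>J e. finite J \<Longrightarrow> 0 < e \<Longrightarrow> \<exists>\<^sub>F k in sequentially. \<forall>p\<in>J. dist (f k p) (gs p) < e"
  proof (rule pointwise_cluster_point[of "\<lambda>_. cball 0 M" f])
    show "f k p \<in> cball 0 M" for k p
      using g M by (auto simp: f_def lipschitz_feedbacks_def split: prod.splits)
  qed auto
  \<comment> \<open>Two coordinates are approximated by the same index \<open>k\<close>, so that the
    Lipschitz inequality of \<open>g k i\<close> between two measures survives in the cluster
    point.\<close>
  have close: "\<exists>k. dist (g k i \<mu>) (gs (i, \<mu>)) < e \<and> dist (g k i \<nu>) (gs (i, \<nu>)) < e"
    if "\<mu> \<in> ?W" "\<nu> \<in> ?W" "0 < e" for i \<mu> \<nu> e
    using frequently_ex[OF gs[of "{(i, \<mu>), (i, \<nu>)}" e]] that by (auto simp: f_def)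
  show ?thesis
  proof (rule that[of "\<lambda>i \<mu>. gs (i, \<mu>)"])
    fix i
    show "(\<lambda>\<mu>. gs (i, \<mu>)) \<in> lipschitz_feedbacks M L"
      unfolding lipschitz_feedbacks_def
    proof (intro CollectI conjI ballI)
      fix \<mu> assume \<mu>: "\<mu> \<in> ?W"
      show "norm (gs (i, \<mu>)) \<le> M"
      proof (rule field_le_epsilon)
        fix e :: real assume "0 < e"
        then obtain k where "dist (g k i \<mu>) (gs (i, \<mu>)) < e" using close[OF \<mu> \<mu>] by blast
        moreover have "norm (g k i \<mu>) \<le> M" using g \<mu> by (auto simp: lipschitz_feedbacks_def)
        ultimately show "norm (gs (i, \<mu>)) \<le> M + e"
          using norm_triangle_ineq[of "g k i \<mu>" "gs (i, \<mu>) - g k i \<mu>"] by (simp add: dist_norm norm_minus_commute)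
      qed
    next
      fix \<mu> \<nu> assume W: "\<mu> \<in> ?W" "\<nu> \<in> ?W"
      show "dist (gs (i, \<mu>)) (gs (i, \<nu>)) \<le> L * wasserstein_dist 1 \<mu> \<nu>"
      proof (rule field_le_epsilon)
        fix e :: real assume "0 < e"
        then obtain k where k: "dist (g k i \<mu>) (gs (i, \<mu>)) < e / 2" "dist (g k i \<nu>) (gs (i, \<nu>)) < e / 2"
          using close[OF W, of "e / 2"] by auto
        have "dist (g k i \<mu>) (g k i \<nu>) \<le> L * wasserstein_dist 1 \<mu> \<nu>"
          using g W by (auto simp: lipschitz_feedbacks_def)
        then show "dist (gs (i, \<mu>)) (gs (i, \<nu>)) \<le> L * wasserstein_dist 1 \<mu> \<nu> + e"
          using k dist_triangle[of "gs (i, \<mu>)" "gs (i, \<nu>)" "g k i \<mu>"]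
            dist_triangle[of "g k i \<mu>" "gs (i, \<nu>)" "g k i \<nu>"] by (simp add: dist_commute)
      qed
    qed
  next
    fix i \<mu> l assume \<mu>: "\<mu> \<in> ?W" and lim: "(\<lambda>k. g k i \<mu>) \<longlonglongrightarrow> l"
    show "gs (i, \<mu>) = l"
    proof (rule ccontr)
      assume "gs (i, \<mu>) \<noteq> l"
      then have e: "0 < dist (gs (i, \<mu>)) l / 2" by simp
      have "\<exists>\<^sub>F k in sequentially. dist (g k i \<mu>) (gs (i, \<mu>)) < dist (gs (i, \<mu>)) l / 2"
        using gs[of "{(i, \<mu>)}", OF _ e] \<mu> by (simp add: f_def)
      then have "\<exists>\<^sub>F k in sequentially. dist (g k i \<mu>) (gs (i, \<mu>)) < dist (gs (i, \<mu>)) l / 2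
          \<and> dist (g k i \<mu>) l < dist (gs (i, \<mu>)) l / 2"
        using tendstoD[OF lim e] by (rule frequently_eventually_frequently)
      then obtain k where "dist (g k i \<mu>) (gs (i, \<mu>)) < dist (gs (i, \<mu>)) l / 2"
          "dist (g k i \<mu>) l < dist (gs (i, \<mu>)) l / 2"
        by (auto dest: frequently_ex)
      then show False using dist_triangle[of "gs (i, \<mu>)" l "g k i \<mu>"] by (simp add: dist_commute)
    qed
  qed
qed

lemma zero_in_lipschitz_feedbacks:
  "0 \<le> M \<Longrightarrow> 0 \<le> L \<Longrightarrow> (\<lambda>_. 0) \<in> lipschitz_feedbacks M L"
  by (simp add: lipschitz_feedbacks_def wasserstein_dist_nonneg)

section \<open>Vector-valued Lipschitz maps, drift and actuation\<close>

lemma norm_vec_le_sum: "norm x \<le> (\<Sum>i\<in>UNIV. norm (x $ i))"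
  unfolding norm_vec_def by (rule L2_set_le_sum) simp

lemma norm_vec_le:
  fixes x :: "'b::real_normed_vector ^ 'n::finite"
  assumes "\<And>i. norm (x $ i) \<le> B" shows "norm x \<le> real CARD('n) * B"
proof -
  have "(\<Sum>i\<in>UNIV. norm (x $ i)) \<le> real CARD('n) * B"
    using sum_bounded_above[of UNIV "\<lambda>i. norm (x $ i)" B] assms by simp
  then show ?thesis using norm_vec_le_sum order_trans by blast
qed

lemma lipschitz_on_vec:
  fixes f :: "'a::metric_space \<Rightarrow> 'b::real_normed_vector ^ 'n::finite"
  assumes "\<And>i. C-lipschitz_on S (\<lambda>x. f x $ i)"
  shows "(real CARD('n) * C)-lipschitz_on S f"
proof (rule lipschitz_onI)
  fix x y assume "x \<in> S" "y \<in> S"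
  then show "dist (f x) (f y) \<le> real CARD('n) * C * dist x y"
    using norm_vec_le[of "f x - f y" "C * dist x y"] lipschitz_onD[OF assms, of x y]
    by (simp add: dist_norm mult.assoc)
next
  show "0 \<le> real CARD('n) * C" using assms[of undefined] by (simp add: lipschitz_on_nonneg)
qed

lemma borel_measurable_vec:
  fixes f :: "'w \<Rightarrow> 'b::euclidean_space ^ 'n::finite"
  assumes "\<And>i. (\<lambda>\<omega>. f \<omega> $ i) \<in> borel_measurable N"
  shows "f \<in> borel_measurable N"
proof (rule borel_measurable_euclidean_space[THEN iffD2], rule ballI)
  fix b :: "'b ^ 'n" assume "b \<in> Basis"
  then obtain i u where b: "b = axis i u" by (auto simp: Basis_vec_def)
  show "(\<lambda>\<omega>. f \<omega> \<bullet> b) \<in> borel_measurable N"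
    unfolding b inner_axis using assms[of i] by measurable
qed

lemma set_integral_bounded_linear:
  assumes "bounded_linear f" "set_integrable M A u"
  shows "set_integrable M A (\<lambda>x. f (u x))" "(LINT x:A|M. f (u x)) = f (LINT x:A|M. u x)"
proof -
  interpret bounded_linear f by fact
  have u: "integrable M (\<lambda>x. indicator A x *\<^sub>R u x)" using assms(2) by (simp add: set_integrable_def)
  show "set_integrable M A (\<lambda>x. f (u x))"
    using integrable_bounded_linear[OF assms(1) u] by (simp add: set_integrable_def scaleR)
  show "(LINT x:A|M. f (u x)) = f (LINT x:A|M. u x)"
    using integral_bounded_linear[OF assms(1) u] by (simp add: set_lebesgue_integral_def scaleR)
qed

definition drift :: "(real ^ 'd \<Rightarrow> real ^ 'd) \<Rightarrow> (real ^ 'd \<Rightarrow> real ^ 'd) \<Rightarrow> (real ^ 'd \<Rightarrow> real ^ 'd) \<Rightarrow>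
    (real ^ 'd \<Rightarrow> real ^ 'd) \<Rightarrow> (real ^ 'd ^ 'n) \<times> (real ^ 'd ^ 'm) \<Rightarrow> (real ^ 'd ^ 'n) \<times> (real ^ 'd ^ 'm)" where
  "drift H1 H2 K1 K2 z =
    (\<chi> n. (1 / real CARD('n)) *\<^sub>R (\<Sum>l\<in>UNIV. H1 (fst z $ l - fst z $ n)) +
       (1 / real CARD('m)) *\<^sub>R (\<Sum>j\<in>UNIV. K1 (snd z $ j - fst z $ n)),
     \<chi> i. (1 / real CARD('n)) *\<^sub>R (\<Sum>l\<in>UNIV. K2 (snd z $ i - fst z $ l)) +
       (1 / real CARD('m)) *\<^sub>R (\<Sum>j\<in>UNIV. H2 (snd z $ j - snd z $ i)))"

lemma lipschitz_on_mean:
  fixes f :: "'i::finite \<Rightarrow> 'a::metric_space \<Rightarrow> 'b::real_normed_vector"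
  assumes "\<And>i. C-lipschitz_on S (f i)"
  shows "C-lipschitz_on S (\<lambda>x. (1 / real CARD('i)) *\<^sub>R (\<Sum>i\<in>UNIV. f i x))"
proof (rule lipschitz_onI)
  fix x y assume xy: "x \<in> S" "y \<in> S"
  have "norm (\<Sum>i\<in>UNIV. f i x - f i y) \<le> (\<Sum>i\<in>(UNIV :: 'i set). C * dist x y)"
    using lipschitz_onD[OF assms xy] by (intro sum_norm_le) (simp add: dist_norm)
  then have "norm (\<Sum>i\<in>UNIV. f i x - f i y) \<le> real CARD('i) * (C * dist x y)" by simp
  then have "norm (\<Sum>i\<in>UNIV. f i x - f i y) / real CARD('i) \<le> C * dist x y"
    by (simp add: divide_le_eq mult.commute)
  moreover have "(1 / real CARD('i)) *\<^sub>R (\<Sum>i\<in>UNIV. f i x) - (1 / real CARD('i)) *\<^sub>R (\<Sum>i\<in>UNIV. f i y)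
      = (1 / real CARD('i)) *\<^sub>R (\<Sum>i\<in>UNIV. f i x - f i y)"
    by (simp only: sum_subtractf scaleR_diff_right)
  ultimately show "dist ((1 / real CARD('i)) *\<^sub>R (\<Sum>i\<in>UNIV. f i x)) ((1 / real CARD('i)) *\<^sub>R (\<Sum>i\<in>UNIV. f i y)) \<le> C * dist x y"
    by (simp add: dist_norm)
qed (rule lipschitz_on_nonneg[OF assms])

lemma lipschitz_on_drift:
  assumes "\<exists>C. C-lipschitz_on UNIV H1" "\<exists>C. C-lipschitz_on UNIV H2"
    "\<exists>C. C-lipschitz_on UNIV K1" "\<exists>C. C-lipschitz_on UNIV K2"
  shows "\<exists>C. C-lipschitz_on UNIV (drift H1 H2 K1 K2 :: (real ^ 'd ^ 'n) \<times> (real ^ 'd ^ 'm) \<Rightarrow> _)"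
proof -
  obtain c1 c2 c3 c4 where c: "c1-lipschitz_on UNIV H1" "c2-lipschitz_on UNIV H2"
    "c3-lipschitz_on UNIV K1" "c4-lipschitz_on UNIV K2" using assms by blast
  have diff: "(c * 2)-lipschitz_on UNIV (\<lambda>z. f (u z - v z))"
    if "c-lipschitz_on UNIV f" "1-lipschitz_on UNIV u" "1-lipschitz_on UNIV v"
    for c and f :: "real ^ 'd \<Rightarrow> real ^ 'd" and u v :: "(real ^ 'd ^ 'n) \<times> (real ^ 'd ^ 'm) \<Rightarrow> real ^ 'd"
    using lipschitz_on_compose2[OF lipschitz_on_diff[OF that(2,3)] lipschitz_on_subset[OF that(1)]] by simp
  have nth: "1-lipschitz_on UNIV (\<lambda>z :: (real ^ 'd ^ 'n) \<times> (real ^ 'd ^ 'm). fst z $ l)"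
    "1-lipschitz_on UNIV (\<lambda>z :: (real ^ 'd ^ 'n) \<times> (real ^ 'd ^ 'm). snd z $ j)" for l j
    by (rule lipschitz_onI, auto intro: order_trans[OF dist_vec_nth_le] dist_fst_le dist_snd_le)+
  have "(real CARD('n) * (c1 * 2 + c3 * 2))-lipschitz_on UNIV
      (\<lambda>z :: (real ^ 'd ^ 'n) \<times> (real ^ 'd ^ 'm). fst (drift H1 H2 K1 K2 z))"
    by (rule lipschitz_on_vec)
      (simp only: drift_def fst_conv vec_lambda_beta, intro lipschitz_on_add lipschitz_on_mean diff c nth)
  moreover have "(real CARD('m) * (c4 * 2 + c2 * 2))-lipschitz_on UNIV
      (\<lambda>z :: (real ^ 'd ^ 'n) \<times> (real ^ 'd ^ 'm). snd (drift H1 H2 K1 K2 z))"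
    by (rule lipschitz_on_vec)
      (simp only: drift_def snd_conv vec_lambda_beta, intro lipschitz_on_add lipschitz_on_mean diff c nth)
  ultimately show ?thesis using lipschitz_on_Pair by fastforce
qed

definition actuation :: "real ^ 'l ^ 'd ^ 'm \<Rightarrow> real ^ 'l ^ 'm \<Rightarrow> (real ^ 'd ^ 'n) \<times> (real ^ 'd ^ 'm)" where
  "actuation a c = (0, \<chi> i. a $ i *v c $ i)"

lemma bounded_bilinear_actuation:
  "bounded_bilinear (actuation :: real ^ 'l ^ 'd ^ 'm \<Rightarrow> _ \<Rightarrow> (real ^ 'd ^ 'n) \<times> (real ^ 'd ^ 'm))"
  unfolding bilinear_conv_bounded_bilinear[symmetric] bilinear_def
proof (intro conjI allI linearI)
  fix r :: real and x y :: "real ^ 'l ^ 'd ^ 'm" and c e :: "real ^ 'l ^ 'm"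
  show "actuation x (c + e) = (actuation x c + actuation x e :: (real ^ 'd ^ 'n) \<times> (real ^ 'd ^ 'm))"
    by (simp add: actuation_def vec_eq_iff matrix_vector_right_distrib)
  show "actuation (x + y) c = (actuation x c + actuation y c :: (real ^ 'd ^ 'n) \<times> (real ^ 'd ^ 'm))"
    by (simp add: actuation_def vec_eq_iff matrix_vector_mult_add_rdistrib)
  show "actuation x (r *\<^sub>R c) = (r *\<^sub>R actuation x c :: (real ^ 'd ^ 'n) \<times> (real ^ 'd ^ 'm))"
    by (simp add: actuation_def vec_eq_iff matrix_vector_mult_scaleR)
  show "actuation (r *\<^sub>R x) c = (r *\<^sub>R actuation x c :: (real ^ 'd ^ 'n) \<times> (real ^ 'd ^ 'm))"
    by (simp add: actuation_def vec_eq_iff flip: scaleR_matrix_vector_assoc)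
qed

section \<open>The mean-field control problem\<close>

text \<open>\<open>C\<close>, \<open>K\<close> and \<open>R\<close> are parameters and not
  existential statements because the joint equation is instantiated with them; \<open>R\<close>
  bounds whole tuples of control values.\<close>

locale mean_field_control = prob_space P for P :: "'w measure" +
  fixes F :: "real \<Rightarrow> 'w measure" and T \<sigma> M L C K R :: real
    and H1 H2 K1 K2 :: "real ^ 'd \<Rightarrow> real ^ 'd"
    and X0 :: "'n::finite \<Rightarrow> 'w \<Rightarrow> real ^ 'd" and Y0 :: "real ^ 'd ^ 'm"
    and W :: "'n \<Rightarrow> real \<Rightarrow> 'w \<Rightarrow> real ^ 'd"
    and U :: "(real ^ 'l ^ 'd) set"
    and \<Psi> :: "real ^ 'l ^ 'd ^ 'm \<Rightarrow> real ^ 'l ^ 'm \<Rightarrow> real"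
    and \<L> :: "real \<Rightarrow> real ^ 'd ^ 'm \<Rightarrow> (real ^ 'd) measure \<Rightarrow> real"
  assumes filtration: "\<And>t. 0 \<le> t \<Longrightarrow> subalgebra P (F t)"
      "\<And>s t. 0 \<le> s \<Longrightarrow> s \<le> t \<Longrightarrow> subalgebra (F t) (F s)"
    and horizon: "0 < T" and M_pos: "0 < M" and L_pos: "0 < L"
    and drift_lipschitz: "C-lipschitz_on UNIV (drift H1 H2 K1 K2 :: (real ^ 'd ^ 'n) \<times> (real ^ 'd ^ 'm) \<Rightarrow> _)"
    and initial: "\<And>n. X0 n \<in> borel_measurable (F 0)"
    and brownian: "\<And>n. brownian_motion P F (W n)"
    and control_set: "compact U" "convex U" "U \<noteq> {}"
    and actuation_bound: "0 < K"
      "\<And>a c. norm (actuation a c :: (real ^ 'd ^ 'n) \<times> (real ^ 'd ^ 'm)) \<le> K * norm (a :: real ^ 'l ^ 'd ^ 'm) * norm c"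
    and control_radius: "0 < R" "\<And>a :: real ^ 'l ^ 'd ^ 'm. (\<forall>i. a $ i \<in> U) \<Longrightarrow> norm a \<le> R"
    and control_cost_continuous: "continuous_on UNIV (\<lambda>(a, b). \<Psi> a b)"
    and control_cost_convex: "\<And>b. convex_on UNIV (\<lambda>a. \<Psi> a b)"
    and running_cost_continuity: "uniformly_continuous_cost T \<L>"
begin

definition noise :: "'w \<Rightarrow> real \<Rightarrow> (real ^ 'd ^ 'n) \<times> (real ^ 'd ^ 'm)" where
  "noise \<omega> t = (\<chi> n. X0 n \<omega> + sqrt (2 * \<sigma>) *\<^sub>R W n t \<omega>, Y0)"

definition state_cost :: "real \<Rightarrow> (real ^ 'd ^ 'n) \<times> (real ^ 'd ^ 'm) \<Rightarrow> real" where
  "state_cost t z = \<L> t (snd z) (empirical (\<lambda>n. fst z $ n))"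

definition product_controls :: "(real ^ 'l ^ 'd ^ 'm) set" where
  "product_controls = {a. \<forall>i. a $ i \<in> U}"

definition joint_control :: "('m \<Rightarrow> real \<Rightarrow> real ^ 'l ^ 'd) \<Rightarrow> real \<Rightarrow> real ^ 'l ^ 'd ^ 'm" where
  "joint_control h t = (\<chi> i. h i t)"

text \<open>As a function of the particle positions a feedback lives on a Euclidean space, which is
  separable, so that a sequence of feedbacks has a pointwise convergent subsequence there.\<close>

definition joint_feedback :: "('m \<Rightarrow> (real ^ 'd) measure \<Rightarrow> real ^ 'l) \<Rightarrow>
    (real ^ 'd ^ 'n) \<times> (real ^ 'd ^ 'm) \<Rightarrow> real ^ 'l ^ 'm" where
  "joint_feedback g z = (\<chi> i. g i (empirical (\<lambda>n. fst z $ n)))"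

definition joint_state :: "('n \<Rightarrow> real \<Rightarrow> 'w \<Rightarrow> real ^ 'd) \<Rightarrow> (real \<Rightarrow> 'w \<Rightarrow> real ^ 'd ^ 'm) \<Rightarrow>
    'w \<Rightarrow> real \<Rightarrow> (real ^ 'd ^ 'n) \<times> (real ^ 'd ^ 'm)" where
  "joint_state X Y \<omega> t = (\<chi> n. X n t \<omega>, Y t \<omega>)"

lemma product_controls: "compact product_controls" "convex product_controls"
proof -
  have "closed product_controls"
    unfolding product_controls_def
    by (intro closed_Collect_all closed_vimage[OF compact_imp_closed[OF control_set(1)], unfolded vimage_def]
        continuous_intros)
  moreover have "bounded product_controls"
    using control_radius(2) by (intro boundedI[of _ R]) (auto simp: product_controls_def)
  ultimately show "compact product_controls" by (simp add: compact_eq_bounded_closed)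
  show "convex product_controls"
    using control_set(2) by (auto simp: convex_def product_controls_def)
qed

lemma state_cost_uniformly_continuous:
  "uniformly_continuous_on ({0..T} \<times> UNIV) (\<lambda>(t, z). state_cost t z)"
  unfolding uniformly_continuous_on_def
proof (intro allI impI)
  fix e :: real assume "0 < e"
  then obtain \<delta> where \<delta>: "0 < \<delta>" and d: "\<And>t t' y y' \<mu> \<mu>'. t \<in> {0..T} \<Longrightarrow> t' \<in> {0..T} \<Longrightarrow>
      \<mu> \<in> wasserstein_space 1 \<Longrightarrow> \<mu>' \<in> wasserstein_space 1 \<Longrightarrow>
      dist t t' < \<delta> \<Longrightarrow> dist y y' < \<delta> \<Longrightarrow> wasserstein_dist 1 \<mu> \<mu>' < \<delta> \<Longrightarrow> dist (\<L> t y \<mu>) (\<L> t' y' \<mu>') < e"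
    using running_cost_continuity unfolding uniformly_continuous_cost_def by meson
  have "dist (state_cost t' z') (state_cost t z) < e"
    if t: "t \<in> {0..T}" "t' \<in> {0..T}" and le: "dist (t', z') (t, z) < \<delta>" for t t' z z'
    unfolding state_cost_def
  proof (rule d[OF t(2,1) empirical_in_wasserstein_space empirical_in_wasserstein_space])
    have z: "dist z' z < \<delta>" using le dist_snd_le[of "(t', z')" "(t, z)"] by simp
    show "dist t' t < \<delta>" using le dist_fst_le[of "(t', z')" "(t, z)"] by simp
    show "dist (snd z') (snd z) < \<delta>" using z dist_snd_le[of z' z] by simp
    have "dist (fst z') (fst z) < \<delta>" using z dist_fst_le[of z' z] by simp
    then show "wasserstein_dist 1 (empirical (\<lambda>n. fst z' $ n)) (empirical (\<lambda>n. fst z $ n)) < \<delta>"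
      using wasserstein_dist_empirical_le[of "fst z'" "fst z"] by (simp add: dist_norm)
  qed
  with \<delta> show "\<exists>d>0. \<forall>x\<in>{0..T} \<times> UNIV. \<forall>x'\<in>{0..T} \<times> UNIV. dist x' x < d \<longrightarrow>
      dist (case x' of (t, z) \<Rightarrow> state_cost t z) (case x of (t, z) \<Rightarrow> state_cost t z) < e"
    by auto
qed

text \<open>The factor \<open>CARD('m)\<close> in the feedback bounds comes from estimating the norm
  of a tuple by the sum of the norms of its components.\<close>

sublocale controlled_process T C K R "real CARD('m) * M" "real CARD('m) * L" "drift H1 H2 K1 K2"
  actuation product_controls P noise state_cost \<Psi>
proof (intro controlled_process.intro controlled_equation.intro controlled_process_axioms.intro)
  show "norm (x :: real ^ 'l ^ 'd ^ 'm) \<le> R" if "x \<in> product_controls" for x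
    using that control_radius(2) by (simp add: product_controls_def)
qed (use horizon drift_lipschitz bounded_bilinear_actuation actuation_bound product_controls control_radius(1)
    state_cost_uniformly_continuous control_cost_continuous control_cost_convex prob_space_axioms in auto)

section \<open>The particle system as a joint integral equation\<close>

lemma joint_control_in_controls:
  assumes "\<And>i. h i \<in> L1_controls T U"
  shows "joint_control h \<in> controls"
proof -
  have "set_borel_measurable lborel {0..T} (joint_control h)"
    unfolding set_borel_measurable_def
  proof (rule borel_measurable_vec)
    fix i
    have "(\<lambda>t. indicator {0..T} t *\<^sub>R h i t) \<in> borel_measurable lborel"
      using assms[of i] unfolding L1_controls_def set_integrable_def by auto
    then show "(\<lambda>t. (indicator {0..T} t *\<^sub>R joint_control h t) $ i) \<in> borel_measurable lborel"
      by (simp only: joint_control_def vector_scaleR_component vec_lambda_beta)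
  qed
  moreover have "AE t in lborel. \<forall>i. t \<in> {0..T} \<longrightarrow> h i t \<in> U"
    unfolding AE_all_countable using assms by (auto simp: L1_controls_def)
  then have U: "AE t\<in>{0..T} in lborel. joint_control h t \<in> product_controls"
    by eventually_elim (auto simp: joint_control_def product_controls_def)
  moreover have "AE t\<in>{0..T} in lborel. norm (joint_control h t) \<le> R"
    using U by eventually_elim (auto simp: product_controls_def intro: control_radius)
  ultimately show ?thesis
    using set_integrable_bounded by (auto simp: L1_controls_def)
qed

lemma component_in_L1_controls:
  assumes "h \<in> controls" shows "(\<lambda>t. h t $ i) \<in> L1_controls T U"
proof -
  have "AE t\<in>{0..T} in lborel. h t $ i \<in> U"
    using control_in[OF assms] by eventually_elim (auto simp: product_controls_def)
  then show ?thesis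
    using set_integral_bounded_linear(1)[OF bounded_linear_vec_nth control_integrable[OF assms]]
    by (simp add: L1_controls_def)
qed

lemma feedback_joint_feedback:
  assumes g: "\<And>i. g i \<in> lipschitz_feedbacks M L"
  shows "feedback (joint_feedback g)"
  unfolding feedback_def
proof (intro conjI allI)
  show "norm (joint_feedback g z) \<le> real CARD('m) * M" for z
  proof (rule norm_vec_le)
    show "norm (joint_feedback g z $ i) \<le> M" for i
      using g[of i] empirical_in_wasserstein_space by (auto simp: joint_feedback_def lipschitz_feedbacks_def)
  qed
  show "(real CARD('m) * L)-lipschitz_on UNIV (joint_feedback g)"
  proof (rule lipschitz_on_vec, rule lipschitz_onI)
    fix i z z'
    have "dist (joint_feedback g z $ i) (joint_feedback g z' $ i)
        \<le> L * wasserstein_dist 1 (empirical (\<lambda>n. fst z $ n)) (empirical (\<lambda>n. fst z' $ n))"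
      using g[of i] empirical_in_wasserstein_space by (auto simp: joint_feedback_def lipschitz_feedbacks_def)
    also have "\<dots> \<le> L * dist z z'"
      using L_pos wasserstein_dist_empirical_le[of "fst z" "fst z'"] dist_fst_le[of z z']
      by (intro mult_left_mono) (auto simp: dist_norm)
    finally show "dist (joint_feedback g z $ i) (joint_feedback g z' $ i) \<le> L * dist z z'" .
  qed (use L_pos in simp)
qed

abbreviation solution where
  "solution \<equiv> strong_solution P F T \<sigma> H1 H2 K1 K2 X0 Y0 W"

text \<open>Coordinate projections are bounded linear and commute with the Bochner integral of an
  integrable function; admissibility of the control and the feedback provides this integrability
  along the continuous path.\<close>

lemma solves_joint_state_iff:
  assumes h: "joint_control h \<in> controls" and g: "feedback (joint_feedback g)"
    and z: "continuous_on {0..T} (joint_state X Y \<omega>)"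
  shows "solves (noise \<omega>) (joint_control h) (joint_feedback g) (joint_state X Y \<omega>) \<longleftrightarrow>
    (\<forall>t\<in>{0..T}.
      (\<forall>n. X n t \<omega> = X0 n \<omega> +
        (LINT s:{0..t}|lborel.
           (1 / real CARD('n)) *\<^sub>R (\<Sum>l\<in>UNIV. H1 (X l s \<omega> - X n s \<omega>)) +
           (1 / real CARD('m)) *\<^sub>R (\<Sum>j\<in>UNIV. K1 (Y s \<omega> $ j - X n s \<omega>))) +
        sqrt (2 * \<sigma>) *\<^sub>R W n t \<omega>) \<and>
      (\<forall>i. Y t \<omega> $ i = Y0 $ i +
        (LINT s:{0..t}|lborel.
           (1 / real CARD('n)) *\<^sub>R (\<Sum>l\<in>UNIV. K2 (Y s \<omega> $ i - X l s \<omega>)) +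
           (1 / real CARD('m)) *\<^sub>R (\<Sum>j\<in>UNIV. H2 (Y s \<omega> $ j - Y s \<omega> $ i)) +
           h i s *v g i (empirical (\<lambda>l. X l s \<omega>)))))"
    (is "_ \<longleftrightarrow> (\<forall>t\<in>{0..T}. (\<forall>n. X n t \<omega> = X0 n \<omega> + ?A n t + _) \<and> (\<forall>i. Y t \<omega> $ i = Y0 $ i + ?B i t))")
proof -
  let ?r = "\<lambda>s. rhs (joint_control h) (joint_feedback g) s (joint_state X Y \<omega> s)"
  have int: "set_integrable lborel {0..t} ?r" if "t \<in> {0..T}" for t
    by (rule set_integrable_subset[OF rhs_integrable[OF h g z]]) (use that in auto)
  have A: "fst (LINT s:{0..t}|lborel. ?r s) $ n = ?A n t" if "t \<in> {0..T}" for n t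
    using set_integral_bounded_linear(2)[OF bounded_linear_compose[OF bounded_linear_vec_nth bounded_linear_fst] int[OF that], of n]
    by (simp add: rhs_def drift_def actuation_def joint_state_def joint_control_def joint_feedback_def)
  have B: "snd (LINT s:{0..t}|lborel. ?r s) $ i = ?B i t" if "t \<in> {0..T}" for i t
    using set_integral_bounded_linear(2)[OF bounded_linear_compose[OF bounded_linear_vec_nth bounded_linear_snd] int[OF that], of i]
    by (simp add: rhs_def drift_def actuation_def joint_state_def joint_control_def joint_feedback_def)
  have "joint_state X Y \<omega> t = noise \<omega> t + (LINT s:{0..t}|lborel. ?r s) \<longleftrightarrow>
      (\<forall>n. X n t \<omega> = X0 n \<omega> + ?A n t + sqrt (2 * \<sigma>) *\<^sub>R W n t \<omega>) \<and> (\<forall>i. Y t \<omega> $ i = Y0 $ i + ?B i t)"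
    if t: "t \<in> {0..T}" for t
    unfolding A[OF t, symmetric] B[OF t, symmetric]
    by (simp add: prod_eq_iff vec_eq_iff joint_state_def noise_def algebra_simps)
  then show ?thesis using z by (simp add: solves_def)
qed

lemma process_joint_state:
  assumes h: "joint_control h \<in> controls" and g: "feedback (joint_feedback g)" and sol: "solution h g X Y"
  shows "process (joint_control h) (joint_feedback g) (joint_state X Y)"
proof -
  have c: "continuous_on {0..T} (joint_state X Y \<omega>)" if "\<omega> \<in> space P" for \<omega>
    using sol that unfolding strong_solution_def joint_state_def
    by (intro continuous_on_Pair continuous_on_vec_lambda) auto
  have m: "X n t \<in> borel_measurable P" "Y t \<in> borel_measurable P" if "t \<in> {0..T}" for n t
    using that sol unfolding strong_solution_def
    by (auto intro!: measurable_from_subalg[OF filtration(1)])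
  have "(\<lambda>\<omega>. joint_state X Y \<omega> t) \<in> borel_measurable P" if "t \<in> {0..T}" for t
    unfolding joint_state_def using m[OF that]
    by (intro borel_measurable_Pair, intro borel_measurable_vec[where 'b="real ^ 'd"]) simp_all
  moreover have "AE \<omega> in P. solves (noise \<omega>) (joint_control h) (joint_feedback g) (joint_state X Y \<omega>)"
  proof -
    have "AE \<omega> in P. \<omega> \<in> space P" by (rule AE_space)
    with sol[unfolded strong_solution_def, THEN conjunct2, THEN conjunct2, THEN conjunct2, THEN conjunct2]
    show ?thesis
      by eventually_elim (simp only: solves_joint_state_iff[OF h g c])
  qed
  ultimately show ?thesis using c by (simp add: process_def)
qed

lemma solution_exists:
  assumes h: "joint_control h \<in> controls" and g: "feedback (joint_feedback g)"
  shows "\<exists>X Y. solution h g X Y"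
proof -
  have W: "W n t \<in> borel_measurable (F t)" if "t \<in> {0..T}" for n t
    using brownian[of n] that unfolding brownian_motion_def by simp
  have Wc: "continuous_on {0..T} (\<lambda>t. W n t \<omega>)" if "\<omega> \<in> space P" for n \<omega>
  proof (rule continuous_on_subset)
    show "continuous_on {0..} (\<lambda>t. W n t \<omega>)"
      using brownian[of n] that unfolding brownian_motion_def by simp
  qed auto
  have X0: "X0 n \<in> borel_measurable (F t)" if "t \<in> {0..T}" for n t
    using measurable_from_subalg[OF filtration(2)[of 0 t] initial[of n]] that by simp
  obtain Z where Z: "\<And>\<omega>. \<omega> \<in> space P \<Longrightarrow> solves (noise \<omega>) (joint_control h) (joint_feedback g) (Z \<omega>)"
    "\<And>t. t \<in> {0..T} \<Longrightarrow> (\<lambda>\<omega>. Z \<omega> t) \<in> borel_measurable (F t)"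
  proof (rule adapted_solution_exists[OF h g filtration, where w=noise])
    show "continuous_on {0..T} (noise \<omega>)" if "\<omega> \<in> space P" for \<omega>
      unfolding noise_def using Wc[OF that]
      by (intro continuous_on_Pair continuous_on_vec_lambda continuous_intros)
    show "(\<lambda>\<omega>. noise \<omega> t) \<in> borel_measurable (F t)" if "t \<in> {0..T}" for t
      unfolding noise_def using W[OF that] X0[OF that]
      by (intro borel_measurable_Pair, intro borel_measurable_vec[where 'b="real ^ 'd"]) simp_all
  qed auto
  define X where "X n t \<omega> = fst (Z \<omega> t) $ n" for n t \<omega>
  define Y where "Y t \<omega> = snd (Z \<omega> t)" for t \<omega>
  have js: "joint_state X Y \<omega> = Z \<omega>" for \<omega>
    by (simp add: fun_eq_iff joint_state_def X_def Y_def prod_eq_iff vec_eq_iff)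
  have c: "continuous_on {0..T} (Z \<omega>)" if "\<omega> \<in> space P" for \<omega>
    using Z(1)[OF that] by (simp add: solves_def)
  have "solution h g X Y"
    unfolding strong_solution_def
  proof (intro conjI ballI allI)
    show "X n t \<in> borel_measurable (F t)" if "t \<in> {0..T}" for n t
      unfolding X_def[abs_def]
      by (rule measurable_compose[OF Z(2)[OF that] borel_measurable_continuous_onI]) (intro continuous_intros)
    show "Y t \<in> borel_measurable (F t)" if "t \<in> {0..T}" for t
      unfolding Y_def[abs_def]
      by (rule measurable_compose[OF Z(2)[OF that] borel_measurable_continuous_onI]) (intro continuous_intros)
    show "continuous_on {0..T} (\<lambda>t. X n t \<omega>)" if "\<omega> \<in> space P" for n \<omega>
      unfolding X_def by (intro continuous_intros c that)
    show "continuous_on {0..T} (\<lambda>t. Y t \<omega>)" if "\<omega> \<in> space P" for \<omega>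
      unfolding Y_def by (intro continuous_intros c that)
    have "AE \<omega> in P. solves (noise \<omega>) (joint_control h) (joint_feedback g) (joint_state X Y \<omega>)"
      using Z(1) js by (intro AE_I2) simp
    then show "AE \<omega> in P. \<forall>t\<in>{0..T}.
      (\<forall>n. X n t \<omega> = X0 n \<omega> +
        (LINT s:{0..t}|lborel.
           (1 / real CARD('n)) *\<^sub>R (\<Sum>l\<in>UNIV. H1 (X l s \<omega> - X n s \<omega>)) +
           (1 / real CARD('m)) *\<^sub>R (\<Sum>j\<in>UNIV. K1 (Y s \<omega> $ j - X n s \<omega>))) +
        sqrt (2 * \<sigma>) *\<^sub>R W n t \<omega>) \<and>
      (\<forall>i. Y t \<omega> $ i = Y0 $ i +
        (LINT s:{0..t}|lborel.
           (1 / real CARD('n)) *\<^sub>R (\<Sum>l\<in>UNIV. K2 (Y s \<omega> $ i - X l s \<omega>)) +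
           (1 / real CARD('m)) *\<^sub>R (\<Sum>j\<in>UNIV. H2 (Y s \<omega> $ j - Y s \<omega> $ i)) +
           h i s *v g i (empirical (\<lambda>l. X l s \<omega>))))"
      using AE_space
    proof eventually_elim
      case (elim \<omega>)
      have "continuous_on {0..T} (joint_state X Y \<omega>)" using c[OF elim(2)] js by simp
      from elim(1)[unfolded solves_joint_state_iff[OF h g this]] show ?case .
    qed
  qed
  then show ?thesis by blast
qed

section \<open>The objective and its minimizer\<close>

lemma control_tuplesD:
  assumes "(h, g) \<in> control_tuples T U M L"
  shows "joint_control h \<in> controls" "feedback (joint_feedback g)"
proof -
  have "\<And>i. h i \<in> L1_controls T U" "\<And>i. g i \<in> lipschitz_feedbacks M L"
    using assms by (simp_all add: control_tuples_def control_pairs_def)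
  from joint_control_in_controls[OF this(1)] feedback_joint_feedback[OF this(2)]
  show "joint_control h \<in> controls" "feedback (joint_feedback g)" .
qed

abbreviation objective where
  "objective \<equiv> cost_functional P F T \<sigma> H1 H2 K1 K2 X0 Y0 W \<L> \<Psi>"

text \<open>The choice operator in \<open>cost_functional\<close> returns a solution because one
  exists. Which one remains unspecified, so the process \<open>Z\<close> is only obtained and later
  estimates must hold for arbitrary processes.\<close>

lemma objective_eq_cost:
  assumes "(h, g) \<in> control_tuples T U M L"
  obtains Z where "process (joint_control h) (joint_feedback g) Z"
    "objective (h, g) = cost (joint_control h) (joint_feedback g) Z"
proof -
  note hg = control_tuplesD[OF assms]
  define XY where "XY = (SOME (X, Y). solution h g X Y)"
  have "\<exists>p. case p of (X, Y) \<Rightarrow> solution h g X Y" using solution_exists[OF hg] by auto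
  then have sol: "case XY of (X, Y) \<Rightarrow> solution h g X Y" unfolding XY_def by (rule someI_ex)
  obtain X Y where XY: "XY = (X, Y)" by fastforce
  show ?thesis
  proof (rule that[of "joint_state X Y"])
    show "process (joint_control h) (joint_feedback g) (joint_state X Y)"
      using process_joint_state[OF hg] sol XY by simp
    have "objective (h, g) = expected_cost P T \<L> \<Psi> h g X Y"
      using XY by (simp add: cost_functional_def XY_def)
    also have "\<dots> = cost (joint_control h) (joint_feedback g) (joint_state X Y)"
      by (simp add: expected_cost_def cost_def running_def effort_def state_cost_def joint_state_def
          joint_control_def joint_feedback_def)
    finally show "objective (h, g) = cost (joint_control h) (joint_feedback g) (joint_state X Y)" .
  qed
qed

lemma control_tuples_nonempty:
  "control_tuples T U M L \<noteq> ({} :: (('m \<Rightarrow> _) \<times> ('m \<Rightarrow> _)) set)"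
proof -
  obtain u where u: "u \<in> U" using control_set(3) by blast
  have "(\<lambda>_. u) \<in> L1_controls T U"
    using u by (auto simp: L1_controls_def intro!: borel_integrable_atLeastAtMost')
  then have "(\<lambda>_ _. u, \<lambda>_ _. 0) \<in> control_tuples T U M L"
    using zero_in_lipschitz_feedbacks[of M L] M_pos L_pos by (auto simp: control_tuples_def control_pairs_def)
  then show ?thesis by blast
qed

lemma minimizer_exists:
  "\<exists>p\<in>control_tuples T U M L. \<forall>q\<in>control_tuples T U M L. objective p \<le> objective q"
proof -
  let ?E = "control_tuples T U M L :: (('m \<Rightarrow> _) \<times> ('m \<Rightarrow> _)) set"
  obtain h0 g0 where p0: "(h0, g0) \<in> ?E" using control_tuples_nonempty by fastforce
  obtain Z0 where Z0: "process (joint_control h0) (joint_feedback g0) Z0"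
    using objective_eq_cost[OF p0] by blast
  show ?thesis
  proof (cases "integrable P (running Z0)")
    case False
    text \<open>Here the Bochner integral of every admissible control takes the junk value \<open>0\<close>:
      trajectories of different controls stay within bounded distance, so that none of the running
      costs is integrable.\<close>
    have "objective q = 0" if "q \<in> ?E" for q
    proof -
      obtain h g where q: "q = (h, g)" by fastforce
      note hg = that[unfolded q]
      obtain Z where Z: "process (joint_control h) (joint_feedback g) Z"
        "objective (h, g) = cost (joint_control h) (joint_feedback g) Z"
        using objective_eq_cost[OF hg] by blast
      have "\<not> integrable P (running Z)"
        using running_integrable_iff[OF control_tuplesD(1)[OF p0] control_tuplesD(1)[OF hg]
            control_tuplesD(2)[OF p0] control_tuplesD(2)[OF hg] Z0 Z(1)] False by simp
      then show ?thesis
        using cost_not_integrable[OF control_tuplesD[OF hg] Z(1)] Z(2) q by simp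
    qed
    then show ?thesis using p0 by auto
  next
    case True
    obtain c where c: "\<And>h \<gamma> Z. h \<in> controls \<Longrightarrow> feedback \<gamma> \<Longrightarrow> process h \<gamma> Z \<Longrightarrow> c \<le> cost h \<gamma> Z"
      using cost_bounded_below[OF control_tuplesD[OF p0] Z0 True] by blast
    have below: "c \<le> objective q" if "q \<in> ?E" for q
    proof -
      obtain h g where q: "q = (h, g)" by fastforce
      show ?thesis using objective_eq_cost[OF that[unfolded q]] c control_tuplesD[OF that[unfolded q]] q by metis
    qed
    then have bdd: "bdd_below (objective ` ?E)" by (intro bdd_belowI2)
    define J where "J = (INF q\<in>?E. objective q)"
    have J: "J \<le> objective q" if "q \<in> ?E" for q
      unfolding J_def using bdd that by (rule cINF_lower)
    have "\<exists>q\<in>?E. objective q < J + 1 / real (Suc k)" for k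
      using cInf_lessD[of "objective ` ?E" "J + 1 / real (Suc k)"] control_tuples_nonempty
      unfolding J_def by auto
    then obtain q where q: "\<And>k. q k \<in> ?E" "\<And>k. objective (q k) < J + 1 / real (Suc k)" by metis
    have lim_J: "(\<lambda>k. objective (q k)) \<longlonglongrightarrow> J"
    proof (rule real_tendsto_sandwich[where f="\<lambda>_. J" and h="\<lambda>k. J + 1 / real (Suc k)"])
      show "(\<lambda>k. J + 1 / real (Suc k)) \<longlonglongrightarrow> J"
        using tendsto_add[OF tendsto_const LIMSEQ_inverse_real_of_nat, of J] by (simp add: inverse_eq_divide)
      show "\<forall>\<^sub>F k in sequentially. J \<le> objective (q k)" using J[OF q(1)] by simp
      show "\<forall>\<^sub>F k in sequentially. objective (q k) \<le> J + 1 / real (Suc k)"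
        using q(2) by (simp add: less_imp_le)
    qed simp
    define h where "h k = joint_control (fst (q k))" for k
    define g where "g k = snd (q k)" for k
    have qE: "(fst (q k), g k) \<in> ?E" for k using q(1)[of k] by (simp add: g_def)
    have h: "h k \<in> controls" and \<gamma>: "feedback (joint_feedback (g k))" for k
      using control_tuplesD[OF qE] by (simp_all add: h_def)
    have "\<exists>Z. process (h k) (joint_feedback (g k)) Z \<and> objective (q k) = cost (h k) (joint_feedback (g k)) Z" for k
      using objective_eq_cost[OF qE[of k]] unfolding h_def g_def prod.collapse by metis
    then obtain Z where Z: "\<And>k. process (h k) (joint_feedback (g k)) (Z k)"
      "\<And>k. objective (q k) = cost (h k) (joint_feedback (g k)) (Z k)" by metis
    obtain r1 :: "nat \<Rightarrow> nat" and H where r1: "strict_mono r1"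
      "\<And>t. t \<in> {0..T} \<Longrightarrow> (\<lambda>k. LINT s:{0..t}|lborel. h (r1 k) s) \<longlonglongrightarrow> H t"
    proof (rule control_subsequence[OF h])
      fix r :: "nat \<Rightarrow> nat" and H
      assume "strict_mono r" "\<And>t. t \<in> {0..T} \<Longrightarrow> (\<lambda>k. LINT s:{0..t}|lborel. h (r k) s) \<longlonglongrightarrow> H t"
      then show thesis by (rule that)
    qed
    \<comment> \<open>A subsequence of the previous one, so the limit \<open>H\<close> of the
      primitives persists. The limit \<open>\<gamma>'\<close> is so far a function of the state, not
      yet a map on measures.\<close>
    obtain r2 :: "nat \<Rightarrow> nat" and \<gamma>' where r2: "strict_mono r2" "feedback \<gamma>'"
      "\<And>x. (\<lambda>k. joint_feedback (g (r1 (r2 k))) x) \<longlonglongrightarrow> \<gamma>' x"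
      using feedback_subsequence[of "\<lambda>k. joint_feedback (g (r1 k))"] \<gamma> by blast
    define r where "r k = r1 (r2 k)" for k
    have r: "strict_mono r" using r1(1) r2(1) by (simp add: r_def strict_mono_def)
    have H: "(\<lambda>k. LINT s:{0..t}|lborel. h (r k) s) \<longlonglongrightarrow> H t" if "t \<in> {0..T}" for t
      using LIMSEQ_subseq_LIMSEQ[OF r1(2)[OF that] r2(1)] by (simp add: comp_def r_def)
    have int: "integrable P (running (Z (r 0)))"
      using running_integrable_iff[OF control_tuplesD(1)[OF p0] h control_tuplesD(2)[OF p0] \<gamma> Z0 Z(1)] True by blast
    have cost_lim: "(\<lambda>k. cost (h (r k)) (joint_feedback (g (r k))) (Z (r k))) \<longlonglongrightarrow> J"
      using LIMSEQ_subseq_LIMSEQ[OF lim_J r] by (simp add: comp_def Z(2))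
    obtain h' where h': "h' \<in> controls" "\<And>Z'. process h' \<gamma>' Z' \<Longrightarrow> cost h' \<gamma>' Z' \<le> J"
    proof (rule cost_lower_semicontinuous[of "\<lambda>k. h (r k)" "\<lambda>k. joint_feedback (g (r k))" \<gamma>' "\<lambda>k. Z (r k)" H J])
      show "(\<lambda>k. joint_feedback (g (r k)) x) \<longlonglongrightarrow> \<gamma>' x" for x using r2(3) by (simp add: r_def)
    qed (use h \<gamma> r2(2) Z(1) int H cost_lim in auto)
    have "g k i \<in> lipschitz_feedbacks M L" for k i
      using qE[of k] by (auto simp: control_tuples_def control_pairs_def)
    then obtain gs where gs: "\<And>i. gs i \<in> lipschitz_feedbacks M L"
      "\<And>i \<mu> l. \<mu> \<in> wasserstein_space 1 \<Longrightarrow> (\<lambda>k. g (r k) i \<mu>) \<longlonglongrightarrow> l \<Longrightarrow> gs i \<mu> = l"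
      using lipschitz_feedbacks_cluster_point[of "\<lambda>k. g (r k)" M L] by metis
    \<comment> \<open>At empirical measures the feedbacks converge along \<open>r\<close>, so the
      cluster point must take the limit values there. Hence \<open>\<gamma>'\<close> is induced by
      an admissible tuple of feedbacks.\<close>
    have \<gamma>'_eq: "joint_feedback gs = \<gamma>'"
    proof
      fix x
      have "gs i (empirical (\<lambda>n. fst x $ n)) = \<gamma>' x $ i" for i
      proof (rule gs(2)[OF empirical_in_wasserstein_space])
        show "(\<lambda>k. g (r k) i (empirical (\<lambda>n. fst x $ n))) \<longlonglongrightarrow> \<gamma>' x $ i"
          using tendsto_vec_nth[OF r2(3)[of x], of i] by (simp add: joint_feedback_def r_def)
      qed
      then show "joint_feedback gs x = \<gamma>' x" by (simp add: joint_feedback_def vec_eq_iff)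
    qed
    define hs where "hs i t = h' t $ i" for i t
    have h'_eq: "joint_control hs = h'" by (simp add: joint_control_def hs_def fun_eq_iff vec_eq_iff)
    have pE: "(hs, gs) \<in> ?E"
      using component_in_L1_controls[OF h'(1)] gs(1) by (auto simp: control_tuples_def control_pairs_def hs_def[abs_def])
    \<comment> \<open>\<open>Z'\<close> comes from the version that the objective selects for the
      limit pair; the semicontinuity estimate \<open>h'(2)\<close> applies to it as to any
      other.\<close>
    obtain Z' where "process h' \<gamma>' Z'" "objective (hs, gs) = cost h' \<gamma>' Z'"
      using objective_eq_cost[OF pE] unfolding h'_eq \<gamma>'_eq by blast
    then have "objective (hs, gs) \<le> J" using h'(2) by simp
    then show ?thesis using pE J order_trans by blast
  qed
qed

end

theorem theorem4p2:
  fixes P :: "'w measure" and F :: "real \<Rightarrow> 'w measure"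
    and T \<sigma> M L p :: real
    and H1 H2 K1 K2 :: "real ^ 'd \<Rightarrow> real ^ 'd"
    and \<mu>0 :: "(real ^ 'd) measure"
    and X0 :: "'n::finite \<Rightarrow> 'w \<Rightarrow> real ^ 'd"
    and Y0 :: "real ^ 'd ^ 'm"
    and W :: "'n \<Rightarrow> real \<Rightarrow> 'w \<Rightarrow> real ^ 'd"
    and U :: "(real ^ 'l ^ 'd) set"
    and \<Psi> :: "real ^ 'l ^ 'd ^ 'm \<Rightarrow> real ^ 'l ^ 'm \<Rightarrow> real"
    and \<L> :: "real \<Rightarrow> real ^ 'd ^ 'm \<Rightarrow> (real ^ 'd) measure \<Rightarrow> real"
  assumes "prob_space P"
    and "\<And>t. 0 \<le> t \<Longrightarrow> subalgebra P (F t)"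
    and "\<And>s t. 0 \<le> s \<Longrightarrow> s \<le> t \<Longrightarrow> subalgebra (F t) (F s)"
    and "T > 0" and "\<sigma> > 0" and "M > 0" and "L > 0"
    and "\<exists>C. C-lipschitz_on UNIV H1" and "\<exists>C. C-lipschitz_on UNIV H2"
    and "\<exists>C. C-lipschitz_on UNIV K1" and "\<exists>C. C-lipschitz_on UNIV K2"
    and "p > 1" and "\<mu>0 \<in> wasserstein_space p"
    and "\<And>n. X0 n \<in> borel_measurable (F 0)"
    and "prob_space.indep_vars P (\<lambda>_. borel) X0 UNIV"
    and "\<And>n. distr P borel (X0 n) = \<mu>0"
    and "\<And>n. brownian_motion P F (W n)"
    and "prob_space.indep_vars P (\<lambda>_. Pi\<^sub>M {0..} (\<lambda>_. borel))
           (\<lambda>n \<omega>. \<lambda>t\<in>{0..}. W n t \<omega>) UNIV"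
    and "compact U" and "convex U" and "U \<noteq> {}"
    and "continuous_on UNIV (\<lambda>(a, b). \<Psi> a b)"
    and "\<And>b. convex_on UNIV (\<lambda>a. \<Psi> a b)"
    and "uniformly_continuous_cost T \<L>"
  shows "\<exists>(hs, gs) \<in> control_tuples T U M L. \<forall>(h, g) \<in> control_tuples T U M L.
    cost_functional P F T \<sigma> H1 H2 K1 K2 X0 Y0 W \<L> \<Psi> (hs, gs)
      \<le> cost_functional P F T \<sigma> H1 H2 K1 K2 X0 Y0 W \<L> \<Psi> (h, g)"
proof -
  obtain C where C: "C-lipschitz_on UNIV (drift H1 H2 K1 K2 :: (real ^ 'd ^ 'n) \<times> (real ^ 'd ^ 'm) \<Rightarrow> _)"
    using lipschitz_on_drift assms(8-11) by blast
  obtain K where K: "0 < K"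
    "\<And>a c. norm (actuation a c :: (real ^ 'd ^ 'n) \<times> (real ^ 'd ^ 'm)) \<le> norm (a :: real ^ 'l ^ 'd ^ 'm) * norm c * K"
    using bounded_bilinear.pos_bounded[OF bounded_bilinear_actuation] by blast
  obtain R where R: "0 < R" "\<And>u. u \<in> U \<Longrightarrow> norm u \<le> R"
    using compact_imp_bounded[OF \<open>compact U\<close>] unfolding bounded_pos by blast
  \<comment> \<open>\<open>R\<close> bounds a single control value in \<open>U\<close>; a tuple of
    \<open>CARD('m)\<close> such values has norm at most \<open>CARD('m) * R\<close>.\<close>
  interpret mean_field_control P F T \<sigma> M L C K "real CARD('m) * R" H1 H2 K1 K2 X0 Y0 W U \<Psi> \<L>
  proof (intro mean_field_control.intro mean_field_control_axioms.intro)
    show "norm (a :: real ^ 'l ^ 'd ^ 'm) \<le> real CARD('m) * R" if "\<forall>i. a $ i \<in> U" for a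
      using that R(2) by (intro norm_vec_le) auto
    show "norm (actuation a c :: (real ^ 'd ^ 'n) \<times> (real ^ 'd ^ 'm)) \<le> K * norm (a :: real ^ 'l ^ 'd ^ 'm) * norm c" for a c
      using K(2)[of a c] by (simp add: mult_ac)
    show "0 < real CARD('m) * R" using R(1) by simp
    show "prob_space P" by fact
    show "subalgebra P (F t)" if "0 \<le> t" for t using that by (rule assms(2))
    show "subalgebra (F t) (F s)" if "0 \<le> s" "s \<le> t" for s t using that by (rule assms(3))
    show "0 < T" "0 < M" "0 < L" "0 < K" by fact+
    show "X0 n \<in> borel_measurable (F 0)" "brownian_motion P F (W n)" for n by (rule assms)+
    show "compact U" "convex U" "U \<noteq> {}" by fact+
    show "continuous_on UNIV (\<lambda>(a, b). \<Psi> a b)" "convex_on UNIV (\<lambda>a. \<Psi> a b)" for b by (rule assms)+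
    show "uniformly_continuous_cost T \<L>" by fact
  qed (rule C)
  show ?thesis using minimizer_exists by auto
qed

end
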